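(* Let $(\mathcal{G},\|\cdot\|)$ be an arithmetical semigroup satisfying Axiom $A$ with constant $c_{\mathcal{G}}$, and let $S\subseteq\mathcal{P}$ have natural density $\delta(S)$. Let $f\colon[1,\infty)\to\mathbb{C}$ be bounded with $f(1)=0$, and let $a\colon\mathcal{G}\to\mathbb{C}$ be supported on $\mathfrak{D}(\mathcal{G},S)$ with $a(e_{\mathcal{G}})=1$ and $\lim_{x\to\infty}\sum_{2\le\|g\|\le x,\ g\in\mathfrak{D}(\mathcal{G},S)}\frac{|a(g)|}{\|g\|}\log\log\|g\|<\infty$. Then the following are equivalent: (i) $\sum_{\|g\|\le x}Q_S(g)f(\mathrm{N}^+(g))=c_{\mathcal{G}}\delta(S)x+o(x)$ as $x\to\infty$; (ii) $-\lim_{x\to\infty}\sum_{\|g\|\le x,\ g\in\mathfrak{D}(\mathcal{G},S),\ g\ne e_{\mathcal{G}}}\frac{\mu(g)f(\mathrm{N}_-(g))}{\|g\|}=\delta(S)$; (iii) $-\lim_{x\to\infty}\sum_{\|g\|\le x,\ g\in\mathfrak{D}(\mathcal{G},S),\ g\ne e_{\mathcal{G}}}\frac{(\mu*a)(g)f(\mathrm{N}_-(g))}{\|g\|}=\delta(S)$.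
   Context: An arithmetical semigroup is a commutative monoid $\mathcal{G}$ with identity $e_{\mathcal{G}}$ freely generated by a finite or countable set $\mathcal{P}$ of primes, with a multiplicative norm $\|\cdot\|$, $\|e_{\mathcal{G}}\|=1$, $\|P\|>1$ for primes, $\mathcal{N}(x)=\#\{g:\|g\|\le x\}<\infty$. Axiom $A$: $\mathcal{N}(x)=c_{\mathcal{G}}x+O(x^{\eta})$ with $c_{\mathcal{G}}>0$, $0<\eta<1$. Natural density: $\delta(S)=\lim_{x\to\infty}\#\{P\in S:\|P\|\le x\}/\#\{P\in\mathcal{P}:\|P\|\le x\}$. $h\mid g$ means $g=hr$. For $g\ne e_{\mathcal{G}}$, $\mathrm{N}_-(g)$ and $\mathrm{N}^+(g)$ are the minimal and maximal norms of primes dividing $g$; $\mathrm{N}^+(e_{\mathcal{G}})=1$. $g$ is distinguishable if $g\ne e_{\mathcal{G}}$ and exactly one prime $P_{\min}(g)\mid g$ has norm $\mathrm{N}_-(g)$; $\mathfrak{D}(\mathcal{G},S)=\{g\text{ distinguishable}:P_{\min}(g)\in S\}\cup\{e_{\mathcal{G}}\}$. $Q_S(g)=\#\{P\in S:P\mid g,\ \|P\|=\mathrm{N}^+(g)\}$. $\mu$ is the Möbius function; $(\mu*a)(g)=\sum_{h\mid g}\mu(h)a(g/h)$; $a$ supported on $\mathfrak{D}(\mathcal{G},S)$ means it vanishes outside it. *)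

theory Defs
  imports "HOL-Analysis.Analysis" "HOL-Library.Multiset" "HOL-Library.Landau_Symbols"
begin

text \<open>An arithmetical semigroup freely generated by a set P of primes (of type 'p) is
modelled as the finite multisets over P; the identity is the empty multiset,
multiplication is multiset union, and divisibility is sub-multiset inclusion.
The norm is given by its values Np on primes, extended multiplicatively.\<close>

definition gelems :: "'p set \<Rightarrow> 'p multiset set" where
  "gelems P = {g. set_mset g \<subseteq> P}"

definition gnorm :: "('p \<Rightarrow> real) \<Rightarrow> 'p multiset \<Rightarrow> real" where
  "gnorm Np g = prod_mset (image_mset Np g)"

definition countN :: "'p set \<Rightarrow> ('p \<Rightarrow> real) \<Rightarrow> real \<Rightarrow> nat" where
  "countN P Np x = card {g \<in> gelems P. gnorm Np g \<le> x}"

definition arith_semigroup :: "'p set \<Rightarrow> ('p \<Rightarrow> real) \<Rightarrow> bool" where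
  "arith_semigroup P Np \<longleftrightarrow> countable P \<and> (\<forall>p\<in>P. Np p > 1)
     \<and> (\<forall>x. finite {g \<in> gelems P. gnorm Np g \<le> x})"

definition axiomA :: "'p set \<Rightarrow> ('p \<Rightarrow> real) \<Rightarrow> real \<Rightarrow> bool" where
  "axiomA P Np c \<longleftrightarrow> c > 0 \<and> (\<exists>\<eta>. 0 < \<eta> \<and> \<eta> < 1 \<and>
     (\<lambda>x. real (countN P Np x) - c * x) \<in> O[at_top](\<lambda>x. x powr \<eta>))"

definition has_nat_density :: "'p set \<Rightarrow> ('p \<Rightarrow> real) \<Rightarrow> 'p set \<Rightarrow> real \<Rightarrow> bool" where
  "has_nat_density P Np S d \<longleftrightarrow>
     ((\<lambda>x. real (card {p \<in> S. Np p \<le> x}) / real (card {p \<in> P. Np p \<le> x})) \<longlongrightarrow> d) at_top"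

definition Nminus :: "('p \<Rightarrow> real) \<Rightarrow> 'p multiset \<Rightarrow> real" where
  "Nminus Np g = Min (Np ` set_mset g)"

definition Nplus :: "('p \<Rightarrow> real) \<Rightarrow> 'p multiset \<Rightarrow> real" where
  "Nplus Np g = (if g = {#} then 1 else Max (Np ` set_mset g))"

definition distinguishable :: "('p \<Rightarrow> real) \<Rightarrow> 'p multiset \<Rightarrow> bool" where
  "distinguishable Np g \<longleftrightarrow> g \<noteq> {#} \<and> card {p \<in> set_mset g. Np p = Nminus Np g} = 1"

definition Pmin :: "('p \<Rightarrow> real) \<Rightarrow> 'p multiset \<Rightarrow> 'p" where
  "Pmin Np g = (THE p. p \<in># g \<and> Np p = Nminus Np g)"

definition Dset :: "'p set \<Rightarrow> ('p \<Rightarrow> real) \<Rightarrow> 'p set \<Rightarrow> 'p multiset set" where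
  "Dset P Np S = {g \<in> gelems P. distinguishable Np g \<and> Pmin Np g \<in> S} \<union> {{#}}"

definition QS :: "('p \<Rightarrow> real) \<Rightarrow> 'p set \<Rightarrow> 'p multiset \<Rightarrow> nat" where
  "QS Np S g = card {p \<in> S. p \<in># g \<and> Np p = Nplus Np g}"

definition gmoebius :: "'p multiset \<Rightarrow> complex" where
  "gmoebius g = (if \<forall>p. count g p \<le> 1 then (-1) ^ size g else 0)"

definition gconv :: "('p multiset \<Rightarrow> complex) \<Rightarrow> ('p multiset \<Rightarrow> complex) \<Rightarrow> 'p multiset \<Rightarrow> complex" where
  "gconv u v g = (\<Sum>h\<in>{h. h \<subseteq># g}. u h * v (g - h))"

end

theory Submission
  imports Defs "HOL-Complex_Analysis.Complex_Analysis"
begin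

text \<open>
  Summing \<open>\<mu>(h) f(N\<^sub>-(h))\<close> over the divisors \<open>h \<in> \<DD>(\<G>, S)\<close>, \<open>h \<noteq> e\<close>, of \<open>g\<close> gives \<open>- Q\<^sub>S(g) f(N\<^sup>+(g))\<close>
  (Alladi's duality). Hence the sum in (i) is \<open>- c x\<close> times the sum in (ii), up to
  \<open>\<Sum> \<mu>(h) f(N\<^sub>-(h)) E(x / \<parallel>h\<parallel>)\<close> with \<open>E(y) = \<N>(y) - c y = O(y\<^sup>\<eta>)\<close>. Elements without small prime factors are
  too sparse to matter there, and those with a given smallest prime contribute \<open>o(x)\<close> because
  \<open>\<Sum> \<mu>(h) / \<parallel>h\<parallel>\<close>, over all \<open>h\<close> avoiding a fixed finite set of primes, converges to \<open>0\<close>. This last fact has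
  the strength of the prime number theorem: it follows from Newman's Tauberian theorem and the
  non-vanishing of \<open>\<zeta>\<close> on \<open>Re s = 1\<close>.

  For (iii), expanding \<open>\<mu> * a\<close> gives the sum in (ii) plus \<open>\<Sum> a(k) / \<parallel>k\<parallel> I\<^sub>k(x / \<parallel>k\<parallel>)\<close> over \<open>k \<noteq> e\<close>, where
  \<open>I\<^sub>k(y)\<close> tends to \<open>0\<close> for each \<open>k\<close> and is bounded by a multiple of \<open>1 + \<Sum> 1 / \<parallel>p\<parallel>\<close> over \<open>\<parallel>p\<parallel> \<le> \<parallel>k\<parallel>\<close>,
  hence of \<open>log log \<parallel>k\<parallel>\<close>; dominated convergence applies.
\<close>

section \<open>Elements of bounded norm and partial summation\<close>

text \<open>The obstacle is that \<open>K * y powr \<eta>\<close> bounds the counting error, but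
  summing it trivially over all \<open>h\<close> gives only O(x) where o(x) is needed. The saving
  for small primes comes from an exact identity: off a set A of primes, the Moebius function
  convolved with 1 is the indicator of the elements supported on A, so its error sum equals the
  number of those elements minus \<open>c * y\<close> times a Moebius sum. The same identity, read
  backwards, bounds these Moebius sums by one constant for all A. That uniformity is why the price
  of \<open>a\<close> in (iii) is only a sum of reciprocals of primes, hence the weight log log.

  Distinct primes may share a norm. So the primes excluded together with p are all those of norm at
  most that of p, and a smallest prime has to be strictly smallest.

  Newman's theorem is applied to the summatory function M of the Moebius function, since M(u) / u is
  bounded trivially. It yields only the difference of the sum of \<mu>(h) / ||h|| and M(X) / X; the
  slow variation of M then separates the two.\<close>

lemma gelems_add_iff [simp]: "g + h \<in> gelems P \<longleftrightarrow> g \<in> gelems P \<and> h \<in> gelems P"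
  by (auto simp: gelems_def)

lemma gelems_empty [simp]: "{#} \<in> gelems P"
  by (simp add: gelems_def)

lemma gelems_subset_mset: "h \<subseteq># g \<Longrightarrow> g \<in> gelems P \<Longrightarrow> h \<in> gelems P"
  unfolding gelems_def using set_mset_mono by fastforce

lemma gelems_mono: "A \<subseteq> B \<Longrightarrow> gelems A \<subseteq> gelems B"
  by (auto simp: gelems_def)

lemma gnorm_empty [simp]: "gnorm Np {#} = 1"
  by (simp add: gnorm_def)

lemma gnorm_add: "gnorm Np (g + h) = gnorm Np g * gnorm Np h"
  by (simp add: gnorm_def)

lemma gnorm_add_mset: "gnorm Np (add_mset p h) = Np p * gnorm Np h"
  by (simp add: gnorm_def)

lemma finite_submultisets: "finite {h. h \<subseteq># (g :: 'a multiset)}"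
proof (induction g)
  case empty
  then show ?case by simp
next
  case (add x g)
  have "{h. h \<subseteq># add_mset x g} \<subseteq> {h. h \<subseteq># g} \<union> add_mset x ` {h. h \<subseteq># g}"
  proof
    fix h assume "h \<in> {h. h \<subseteq># add_mset x g}"
    then have h: "h \<subseteq># add_mset x g" by simp
    show "h \<in> {h. h \<subseteq># g} \<union> add_mset x ` {h. h \<subseteq># g}"
    proof (cases "x \<in># h")
      case True
      then obtain h' where "h = add_mset x h'" by (meson mset_add)
      then show ?thesis using h by auto
    next
      case False
      have "h \<subseteq># g"
      proof (rule mset_subset_eqI)
        fix a show "count h a \<le> count g a"
          using mset_subset_eq_count[OF h, of a] False by (cases "a = x") (auto simp: not_in_iff)
      qed
      then show ?thesis by simp
    qed
  qed
  then show ?case using add.IH by (meson finite_UnI finite_imageI finite_subset)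
qed

section \<open>Moebius sums over divisors\<close>

lemma sum_Pow_alternating:
  assumes "finite A"
  shows "(\<Sum>T\<in>Pow A. (-1) ^ card T) = (if A = {} then 1 else (0 :: complex))"
proof (cases "A = {}")
  case False
  then obtain p B where A: "A = insert p B" "p \<notin> B" by (meson ex_in_conv mk_disjoint_insert)
  have B: "finite B" using assms A by simp
  have "(\<Sum>T\<in>Pow A. (-1) ^ card T :: complex)
      = (\<Sum>T\<in>Pow B. (-1) ^ card T) + (\<Sum>T\<in>insert p ` Pow B. (-1) ^ card T)"
    unfolding A(1) Pow_insert using A(2) B by (intro sum.union_disjoint) auto
  also have "(\<Sum>T\<in>insert p ` Pow B. (-1) ^ card T :: complex) = (\<Sum>T\<in>Pow B. (-1) ^ card (insert p T))"
    using A(2) by (subst sum.reindex) (auto simp: inj_on_def)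
  also have "\<dots> = (\<Sum>T\<in>Pow B. - ((-1) ^ card T))"
  proof (rule sum.cong)
    fix T assume "T \<in> Pow B"
    then have "finite T" "p \<notin> T" using A B finite_subset by auto
    then show "(-1) ^ card (insert p T) = - ((-1) ^ card T :: complex)" by simp
  qed simp
  finally show ?thesis using False by (simp add: sum_negf)
qed simp

lemma gmoebius_mset_set: "finite T \<Longrightarrow> gmoebius (mset_set T) = (-1) ^ card T"
  by (auto simp: gmoebius_def count_mset_set')

lemma gmoebius_nonzero_imp_mset_set:
  assumes "gmoebius h \<noteq> 0" shows "h = mset_set (set_mset h)"
proof (rule multiset_eqI)
  fix p
  have "count h p \<le> 1" using assms by (auto simp: gmoebius_def split: if_splits)
  then show "count h p = count (mset_set (set_mset h)) p"
    by (auto simp: count_mset_set' not_in_iff order.antisym Suc_leI)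
qed

lemma norm_gmoebius_le: "norm (gmoebius h) \<le> 1"
  by (simp add: gmoebius_def norm_power)

text \<open>Only squarefree divisors count, and those with primes in B match the subsets of
  \<open>set_mset g \<inter> B\<close>, so an alternating sum over subsets remains. The parameter B
  covers plain Moebius inversion (\<open>B = UNIV\<close>) as well as the Moebius function with the
  primes of A removed (\<open>B = - A\<close>).\<close>

lemma sum_gmoebius_divisors:
  "(\<Sum>h | h \<subseteq># g \<and> set_mset h \<subseteq> B. gmoebius h) = (if set_mset g \<inter> B = {} then 1 else 0)"
proof -
  let ?T = "set_mset g \<inter> B"
  have sub: "mset_set T \<subseteq># g" if "T \<subseteq> set_mset g" for T
  proof (rule mset_subset_eqI)
    fix p
    have "finite T" using that finite_subset by auto
    then show "count (mset_set T) p \<le> count g p"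
      using that by (auto simp: count_mset_set' Suc_le_eq)
  qed
  have "(\<Sum>h | h \<subseteq># g \<and> set_mset h \<subseteq> B. gmoebius h) = (\<Sum>h\<in>mset_set ` Pow ?T. gmoebius h)"
  proof (rule sum.mono_neutral_right)
    show "finite {h. h \<subseteq># g \<and> set_mset h \<subseteq> B}"
      using finite_submultisets[of g] by (rule rev_finite_subset) auto
    show "mset_set ` Pow ?T \<subseteq> {h. h \<subseteq># g \<and> set_mset h \<subseteq> B}"
    proof
      fix h assume "h \<in> mset_set ` Pow ?T"
      then obtain T where T: "T \<subseteq> ?T" "h = mset_set T" by auto
      then have "finite T" using finite_subset by auto
      then show "h \<in> {h. h \<subseteq># g \<and> set_mset h \<subseteq> B}" using T sub by auto
    qed
    show "\<forall>h\<in>{h. h \<subseteq># g \<and> set_mset h \<subseteq> B} - mset_set ` Pow ?T. gmoebius h = 0"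
    proof (intro ballI)
      fix h assume h: "h \<in> {h. h \<subseteq># g \<and> set_mset h \<subseteq> B} - mset_set ` Pow ?T"
      show "gmoebius h = 0"
      proof (rule ccontr)
        assume "gmoebius h \<noteq> 0"
        then have "h = mset_set (set_mset h)" by (rule gmoebius_nonzero_imp_mset_set)
        moreover have "set_mset h \<in> Pow ?T" using h set_mset_mono by auto
        ultimately show False using h by blast
      qed
    qed
  qed
  also have "\<dots> = (\<Sum>T\<in>Pow ?T. gmoebius (mset_set T))"
  proof (rule sum.reindex_cong[of mset_set])
    show "inj_on mset_set (Pow ?T)"
    proof (rule inj_onI)
      fix S T assume *: "S \<in> Pow ?T" "T \<in> Pow ?T" "mset_set S = mset_set T"
      then have "finite S" "finite T" using finite_subset[of _ ?T] by auto
      then show "S = T" using *(3) by (metis finite_set_mset_mset_set)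
    qed
  qed auto
  also have "\<dots> = (\<Sum>T\<in>Pow ?T. (-1) ^ card T)"
    by (intro sum.cong refl gmoebius_mset_set) (auto intro: finite_subset)
  also have "\<dots> = (if ?T = {} then 1 else 0)"
    by (rule sum_Pow_alternating) simp
  finally show ?thesis .
qed

section \<open>Counting elements and partial summation\<close>

text \<open>The O-term of Axiom A becomes an explicit K valid from 1 on. All later bounds are then
  explicit in c, K and \<eta>, which makes visible that they do not depend on the excluded set of
  primes.\<close>

locale arithmetical_semigroup =
  fixes P :: "'p set" and Np :: "'p \<Rightarrow> real" and c \<eta> K :: real
  assumes semigroup: "arith_semigroup P Np"
    and c_pos: "c > 0" and eta_pos: "\<eta> > 0" and eta_less_1: "\<eta> < 1"
    and count_approx: "x \<ge> 1 \<Longrightarrow> \<bar>real (countN P Np x) - c * x\<bar> \<le> K * x powr \<eta>"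
begin

abbreviation nm :: "'p multiset \<Rightarrow> real" where "nm \<equiv> gnorm Np"

definition elems :: "real \<Rightarrow> 'p multiset set" where
  "elems x = {g \<in> gelems P. nm g \<le> x}"

lemma finite_elems [simp]: "finite (elems x)"
  using semigroup by (simp add: elems_def arith_semigroup_def)

lemma prime_norm_gt_1: "p \<in> P \<Longrightarrow> Np p > 1"
  using semigroup by (simp add: arith_semigroup_def)

lemma countN_eq: "countN P Np x = card (elems x)"
  by (simp add: countN_def elems_def)

lemma nm_ge_1: "g \<in> gelems P \<Longrightarrow> nm g \<ge> 1"
proof (induction g)
  case (add p g)
  then have "p \<in> P" "g \<in> gelems P" by (auto simp: gelems_def)
  then have "1 * 1 \<le> Np p * nm g"
    using add.IH prime_norm_gt_1[of p] by (intro mult_mono) auto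
  then show ?case by (simp add: gnorm_add_mset)
qed simp

lemma nm_pos: "g \<in> gelems P \<Longrightarrow> nm g > 0"
  using nm_ge_1[of g] by simp

lemma prime_le_nm:
  assumes "g \<in> gelems P" "p \<in># g" shows "Np p \<le> nm g"
proof -
  obtain h where h: "g = add_mset p h" using assms(2) by (meson mset_add)
  then have "h \<in> gelems P" "p \<in> P" using assms(1) by (auto simp: gelems_def)
  then have "Np p * 1 \<le> Np p * nm h"
    using nm_ge_1[of h] prime_norm_gt_1[of p] by (intro mult_left_mono) auto
  then show ?thesis by (simp add: h gnorm_add_mset)
qed

lemma nm_eq_1_iff: "g \<in> gelems P \<Longrightarrow> nm g = 1 \<longleftrightarrow> g = {#}"
proof
  assume g: "g \<in> gelems P" "nm g = 1"
  show "g = {#}"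
  proof (rule ccontr)
    assume "g \<noteq> {#}"
    then obtain p where p: "p \<in># g" by blast
    then have "p \<in> P" using g by (auto simp: gelems_def)
    then show False using prime_le_nm[OF g(1) p] prime_norm_gt_1 g(2) by fastforce
  qed
qed simp

lemma elems_mono: "x \<le> y \<Longrightarrow> elems x \<subseteq> elems y"
  by (auto simp: elems_def)

lemma elems_empty: "x < 1 \<Longrightarrow> elems x = {}"
  using nm_ge_1 by (force simp: elems_def)

lemma elems_1: "elems 1 = {{#}}"
  using nm_ge_1 nm_eq_1_iff by (force simp: elems_def)

lemma finite_primes_le: "finite {p \<in> P. Np p \<le> x}"
proof -
  have "(\<lambda>p. {#p#}) ` {p \<in> P. Np p \<le> x} \<subseteq> elems x"
    by (auto simp: elems_def gelems_def gnorm_def)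
  then have "finite ((\<lambda>p. {#p#}) ` {p \<in> P. Np p \<le> x})"
    by (rule finite_subset) simp
  then show ?thesis by (rule finite_imageD) (simp add: inj_on_def)
qed

lemma K_nonneg: "K \<ge> 0"
  using count_approx[of 1] by simp

definition C :: real where "C = c + K"

lemma C_pos: "C > 0"
  using c_pos K_nonneg by (simp add: C_def)

lemma card_elems_approx: "x \<ge> 1 \<Longrightarrow> \<bar>real (card (elems x)) - c * x\<bar> \<le> K * x powr \<eta>"
  using count_approx[of x] by (simp add: countN_eq)

lemma card_elems_le: "x \<ge> 1 \<Longrightarrow> real (card (elems x)) \<le> C * x"
proof -
  assume x: "x \<ge> 1"
  have "x powr \<eta> \<le> x powr 1" using x eta_less_1 by (intro powr_mono) auto
  then have "K * x powr \<eta> \<le> K * x" using K_nonneg x by (intro mult_left_mono) auto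
  then show ?thesis using card_elems_approx[OF x] by (simp add: C_def algebra_simps)
qed

text \<open>Writing g = h + k turns pairs (element, divisor) into pairs whose norms have product at
  most x. Every exchange of a divisor sum with a counting sum goes through this.\<close>

lemma sum_divisors_swap:
  fixes u :: "'p multiset \<Rightarrow> 'p multiset \<Rightarrow> complex"
  shows "(\<Sum>g\<in>elems x. \<Sum>h | h \<subseteq># g. u h (g - h)) = (\<Sum>h\<in>elems x. \<Sum>k\<in>elems (x / nm h). u h k)"
proof -
  have "(\<Sum>g\<in>elems x. \<Sum>h | h \<subseteq># g. u h (g - h))
      = (\<Sum>(g, h)\<in>Sigma (elems x) (\<lambda>g. {h. h \<subseteq># g}). u h (g - h))"
    by (rule sum.Sigma) (auto simp: finite_submultisets)
  also have "\<dots> = (\<Sum>(h, k)\<in>Sigma (elems x) (\<lambda>h. elems (x / nm h)). u h k)"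
  proof (rule sum.reindex_bij_witness[of _ "\<lambda>(h, k). (h + k, h)" "\<lambda>(g, h). (h, g - h)"], goal_cases)
    case (2 a)
    then obtain g h where a: "a = (g, h)" "g \<in> elems x" "h \<subseteq># g" by auto
    then obtain k where k: "g = h + k" by (meson mset_subset_eq_exists_conv)
    have *: "h \<in> gelems P" "k \<in> gelems P" "nm h * nm k \<le> x"
      using a k by (auto simp: elems_def gnorm_add)
    have "nm h * 1 \<le> nm h * nm k" using nm_ge_1[OF *(2)] nm_pos[OF *(1)] by (intro mult_left_mono) auto
    then have "nm h \<le> x" using *(3) by linarith
    then show ?case using * nm_pos[OF *(1)] a k by (auto simp: elems_def field_simps)
  next
    case (4 b)
    then obtain h k where b: "b = (h, k)" "h \<in> elems x" "k \<in> elems (x / nm h)" by auto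
    then have "h \<in> gelems P" by (simp add: elems_def)
    then show ?case using b nm_pos[of h] by (auto simp: elems_def gnorm_add field_simps)
  qed auto
  also have "\<dots> = (\<Sum>h\<in>elems x. \<Sum>k\<in>elems (x / nm h). u h k)"
    by (rule sum.Sigma[symmetric]) auto
  finally show ?thesis .
qed

text \<open>Each g contributes \<open>w g\<close> times the integral of \<open>\<phi>'\<close> over
  the part of [Y, X] beyond its norm, which the fundamental theorem evaluates; summing over g under
  the integral sign produces the summatory function. No enumeration of the norms in increasing order
  is required.\<close>

lemma abel_summation:
  fixes w :: "'p multiset \<Rightarrow> complex" and \<phi> \<phi>' :: "real \<Rightarrow> complex"
  assumes "Y \<le> X"
    and deriv: "\<And>u. u \<in> {Y..X} \<Longrightarrow> (\<phi> has_vector_derivative \<phi>' u) (at u)"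
  shows "((\<lambda>u. (\<Sum>g\<in>elems u. w g) * \<phi>' u) has_integral
      ((\<Sum>g\<in>elems X. w g) * \<phi> X - (\<Sum>g\<in>elems Y. w g) * \<phi> Y - (\<Sum>g\<in>elems X - elems Y. w g * \<phi> (nm g)))) {Y..X}"
proof -
  have 1: "((\<lambda>u. w g * (if u \<in> {max (nm g) Y..X} then \<phi>' u else 0)) has_integral
      w g * (\<phi> X - \<phi> (max (nm g) Y))) {Y..X}" if "g \<in> elems X" for g
  proof (rule has_integral_mult_right)
    have le: "max (nm g) Y \<le> X" using that assms by (simp add: elems_def)
    have "(\<phi>' has_integral (\<phi> X - \<phi> (max (nm g) Y))) {max (nm g) Y..X}"
      using deriv le by (intro fundamental_theorem_of_calculus)
        (auto intro: has_vector_derivative_at_within)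
    then show "((\<lambda>u. if u \<in> {max (nm g) Y..X} then \<phi>' u else 0) has_integral
        \<phi> X - \<phi> (max (nm g) Y)) {Y..X}"
      by (subst has_integral_restrict) auto
  qed
  have 2: "((\<lambda>u. \<Sum>g\<in>elems X. w g * (if u \<in> {max (nm g) Y..X} then \<phi>' u else 0)) has_integral
      (\<Sum>g\<in>elems X. w g * (\<phi> X - \<phi> (max (nm g) Y)))) {Y..X}"
    by (rule has_integral_sum) (use 1 in auto)
  have 3: "(\<Sum>g\<in>elems X. w g * (if u \<in> {max (nm g) Y..X} then \<phi>' u else 0)) = (\<Sum>g\<in>elems u. w g) * \<phi>' u"
    if "u \<in> {Y..X}" for u
  proof -
    have "(\<Sum>g\<in>elems X. w g * (if u \<in> {max (nm g) Y..X} then \<phi>' u else 0))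
        = (\<Sum>g\<in>elems u. w g * (if u \<in> {max (nm g) Y..X} then \<phi>' u else 0))"
      using that elems_mono[of u X] by (intro sum.mono_neutral_right finite_elems) (auto simp: elems_def)
    also have "\<dots> = (\<Sum>g\<in>elems u. w g * \<phi>' u)"
      using that by (intro sum.cong) (auto simp: elems_def)
    finally show ?thesis by (simp add: sum_distrib_right)
  qed
  have split: "(\<Sum>g\<in>elems X. v g) = (\<Sum>g\<in>elems Y. v g) + (\<Sum>g\<in>elems X - elems Y. v g)" for v :: "_ \<Rightarrow> complex"
    using sum.subset_diff[OF elems_mono[OF assms(1)], of v] by (simp add: add.commute)
  have 4: "(\<Sum>g\<in>elems X. w g * \<phi> (max (nm g) Y))
      = (\<Sum>g\<in>elems Y. w g) * \<phi> Y + (\<Sum>g\<in>elems X - elems Y. w g * \<phi> (nm g))"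
    unfolding split[of "\<lambda>g. w g * \<phi> (max (nm g) Y)"] sum_distrib_right
    by (intro arg_cong2[of _ _ _ _ "(+)"] sum.cong) (auto simp: elems_def max_def)
  have "(\<Sum>g\<in>elems X. w g * (\<phi> X - \<phi> (max (nm g) Y)))
      = (\<Sum>g\<in>elems X. w g) * \<phi> X - (\<Sum>g\<in>elems X. w g * \<phi> (max (nm g) Y))"
    by (simp add: right_diff_distrib sum_subtractf sum_distrib_right)
  also have "\<dots> = (\<Sum>g\<in>elems X. w g) * \<phi> X - (\<Sum>g\<in>elems Y. w g) * \<phi> Y
      - (\<Sum>g\<in>elems X - elems Y. w g * \<phi> (nm g))"
    unfolding 4 by simp
  finally have 5: "(\<Sum>g\<in>elems X. w g * (\<phi> X - \<phi> (max (nm g) Y))) = \<dots>" .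
  show ?thesis
    using has_integral_cong[of "{Y..X}", THEN iffD1, OF 3 2] unfolding 5 .
qed

text \<open>\<open>\<psi>\<close> is a primitive of a majorant of the integrand, so applications
  obtain a closed bound without meeting an integral.\<close>

lemma abel_summation_bound:
  fixes w :: "'p multiset \<Rightarrow> complex" and \<phi> \<phi>' :: "real \<Rightarrow> complex" and \<psi> \<psi>' :: "real \<Rightarrow> real"
  assumes "Y \<le> X"
    and "\<And>u. u \<in> {Y..X} \<Longrightarrow> (\<phi> has_vector_derivative \<phi>' u) (at u)"
    and "\<And>u. u \<in> {Y..X} \<Longrightarrow> (\<psi> has_real_derivative \<psi>' u) (at u)"
    and "\<And>u. u \<in> {Y..X} \<Longrightarrow> norm (\<Sum>g\<in>elems u. w g) * norm (\<phi>' u) \<le> \<psi>' u"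
  shows "norm ((\<Sum>g\<in>elems X. w g) * \<phi> X - (\<Sum>g\<in>elems Y. w g) * \<phi> Y
      - (\<Sum>g\<in>elems X - elems Y. w g * \<phi> (nm g))) \<le> \<psi> X - \<psi> Y"
proof -
  have a: "((\<lambda>u. (\<Sum>g\<in>elems u. w g) * \<phi>' u) has_integral
      ((\<Sum>g\<in>elems X. w g) * \<phi> X - (\<Sum>g\<in>elems Y. w g) * \<phi> Y - (\<Sum>g\<in>elems X - elems Y. w g * \<phi> (nm g)))) {Y..X}"
    by (rule abel_summation) (use assms in auto)
  have b: "(\<psi>' has_integral (\<psi> X - \<psi> Y)) {Y..X}"
    using assms by (intro fundamental_theorem_of_calculus)
      (auto simp: has_real_derivative_iff_has_vector_derivative intro: has_vector_derivative_at_within)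
  have "norm (integral {Y..X} (\<lambda>u. (\<Sum>g\<in>elems u. w g) * \<phi>' u)) \<le> integral {Y..X} \<psi>'"
    using a b assms(4) by (intro integral_norm_bound_integral) (auto simp: norm_mult has_integral_integrable)
  then show ?thesis using integral_unique[OF a] integral_unique[OF b] by simp
qed

end

section \<open>The zeta function\<close>

text \<open>For u > 0 this is u to the power -s. The exponential of a multiple of the real logarithm
  makes it entire in s for every u.\<close>

definition npow :: "real \<Rightarrow> complex \<Rightarrow> complex" where
  "npow u s = exp (- s * of_real (ln u))"

lemma norm_npow: "u > 0 \<Longrightarrow> norm (npow u s) = u powr (- Re s)"
  by (simp add: npow_def powr_def)

lemma npow_of_real: "u > 0 \<Longrightarrow> npow u (of_real r) = of_real (u powr (- r))"
  by (simp add: npow_def powr_def flip: exp_of_real)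

lemma npow_nonzero [simp]: "npow u s \<noteq> 0"
  by (simp add: npow_def)

lemma npow_one [simp]: "npow 1 s = 1"
  by (simp add: npow_def)

lemma npow_0_right [simp]: "npow u 0 = 1"
  by (simp add: npow_def)

lemma npow_1_right: "u > 0 \<Longrightarrow> npow u 1 = 1 / of_real u"
  using npow_of_real[of u 1] by (simp add: powr_minus field_simps)

lemma npow_mult: "u > 0 \<Longrightarrow> v > 0 \<Longrightarrow> npow (u * v) s = npow u s * npow v s"
  by (simp add: npow_def ln_mult ring_distribs exp_diff exp_minus divide_inverse)

lemma npow_add: "npow u (s + t) = npow u s * npow u t"
  by (simp add: npow_def ring_distribs exp_diff exp_minus divide_inverse)

lemma npow_times_base: "u > 0 \<Longrightarrow> of_real u * npow u s = npow u (s - 1)"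
  using npow_add[of u "s - 1" 1] by (simp add: npow_1_right)

lemma npow_has_vector_derivative [derivative_intros]:
  assumes "u > 0"
  shows "((\<lambda>u. npow u s) has_vector_derivative (- s * npow u (s + 1))) (at u)"
proof -
  have 1: "((\<lambda>u. of_real (ln u) :: complex) has_vector_derivative of_real (1 / u)) (at u)"
    using assms by (intro has_vector_derivative_of_real)
      (auto simp flip: has_real_derivative_iff_has_vector_derivative intro!: derivative_eq_intros)
  have "((\<lambda>w. exp (- s * w)) has_field_derivative (- s * exp (- s * of_real (ln u)))) (at (of_real (ln u)))"
    by (auto intro!: derivative_eq_intros)
  from field_vector_diff_chain_at[OF 1 this]
  have "((\<lambda>u. npow u s) has_vector_derivative of_real (1 / u) * (- s * npow u s)) (at u)"
    by (simp add: npow_def o_def)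
  moreover have "npow u (s + 1) = npow u s / of_real u"
    using assms by (simp add: npow_add npow_1_right)
  ultimately show ?thesis by simp
qed

lemma npow_holomorphic [holomorphic_intros]:
  "f holomorphic_on A \<Longrightarrow> (\<lambda>z. npow u (f z)) holomorphic_on A"
  unfolding npow_def by (intro holomorphic_intros)

lemma has_real_derivative_powr_div:
  assumes "u > 0" "a \<noteq> 0"
  shows "((\<lambda>u. D * u powr a / a) has_real_derivative D * u powr (a - 1)) (at u)"
  using assms by (auto intro!: derivative_eq_intros)

context arithmetical_semigroup
begin

lemma abel_summation_bound_1:
  fixes w :: "'p multiset \<Rightarrow> complex" and \<phi> \<phi>' :: "real \<Rightarrow> complex" and \<psi> \<psi>' :: "real \<Rightarrow> real"
  assumes "1 \<le> X"
    and "\<And>u. u \<in> {1..X} \<Longrightarrow> (\<phi> has_vector_derivative \<phi>' u) (at u)"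
    and "\<And>u. u \<in> {1..X} \<Longrightarrow> (\<psi> has_real_derivative \<psi>' u) (at u)"
    and "\<And>u. u \<in> {1..X} \<Longrightarrow> norm (\<Sum>g\<in>elems u. w g) * norm (\<phi>' u) \<le> \<psi>' u"
  shows "norm ((\<Sum>g\<in>elems X. w g) * \<phi> X - (\<Sum>g\<in>elems X. w g * \<phi> (nm g))) \<le> \<psi> X - \<psi> 1"
proof -
  have "(\<Sum>g\<in>elems X. w g * \<phi> (nm g)) = (\<Sum>g\<in>elems X - elems 1. w g * \<phi> (nm g)) + (\<Sum>g\<in>elems 1. w g * \<phi> (nm g))"
    by (rule sum.subset_diff) (use elems_mono[OF assms(1)] in auto)
  moreover have "(\<Sum>g\<in>elems 1. w g * \<phi> (nm g)) = (\<Sum>g\<in>elems 1. w g) * \<phi> 1"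
    by (simp add: elems_1)
  ultimately have "(\<Sum>g\<in>elems X. w g) * \<phi> X - (\<Sum>g\<in>elems X. w g * \<phi> (nm g))
      = (\<Sum>g\<in>elems X. w g) * \<phi> X - (\<Sum>g\<in>elems 1. w g) * \<phi> 1 - (\<Sum>g\<in>elems X - elems 1. w g * \<phi> (nm g))"
    by simp
  then show ?thesis using abel_summation_bound[OF assms] by (simp only:)
qed

text \<open>The growth constant D enters the bound linearly. Besides the full semigroup, where D =
  C, this serves a sparse set, whose small D has to survive partial summation.\<close>

lemma sum_powr_le:
  assumes "X \<ge> 1" "\<sigma> \<noteq> 1" "\<sigma> > 0"
    and w: "\<And>u. u \<in> {1..X} \<Longrightarrow> norm (\<Sum>g\<in>elems u. w g :: complex) \<le> D * u"
  shows "norm (\<Sum>g\<in>elems X. w g * of_real (nm g powr (- \<sigma>)))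
      \<le> D * X powr (1 - \<sigma>) + D * \<sigma> * (X powr (1 - \<sigma>) - 1) / (1 - \<sigma>)"
proof -
  let ?W = "\<lambda>u. \<Sum>g\<in>elems u. w g"
  have *: "norm (?W X * npow X \<sigma> - (\<Sum>g\<in>elems X. w g * npow (nm g) \<sigma>))
      \<le> (D * \<sigma>) * X powr (1 - \<sigma>) / (1 - \<sigma>) - (D * \<sigma>) * 1 powr (1 - \<sigma>) / (1 - \<sigma>)"
  proof (rule abel_summation_bound_1[OF assms(1)])
    fix u assume u: "u \<in> {1..X}"
    show "((\<lambda>u. npow u \<sigma>) has_vector_derivative - of_real \<sigma> * npow u (of_real \<sigma> + 1)) (at u)"
      by (rule npow_has_vector_derivative) (use u in auto)
    show "((\<lambda>u. (D * \<sigma>) * u powr (1 - \<sigma>) / (1 - \<sigma>)) has_real_derivative (D * \<sigma>) * u powr ((1 - \<sigma>) - 1)) (at u)"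
      by (rule has_real_derivative_powr_div) (use u assms in auto)
    have "norm (?W u) * norm (- of_real \<sigma> * npow u (of_real \<sigma> + 1)) \<le> (D * u) * (\<sigma> * u powr (- \<sigma> - 1))"
      using u assms by (intro mult_mono w) (auto simp: norm_mult norm_npow intro: order.trans[OF norm_ge_zero w])
    also have "\<dots> = (D * \<sigma>) * u powr ((1 - \<sigma>) - 1)"
      using u powr_add[of u "-\<sigma> - 1" 1] by (simp add: algebra_simps)
    finally show "norm (?W u) * norm (- of_real \<sigma> * npow u (of_real \<sigma> + 1)) \<le> (D * \<sigma>) * u powr ((1 - \<sigma>) - 1)" .
  qed
  have eq: "(\<Sum>g\<in>elems X. w g * npow (nm g) \<sigma>) = (\<Sum>g\<in>elems X. w g * of_real (nm g powr (- \<sigma>)))"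
    by (intro sum.cong refl) (auto simp: elems_def npow_of_real nm_pos)
  have "norm (?W X * npow X \<sigma>) \<le> (D * X) * X powr (- \<sigma>)"
    unfolding norm_mult using assms by (intro mult_mono w) (auto simp: norm_npow intro: order.trans[OF norm_ge_zero w])
  also have "\<dots> = D * X powr (1 - \<sigma>)"
    using assms powr_add[of X "-\<sigma>" 1] by (simp add: algebra_simps)
  finally have "norm (?W X * npow X \<sigma>) \<le> D * X powr (1 - \<sigma>)" .
  then show ?thesis using * norm_triangle_sub[of "\<Sum>g\<in>elems X. w g * npow (nm g) \<sigma>" "?W X * npow X \<sigma>"]
    unfolding eq by (simp add: norm_minus_commute right_diff_distrib diff_divide_distrib)
qed

lemma norm_sum_elems_le:
  assumes "\<And>g. g \<in> gelems P \<Longrightarrow> norm (w g) \<le> B" "u \<ge> 1"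
  shows "norm (\<Sum>g\<in>elems u. w g) \<le> B * (C * u)"
proof -
  have "norm (\<Sum>g\<in>elems u. w g) \<le> (\<Sum>g\<in>elems u. B)"
    by (intro sum_norm_le assms) (auto simp: elems_def)
  also have "\<dots> = B * real (card (elems u))" by simp
  also have "\<dots> \<le> B * (C * u)"
    using assms order.trans[OF norm_ge_zero assms(1)[OF gelems_empty]] by (intro mult_left_mono card_elems_le) auto
  finally show ?thesis .
qed

lemma sum_nm_powr_le:
  assumes "X \<ge> 1" "\<sigma> \<noteq> 1" "\<sigma> > 0"
  shows "(\<Sum>g\<in>elems X. nm g powr (- \<sigma>)) \<le> C * X powr (1 - \<sigma>) + C * \<sigma> * (X powr (1 - \<sigma>) - 1) / (1 - \<sigma>)"
proof -
  have "norm (\<Sum>g\<in>elems X. 1 * complex_of_real (nm g powr (- \<sigma>)))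
      \<le> C * X powr (1 - \<sigma>) + C * \<sigma> * (X powr (1 - \<sigma>) - 1) / (1 - \<sigma>)"
    by (rule sum_powr_le[OF assms]) (use norm_sum_elems_le[of "\<lambda>_. 1 :: complex" 1] in auto)
  moreover have "(\<Sum>g\<in>elems X. 1 * complex_of_real (nm g powr (- \<sigma>))) = of_real (\<Sum>g\<in>elems X. nm g powr (- \<sigma>))"
    by simp
  ultimately have "\<bar>\<Sum>g\<in>elems X. nm g powr (- \<sigma>)\<bar> \<le> C * X powr (1 - \<sigma>) + C * \<sigma> * (X powr (1 - \<sigma>) - 1) / (1 - \<sigma>)"
    by (simp only: norm_of_real)
  then show ?thesis by linarith
qed

lemma finite_sum_nm_powr_le:
  assumes "\<sigma> > 1" and F: "finite F" "F \<subseteq> gelems P"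
  shows "(\<Sum>g\<in>F. nm g powr (- \<sigma>)) \<le> C + C * \<sigma> / (\<sigma> - 1)"
proof -
  define X where "X = Max (insert 1 (nm ` F))"
  have X: "X \<ge> 1" "\<And>g. g \<in> F \<Longrightarrow> nm g \<le> X" using F by (auto simp: X_def)
  have "(\<Sum>g\<in>F. nm g powr (- \<sigma>)) \<le> (\<Sum>g\<in>elems X. nm g powr (- \<sigma>))"
    using F X by (intro sum_mono2) (auto simp: elems_def finite_elems[unfolded elems_def])
  also have "\<dots> \<le> C * X powr (1 - \<sigma>) + C * \<sigma> * (X powr (1 - \<sigma>) - 1) / (1 - \<sigma>)"
    using assms X by (intro sum_nm_powr_le) auto
  also have "\<dots> \<le> C + C * \<sigma> / (\<sigma> - 1)"
  proof -
    have le: "X powr (1 - \<sigma>) \<le> 1" using powr_mono[of "1 - \<sigma>" 0 X] X assms by simp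
    have "C * X powr (1 - \<sigma>) \<le> C * 1" using C_pos le by (intro mult_left_mono) auto
    moreover have "C * \<sigma> * (1 - X powr (1 - \<sigma>)) / (\<sigma> - 1) \<le> C * \<sigma> * 1 / (\<sigma> - 1)"
      using C_pos assms le by (intro divide_right_mono mult_left_mono) auto
    moreover have "C * \<sigma> * (X powr (1 - \<sigma>) - 1) / (1 - \<sigma>) = C * \<sigma> * (1 - X powr (1 - \<sigma>)) / (\<sigma> - 1)"
      using assms by (simp add: field_simps)
    ultimately show ?thesis by simp
  qed
  finally show ?thesis .
qed

lemma summable_nm_powr:
  assumes "\<sigma> > 1"
  shows "(\<lambda>g. nm g powr (- \<sigma>)) summable_on gelems P"
proof (rule nonneg_bdd_above_summable_on)
  show "bdd_above (sum (\<lambda>g. nm g powr (- \<sigma>)) ` {F. F \<subseteq> gelems P \<and> finite F})"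
    by (rule bdd_aboveI2) (use finite_sum_nm_powr_le[OF assms] in auto)
qed simp

text \<open>The Dirichlet series of the subsemigroup generated by B. Keeping B variable allows Euler
  factors to be split off one prime at a time.\<close>

definition Zeta :: "'p set \<Rightarrow> complex \<Rightarrow> complex" where
  "Zeta B s = (\<Sum>\<^sub>\<infinity>g\<in>gelems B. npow (nm g) s)"

lemma abs_summable_npow:
  assumes "Re s > 1" "B \<subseteq> P" "\<And>g. g \<in> gelems P \<Longrightarrow> norm (w g) \<le> 1"
  shows "(\<lambda>g. norm (w g * npow (nm g) s)) summable_on gelems B"
proof (rule Infinite_Sum.abs_summable_on_comparison_test')
  show "(\<lambda>g. nm g powr (- Re s)) summable_on gelems B"
    using summable_nm_powr[OF assms(1)] gelems_mono[OF assms(2)] by (rule summable_on_subset_banach)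
  show "norm (w g * npow (nm g) s) \<le> nm g powr (- Re s)" if "g \<in> gelems B" for g
    using that gelems_mono[OF assms(2)] assms(3)[of g] nm_pos[of g]
    by (auto simp: norm_mult norm_npow intro: mult_left_le_one_le)
qed

lemma Zeta_has_sum:
  assumes "Re s > 1" "B \<subseteq> P"
  shows "((\<lambda>g. npow (nm g) s) has_sum Zeta B s) (gelems B)"
  using abs_summable_npow[OF assms, of "\<lambda>_. 1"] abs_summable_summable
  unfolding Zeta_def by (intro has_sum_infsum) (auto intro: abs_summable_summable)

lemma Zeta_empty: "Zeta {} s = 1"
proof -
  have "gelems {} = {{#} :: 'p multiset}" by (auto simp: gelems_def)
  then show ?thesis by (simp add: Zeta_def)
qed

lemma nm_add_npow: "g \<in> gelems P \<Longrightarrow> h \<in> gelems P \<Longrightarrow> npow (nm (g + h)) s = npow (nm g) s * npow (nm h) s"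
  by (simp add: gnorm_add npow_mult nm_pos)

text \<open>The product of the two absolutely convergent series is regrouped over pairs (g, h) with
  h dividing g; the fibre over g is a full Moebius sum and survives only at the identity.
  Non-vanishing for Re s > 1 is a by-product.\<close>

lemma moebius_has_sum_inverse_Zeta:
  assumes s: "Re s > 1" and B: "B \<subseteq> P"
  shows "((\<lambda>g. gmoebius g * npow (nm g) s) has_sum inverse (Zeta B s)) (gelems B)" and "Zeta B s \<noteq> 0"
proof -
  define F where "F = (\<Sum>\<^sub>\<infinity>g\<in>gelems B. gmoebius g * npow (nm g) s)"
  let ?m = "\<lambda>g. gmoebius g * npow (nm g) s" and ?z = "\<lambda>g. npow (nm g) s"
  have BP: "gelems B \<subseteq> gelems P" using B by (rule gelems_mono)
  have abs1: "(\<lambda>g. norm (?m g)) summable_on gelems B"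
    by (rule abs_summable_npow[OF s B norm_gmoebius_le])
  have abs2: "(\<lambda>g. norm (?z g)) summable_on gelems B"
    using abs_summable_npow[OF s B, of "\<lambda>_. 1"] by simp
  have F: "(?m has_sum F) (gelems B)"
    unfolding F_def using abs_summable_summable[OF abs1] by (rule has_sum_infsum)
  have Z: "(?z has_sum Zeta B s) (gelems B)" by (rule Zeta_has_sum[OF s B])
  have "(\<lambda>a. norm (case a of (h, k) \<Rightarrow> ?m h * ?z k)) summable_on gelems B \<times> gelems B"
    using abs1 abs2 infsum_nonneg[of "gelems B" "\<lambda>g. norm (?z g)"]
    by (subst Infinite_Sum.abs_summable_on_Sigma_iff)
       (auto simp: norm_mult infsum_cmult_right' abs_mult intro!: summable_on_cmult_right summable_on_cmult_left)
  then have "(\<lambda>(h, k). ?m h * ?z k) summable_on gelems B \<times> gelems B"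
    by (rule abs_summable_summable)
  then have "((\<lambda>(h, k). ?m h * ?z k) has_sum F * Zeta B s) (gelems B \<times> gelems B)"
    by (intro has_sum_SigmaI[where g = "\<lambda>h. ?m h * Zeta B s"])
       (auto intro!: has_sum_cmult_right has_sum_cmult_left F Z)
  also have "?this \<longleftrightarrow> ((\<lambda>(g, h). gmoebius h * npow (nm g) s) has_sum F * Zeta B s) (Sigma (gelems B) (\<lambda>g. {h. h \<subseteq># g}))"
  proof (rule has_sum_reindex_bij_witness[where j = "\<lambda>(h, k). (h + k, h)" and i = "\<lambda>(g, h). (h, g - h)"], goal_cases)
    case (4 b)
    then obtain g h where b: "b = (g, h)" "g \<in> gelems B" "h \<subseteq># g" by auto
    then obtain k where "g = h + k" by (meson mset_subset_eq_exists_conv)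
    then show ?case using b by auto
  next
    case (5 a)
    then show ?case using BP nm_add_npow by (auto simp: subset_iff)
  qed auto
  finally have S: "((\<lambda>(g, h). gmoebius h * npow (nm g) s) has_sum F * Zeta B s) (Sigma (gelems B) (\<lambda>g. {h. h \<subseteq># g}))" .
  have "((\<lambda>g. if g = {#} then 1 else 0) has_sum F * Zeta B s) (gelems B)"
  proof (rule has_sum_SigmaD[OF S])
    fix g :: "'p multiset" assume "g \<in> gelems B"
    have "(\<Sum>h | h \<subseteq># g. gmoebius h * npow (nm g) s) = (if g = {#} then 1 else 0)"
      using sum_gmoebius_divisors[of g UNIV] by (simp flip: sum_distrib_right)
    then show "((\<lambda>h. case (g, h) of (g, h) \<Rightarrow> gmoebius h * npow (nm g) s) has_sum (if g = {#} then 1 else 0)) {h. h \<subseteq># g}"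
      by (intro has_sum_finiteI finite_submultisets) simp
  qed
  moreover have "((\<lambda>g. if g = {#} then 1 else 0) has_sum (1 :: complex)) (gelems B)"
    by (rule has_sum_finite_neutralI[of "{{#}}"]) auto
  ultimately have "F * Zeta B s = 1" using has_sum_unique by blast
  then show "Zeta B s \<noteq> 0" by auto
  then have "F = inverse (Zeta B s)" using \<open>F * Zeta B s = 1\<close> by (simp add: field_simps)
  then show "(?m has_sum inverse (Zeta B s)) (gelems B)" using F by simp
qed

section \<open>Euler products\<close>

text \<open>An element either avoids p or is p times an arbitrary element, so
  \<open>Zeta (insert p B) s\<close> equals \<open>Zeta B s\<close> plus
  \<open>npow (Np p) s\<close> times itself. This self-reference replaces the geometric series of
  the Euler factor.\<close>

lemma Zeta_insert:
  assumes s: "Re s > 1" and B: "B \<subseteq> P" and p: "p \<in> P" "p \<notin> B"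
  shows "Zeta (insert p B) s * (1 - npow (Np p) s) = Zeta B s"
proof -
  let ?B = "insert p B"
  have B': "?B \<subseteq> P" using B p by auto
  have p1: "{#p#} \<in> gelems P" using p by (simp add: gelems_def)
  have "((\<lambda>g. npow (Np p) s * npow (nm g) s) has_sum npow (Np p) s * Zeta ?B s) (gelems ?B)"
    by (intro has_sum_cmult_right Zeta_has_sum s B')
  also have "?this \<longleftrightarrow> ((\<lambda>g. npow (nm g) s) \<circ> add_mset p has_sum npow (Np p) s * Zeta ?B s) (gelems ?B)"
  proof (intro has_sum_cong)
    fix g assume "g \<in> gelems ?B"
    then have "g \<in> gelems P" using gelems_mono[OF B'] by auto
    then show "npow (Np p) s * npow (nm g) s = ((\<lambda>g. npow (nm g) s) \<circ> add_mset p) g"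
      using nm_add_npow[OF p1, of g s] by (simp add: gnorm_def)
  qed
  also have "\<dots> \<longleftrightarrow> ((\<lambda>g. npow (nm g) s) has_sum npow (Np p) s * Zeta ?B s) (add_mset p ` gelems ?B)"
    by (rule has_sum_reindex[symmetric]) (simp add: inj_on_def)
  finally have "((\<lambda>g. npow (nm g) s) has_sum Zeta B s + npow (Np p) s * Zeta ?B s)
      (gelems B \<union> add_mset p ` gelems ?B)"
    by (intro has_sum_Un_disjoint Zeta_has_sum s B) (use p in \<open>auto simp: gelems_def\<close>)
  also have "gelems B \<union> add_mset p ` gelems ?B = gelems ?B"
  proof (intro equalityI subsetI)
    fix g assume g: "g \<in> gelems ?B"
    show "g \<in> gelems B \<union> add_mset p ` gelems ?B"
    proof (cases "p \<in># g")
      case True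
      then obtain h where "g = add_mset p h" by (meson mset_add)
      then show ?thesis using g by (auto simp: gelems_def)
    qed (use g in \<open>auto simp: gelems_def\<close>)
  qed (auto simp: gelems_def)
  finally have "Zeta B s + npow (Np p) s * Zeta ?B s = Zeta ?B s"
    using Zeta_has_sum[OF s B'] has_sum_unique by blast
  then show ?thesis by (simp add: algebra_simps)
qed

lemma Zeta_Un_finite:
  assumes s: "Re s > 1" and "finite A" "A \<subseteq> P" "B \<subseteq> P" "A \<inter> B = {}"
  shows "Zeta (A \<union> B) s * (\<Prod>p\<in>A. 1 - npow (Np p) s) = Zeta B s"
  using assms(2-)
proof (induction A)
  case (insert p A)
  have "Zeta (insert p (A \<union> B)) s * (1 - npow (Np p) s) = Zeta (A \<union> B) s"
    using insert by (intro Zeta_insert s) auto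
  then show ?case using insert by (simp flip: mult.assoc)
qed simp

lemma Zeta_finite:
  assumes "Re s > 1" "finite A" "A \<subseteq> P"
  shows "Zeta A s * (\<Prod>p\<in>A. 1 - npow (Np p) s) = 1"
  using Zeta_Un_finite[OF assms, of "{}"] by (simp add: Zeta_empty)

text \<open>The Euler product over all of P in net form. A finite set G of elements that fixes the
  full series up to e / 2 involves only finitely many primes; as soon as A contains them, every
  finite sum over \<open>gelems A\<close> that includes G is equally close to
  \<open>Zeta P s\<close>, and so is its limit \<open>Zeta A s\<close>.\<close>

lemma Zeta_finite_tendsto:
  assumes s: "Re s > 1"
  shows "((\<lambda>A. Zeta A s) \<longlongrightarrow> Zeta P s) (finite_subsets_at_top P)"
proof (rule tendstoI)
  fix e :: real assume e: "e > 0"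
  have "(sum (\<lambda>g. npow (nm g) s) \<longlongrightarrow> Zeta P s) (finite_subsets_at_top (gelems P))"
    using Zeta_has_sum[OF s, of P] by (simp add: has_sum_def)
  then have "\<forall>\<^sub>F F in finite_subsets_at_top (gelems P). dist (\<Sum>g\<in>F. npow (nm g) s) (Zeta P s) < e / 2"
    using e by (intro tendstoD) auto
  then obtain G where G0: "finite G \<and> G \<subseteq> gelems P \<and>
      (\<forall>F. finite F \<and> G \<subseteq> F \<and> F \<subseteq> gelems P \<longrightarrow> dist (\<Sum>g\<in>F. npow (nm g) s) (Zeta P s) < e / 2)"
    unfolding eventually_finite_subsets_at_top by (elim exE) (rule that)
  then have G: "finite G" "G \<subseteq> gelems P"
    "\<And>F. finite F \<Longrightarrow> G \<subseteq> F \<Longrightarrow> F \<subseteq> gelems P \<Longrightarrow> dist (\<Sum>g\<in>F. npow (nm g) s) (Zeta P s) < e / 2"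
    by simp_all
  define A0 where "A0 = (\<Union>g\<in>G. set_mset g)"
  have A0: "finite A0" "A0 \<subseteq> P" using G by (auto simp: A0_def gelems_def)
  have "dist (Zeta A s) (Zeta P s) < e" if A: "finite A" "A0 \<subseteq> A" "A \<subseteq> P" for A
  proof -
    have GA: "G \<subseteq> gelems A" using A by (auto simp: A0_def gelems_def)
    have lim: "((\<lambda>F. (\<Sum>g\<in>F. npow (nm g) s) - Zeta P s) \<longlongrightarrow> Zeta A s - Zeta P s) (finite_subsets_at_top (gelems A))"
      using Zeta_has_sum[OF s A(3)] by (intro tendsto_intros) (simp add: has_sum_def)
    have "norm (Zeta A s - Zeta P s) \<le> e / 2"
    proof (rule Lim_norm_ubound[OF _ lim])
      show "\<forall>\<^sub>F F in finite_subsets_at_top (gelems A). norm ((\<Sum>g\<in>F. npow (nm g) s) - Zeta P s) \<le> e / 2"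
        unfolding eventually_finite_subsets_at_top
      proof (intro exI[of _ G] conjI allI impI)
        fix F assume F: "finite F \<and> G \<subseteq> F \<and> F \<subseteq> gelems A"
        then have "dist (\<Sum>g\<in>F. npow (nm g) s) (Zeta P s) < e / 2"
          using gelems_mono[OF A(3)] by (intro G(3)) auto
        then show "norm ((\<Sum>g\<in>F. npow (nm g) s) - Zeta P s) \<le> e / 2" by (simp add: dist_norm)
      qed (use G GA in auto)
    qed simp
    then show ?thesis using e by (simp add: dist_norm)
  qed
  then show "\<forall>\<^sub>F A in finite_subsets_at_top P. dist (Zeta A s) (Zeta P s) < e"
    unfolding eventually_finite_subsets_at_top using A0 by blast
qed

end

text \<open>Comparing logarithm series term by term, the coefficient that decides the sign is 3 + 4
  cos t + cos 2t = 2 (1 + cos t)^2, with w ^ n = cos t + i sin t.\<close>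

lemma mertens_3_4_1:
  fixes r :: real and w :: complex
  assumes r: "0 \<le> r" "r < 1" and w: "norm w = 1"
  shows "norm (1 - complex_of_real r) ^ 3 * norm (1 - of_real r * w) ^ 4 * norm (1 - of_real r * w\<^sup>2) \<le> 1"
proof -
  \<comment> \<open>The term n = 0 contributes nothing, because division by zero gives 0.\<close>
  have series: "(\<lambda>n. - Re (z ^ n) / n) sums ln (norm (1 - z))" if "norm z < 1" for z :: complex
  proof -
    have "(\<lambda>n. (-1) ^ Suc n / of_nat n * (- z) ^ n) sums ln (1 + - z)"
      using that by (intro Ln_series) simp
    moreover have "(\<lambda>n. (-1) ^ Suc n / of_nat n * (- z) ^ n) = (\<lambda>n. - (z ^ n) / of_nat n)"
      by (simp flip: power_mult_distrib)
    ultimately have "(\<lambda>n. Re (- (z ^ n) / of_nat n)) sums Re (ln (1 - z))"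
      by (intro sums_Re) simp
    moreover have "1 - z \<noteq> 0" using that by auto
    ultimately show ?thesis by simp
  qed
  have lt: "norm (complex_of_real r) < 1" "norm (of_real r * w) < 1" "norm (of_real r * w\<^sup>2) < 1"
    using r w by (simp_all add: norm_mult norm_power)
  have nz: "norm (1 - complex_of_real r) > 0" "norm (1 - of_real r * w) > 0" "norm (1 - of_real r * w\<^sup>2) > 0"
    using lt by auto
  have sums: "(\<lambda>n. 3 * (- Re (of_real r ^ n) / n) + 4 * (- Re ((of_real r * w) ^ n) / n) + - Re ((of_real r * w\<^sup>2) ^ n) / n)
      sums (3 * ln (norm (1 - complex_of_real r)) + 4 * ln (norm (1 - of_real r * w)) + ln (norm (1 - of_real r * w\<^sup>2)))"
    by (intro sums_add sums_mult series lt)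
  have nonpos: "3 * (- Re (of_real r ^ n) / n) + 4 * (- Re ((of_real r * w) ^ n) / n) + - Re ((of_real r * w\<^sup>2) ^ n) / n \<le> 0" for n
  proof -
    let ?v = "w ^ n"
    have "(Re ?v)\<^sup>2 + (Im ?v)\<^sup>2 = 1"
      using w cmod_power2[of ?v] by (simp add: norm_power)
    then have v2: "Re (?v\<^sup>2) = 2 * (Re ?v)\<^sup>2 - 1" by (simp add: power2_eq_square)
    have "3 * (- Re (of_real r ^ n) / n) + 4 * (- Re ((of_real r * w) ^ n) / n) + - Re ((of_real r * w\<^sup>2) ^ n) / n
       = - (r ^ n / n) * (3 + 4 * Re ?v + Re (?v\<^sup>2))"
      by (simp add: power_mult_distrib add_divide_distrib algebra_simps flip: power_mult of_real_power)
    also have "3 + 4 * Re ?v + Re (?v\<^sup>2) = 2 * (1 + Re ?v)\<^sup>2"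
      unfolding v2 by (simp add: power2_eq_square algebra_simps)
    finally show ?thesis using r by simp
  qed
  have "3 * ln (norm (1 - complex_of_real r)) + 4 * ln (norm (1 - of_real r * w)) + ln (norm (1 - of_real r * w\<^sup>2)) \<le> 0"
    by (rule sums_le[OF nonpos sums sums_zero])
  then have "ln (norm (1 - complex_of_real r) ^ 3 * norm (1 - of_real r * w) ^ 4 * norm (1 - of_real r * w\<^sup>2)) \<le> 0"
    using nz by (simp add: ln_mult ln_realpow)
  then show ?thesis
    using nz by (subst (asm) ln_le_zero_iff) auto
qed

context arithmetical_semigroup
begin

lemma elems_subset: "elems x \<subseteq> gelems P"
  by (auto simp: elems_def)

lemma powr_eta_tendsto_0: "((\<lambda>x :: real. x powr (\<eta> - 1)) \<longlongrightarrow> 0) at_top"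
  using eta_less_1 tendsto_neg_powr[of "\<eta> - 1" "\<lambda>X. X" at_top] filterlim_ident by auto

lemma sum_elems_tendsto:
  assumes "(f has_sum S) (gelems P)"
  shows "((\<lambda>x. \<Sum>g\<in>elems x. f g) \<longlongrightarrow> S) at_top"
proof -
  have "filterlim elems (finite_subsets_at_top (gelems P)) at_top"
    unfolding filterlim_finite_subsets_at_top
  proof (intro allI impI)
    fix G assume G: "finite G \<and> G \<subseteq> gelems P"
    define X where "X = Max (insert 1 (nm ` G))"
    have "G \<subseteq> elems x" if "x \<ge> X" for x
      using G that by (auto simp: elems_def X_def)
    then show "\<forall>\<^sub>F x in at_top. finite (elems x) \<and> G \<subseteq> elems x \<and> elems x \<subseteq> gelems P"
      by (intro eventually_at_top_linorderI[of X]) (use elems_subset in auto)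
  qed
  then show ?thesis
    using assms unfolding has_sum_def by (rule filterlim_compose[rotated])
qed

section \<open>Analytic continuation of (s - 1) zeta(s)\<close>

text \<open>This is s - 1 times the difference between the partial sum of the Dirichlet series and
  the integral of c u^(-s) over [1, X]. Subtracting the main term extends convergence to Re s >
  \<eta>, and the factor s - 1, multiplied out, keeps s = 1 regular.\<close>

definition zeta_approx :: "real \<Rightarrow> complex \<Rightarrow> complex" where
  "zeta_approx X s = (s - 1) * (\<Sum>g\<in>elems X. npow (nm g) s) + of_real c * (npow X (s - 1) - 1)"

text \<open>Partial summation leaves only the counting error E(u). The boundary terms at X and Y
  account for the 2, and the integral of E against the derivative for the quotient with Re s -
  \<eta>. The bound is free of X, as a Cauchy criterion requires.\<close>

lemma zeta_approx_diff:
  assumes YX: "1 \<le> Y" "Y \<le> X" and s: "Re s > \<eta>"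
  shows "norm (zeta_approx X s - zeta_approx Y s)
      \<le> norm (s - 1) * K * (2 + norm s / (Re s - \<eta>)) * Y powr (\<eta> - Re s)"
proof -
  define \<sigma> where "\<sigma> = Re s"
  define E where "E u = complex_of_real (real (card (elems u)) - c * u)" for u
  define \<phi>' where "\<phi>' u = - s * npow u (s + 1)" for u
  have E_le: "norm (E u) \<le> K * u powr \<eta>" if "u \<ge> 1" for u
    using card_elems_approx[OF that] by (simp only: E_def norm_of_real)
  let ?D = "\<Sum>g\<in>elems X - elems Y. npow (nm g) s"
  let ?N = "\<lambda>u. of_nat (card (elems u)) :: complex"
  have 1: "((\<lambda>u. ?N u * \<phi>' u) has_integral ?N X * npow X s - ?N Y * npow Y s - ?D) {Y..X}"
    using abel_summation[of Y X "\<lambda>u. npow u s" \<phi>' "\<lambda>_. 1"] YX npow_has_vector_derivative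
    by (simp add: \<phi>'_def)
  \<comment> \<open>Carrying the factor s - 1 along gives the main term a primitive without dividing
    by s - 1, so s = 1 needs no separate case.\<close>
  have 2: "((\<lambda>u. (s - 1) * (of_real (c * u) * \<phi>' u)) has_integral
      of_real c * s * npow X (s - 1) - of_real c * s * npow Y (s - 1)) {Y..X}"
  proof (rule fundamental_theorem_of_calculus[OF YX(2)])
    fix u assume u: "u \<in> {Y..X}"
    then have u0: "u > 0" using YX by auto
    have "((\<lambda>u. of_real c * s * npow u (s - 1)) has_vector_derivative
        of_real c * s * (- (s - 1) * npow u (s - 1 + 1))) (at u within {Y..X})"
      by (rule has_vector_derivative_mult_right[OF has_vector_derivative_at_within[OF npow_has_vector_derivative[OF u0]]])
    moreover have "of_real u * npow u (s + 1) = npow u s" using npow_times_base[OF u0, of "s + 1"] by simp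
    then have "of_real c * s * (- (s - 1) * npow u (s - 1 + 1)) = (s - 1) * (of_real (c * u) * \<phi>' u)"
      by (simp add: \<phi>'_def algebra_simps)
    ultimately show "((\<lambda>u. of_real c * s * npow u (s - 1)) has_vector_derivative
        (s - 1) * (of_real (c * u) * \<phi>' u)) (at u within {Y..X})" by (simp only:)
  qed
  define I where "I = (s - 1) * (?N X * npow X s - ?N Y * npow Y s - ?D)
      - (of_real c * s * npow X (s - 1) - of_real c * s * npow Y (s - 1))"
  have 3: "((\<lambda>u. (s - 1) * (E u * \<phi>' u)) has_integral I) {Y..X}"
    using has_integral_diff[OF has_integral_mult_right[OF 1, of "s - 1"] 2] unfolding I_def
    by (rule has_integral_eq[rotated]) (simp add: E_def algebra_simps)
  have 4: "((\<lambda>u. norm (s - 1) * norm s * K * u powr (\<eta> - \<sigma> - 1)) has_integral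
      (norm (s - 1) * norm s * K * X powr (\<eta> - \<sigma>) / (\<eta> - \<sigma>) - norm (s - 1) * norm s * K * Y powr (\<eta> - \<sigma>) / (\<eta> - \<sigma>))) {Y..X}"
  proof (rule fundamental_theorem_of_calculus[OF YX(2)])
    fix u assume "u \<in> {Y..X}"
    then have "u > 0" "\<eta> - \<sigma> \<noteq> 0" using YX s by (auto simp: \<sigma>_def)
    then show "((\<lambda>u. norm (s - 1) * norm s * K * u powr (\<eta> - \<sigma>) / (\<eta> - \<sigma>)) has_vector_derivative
        norm (s - 1) * norm s * K * u powr (\<eta> - \<sigma> - 1)) (at u within {Y..X})"
      unfolding has_real_derivative_iff_has_vector_derivative[symmetric]
      by (rule has_field_derivative_at_within[OF has_real_derivative_powr_div])
  qed
  have "norm I \<le> norm (s - 1) * norm s * K * X powr (\<eta> - \<sigma>) / (\<eta> - \<sigma>) - norm (s - 1) * norm s * K * Y powr (\<eta> - \<sigma>) / (\<eta> - \<sigma>)"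
  proof -
    have "norm (integral {Y..X} (\<lambda>u. (s - 1) * (E u * \<phi>' u)))
        \<le> integral {Y..X} (\<lambda>u. norm (s - 1) * norm s * K * u powr (\<eta> - \<sigma> - 1))"
    proof (rule integral_norm_bound_integral)
      fix u assume u: "u \<in> {Y..X}"
      then have u1: "u \<ge> 1" using YX by auto
      have "norm ((s - 1) * (E u * \<phi>' u)) \<le> norm (s - 1) * ((K * u powr \<eta>) * (norm s * u powr (- \<sigma> - 1)))"
        unfolding norm_mult using u1 K_nonneg
        by (intro mult_left_mono mult_mono E_le) (auto simp: \<phi>'_def norm_mult norm_npow \<sigma>_def)
      also have "\<dots> = norm (s - 1) * norm s * K * u powr (\<eta> - \<sigma> - 1)"
        using powr_add[of u \<eta> "- \<sigma> - 1"] by (simp add: algebra_simps)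
      finally show "norm ((s - 1) * (E u * \<phi>' u)) \<le> norm (s - 1) * norm s * K * u powr (\<eta> - \<sigma> - 1)" .
    qed (use 3 4 in \<open>auto simp: has_integral_integrable\<close>)
    then show ?thesis using integral_unique[OF 3] integral_unique[OF 4] by simp
  qed
  also have "\<dots> \<le> norm (s - 1) * norm s * K * Y powr (\<eta> - \<sigma>) / (\<sigma> - \<eta>)"
  proof -
    have "norm (s - 1) * norm s * K * X powr (\<eta> - \<sigma>) / (\<eta> - \<sigma>) \<le> 0"
      using s K_nonneg by (intro divide_nonneg_neg) (auto simp: \<sigma>_def)
    moreover have "- (norm (s - 1) * norm s * K * Y powr (\<eta> - \<sigma>) / (\<eta> - \<sigma>)) = norm (s - 1) * norm s * K * Y powr (\<eta> - \<sigma>) / (\<sigma> - \<eta>)"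
      by (metis minus_diff_eq minus_divide_right)
    ultimately show ?thesis by linarith
  qed
  finally have I: "norm I \<le> norm (s - 1) * norm s * K * Y powr (\<eta> - \<sigma>) / (\<sigma> - \<eta>)" .
  have eq: "zeta_approx X s - zeta_approx Y s = (s - 1) * (E X * npow X s) - (s - 1) * (E Y * npow Y s) - I"
  proof -
    have "(\<Sum>g\<in>elems X. npow (nm g) s) = ?D + (\<Sum>g\<in>elems Y. npow (nm g) s)"
      by (rule sum.subset_diff) (use elems_mono[OF YX(2)] in auto)
    moreover have "npow X (s - 1) = of_real X * npow X s" "npow Y (s - 1) = of_real Y * npow Y s"
      using YX by (simp_all add: npow_times_base)
    ultimately show ?thesis
      unfolding zeta_approx_def E_def I_def by (simp add: algebra_simps)
  qed
  have Ebd: "norm ((s - 1) * (E u * npow u s)) \<le> norm (s - 1) * (K * Y powr (\<eta> - \<sigma>))" if "u \<ge> Y" for u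
  proof -
    have u: "u \<ge> 1" using that YX by auto
    have "norm (E u) * norm (npow u s) \<le> K * u powr \<eta> * u powr (- \<sigma>)"
      using u K_nonneg by (intro mult_mono E_le) (auto simp: norm_npow \<sigma>_def)
    also have "\<dots> = K * u powr (\<eta> - \<sigma>)"
      using powr_add[of u \<eta> "- \<sigma>"] by simp
    also have "\<dots> \<le> K * Y powr (\<eta> - \<sigma>)"
      using K_nonneg that YX s by (intro mult_left_mono powr_mono2') (auto simp: \<sigma>_def)
    finally show ?thesis unfolding norm_mult by (rule mult_left_mono) simp
  qed
  have "norm (zeta_approx X s - zeta_approx Y s)
      \<le> norm ((s - 1) * (E X * npow X s)) + norm ((s - 1) * (E Y * npow Y s)) + norm I"
    unfolding eq by (rule order.trans[OF norm_triangle_ineq4 add_right_mono[OF norm_triangle_ineq4]])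
  also have "\<dots> \<le> norm (s - 1) * (K * Y powr (\<eta> - \<sigma>)) + norm (s - 1) * (K * Y powr (\<eta> - \<sigma>))
      + norm (s - 1) * norm s * K * Y powr (\<eta> - \<sigma>) / (\<sigma> - \<eta>)"
    using YX by (intro add_mono Ebd I) auto
  also have "\<dots> = norm (s - 1) * K * (2 + norm s / (\<sigma> - \<eta>)) * Y powr (\<eta> - \<sigma>)"
    by (simp add: algebra_simps)
  finally show ?thesis by (simp add: \<sigma>_def)
qed

text \<open>The value of the analytic continuation of \<open>(s - 1) \<zeta>(s)\<close>; outside \<open>Re s > \<eta>\<close> the limit need not
  exist and the value is junk.\<close>

definition reg_zeta :: "complex \<Rightarrow> complex" where
  "reg_zeta s = of_real c + lim (\<lambda>n. zeta_approx (real (Suc n)) s)"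

lemma reg_zeta_holomorphic: "reg_zeta holomorphic_on {s. Re s > \<eta>}"
proof -
  have "(\<lambda>s. lim (\<lambda>n. zeta_approx (real (Suc n)) s)) holomorphic_on {s. Re s > \<eta>}"
  proof (rule holomorphic_uniform_sequence)
    show "open {s. Re s > \<eta>}" by (rule open_halfspace_Re_gt)
    show "zeta_approx (real (Suc n)) holomorphic_on {s. Re s > \<eta>}" for n
      unfolding zeta_approx_def by (intro holomorphic_intros)
    fix z assume "z \<in> {s. Re s > \<eta>}"
    then have z: "Re z > \<eta>" by simp
    \<comment> \<open>Half the distance to the line Re s = \<eta>: on the closed disc
      \<open>Re s - \<eta> \<ge> d\<close>, which makes the bound of \<open>zeta_approx_diff\<close>
      uniform there.\<close>
    define d where "d = (Re z - \<eta>) / 2"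
    have d: "d > 0" using z by (simp add: d_def)
    have Re: "Re s \<ge> \<eta> + d" if "s \<in> cball z d" for s
    proof -
      have "\<bar>Re (z - s)\<bar> \<le> d" using that abs_Re_le_cmod[of "z - s"] by (simp add: dist_norm)
      then have "Re z - Re s \<le> d" by simp
      then show ?thesis by (simp add: d_def field_simps)
    qed
    define m where "m = norm z + d + 1"
    have m: "norm s \<le> m" "norm (s - 1) \<le> m" if "s \<in> cball z d" for s
    proof -
      have "norm s \<le> norm z + d" using that norm_triangle_sub[of s z] by (simp add: dist_norm norm_minus_commute)
      then show "norm s \<le> m" "norm (s - 1) \<le> m" using norm_triangle_ineq4[of s 1] by (auto simp: m_def)
    qed
    have m0: "m \<ge> 0" using d by (simp add: m_def)
    have "uniformly_Cauchy_on (cball z d) (\<lambda>n. zeta_approx (real (Suc n)))"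
    proof (rule uniformly_Cauchy_onI')
      fix e :: real assume e: "e > 0"
      have "((\<lambda>x. m * K * (2 + m / d) * x powr (- d)) \<longlongrightarrow> m * K * (2 + m / d) * 0) at_top"
        using d by (intro tendsto_intros tendsto_neg_powr filterlim_ident) auto
      then have "\<forall>\<^sub>F x in at_top. m * K * (2 + m / d) * x powr (- d) < e"
        using e by (intro order_tendstoD(2)) auto
      then obtain x0 where x0: "\<And>x. x \<ge> x0 \<Longrightarrow> m * K * (2 + m / d) * x powr (- d) < e"
        by (auto simp: eventually_at_top_linorder)
      obtain M where M: "real M \<ge> x0" using real_arch_simple by blast
      show "\<exists>M. \<forall>s\<in>cball z d. \<forall>k\<ge>M. \<forall>n>k. dist (zeta_approx (real (Suc k)) s) (zeta_approx (real (Suc n)) s) < e"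
      proof (intro exI[of _ M] ballI allI impI)
        fix s k n assume s: "s \<in> cball z d" and k: "M \<le> k" "k < n"
        have Y: "real (Suc k) \<ge> x0" using M k by auto
        have sd: "Re s - \<eta> \<ge> d" using Re[OF s] by simp
        have "norm (zeta_approx (real (Suc n)) s - zeta_approx (real (Suc k)) s)
            \<le> norm (s - 1) * K * (2 + norm s / (Re s - \<eta>)) * real (Suc k) powr (\<eta> - Re s)"
          using k sd d by (intro zeta_approx_diff) auto
        also have "\<dots> \<le> m * K * (2 + m / d) * real (Suc k) powr (- d)"
          using m[OF s] m0 sd d K_nonneg
          by (intro mult_mono add_mono frac_le powr_mono mult_nonneg_nonneg) auto
        also have "\<dots> < e" by (rule x0[OF Y])
        finally show "dist (zeta_approx (real (Suc k)) s) (zeta_approx (real (Suc n)) s) < e"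
          by (simp add: dist_norm norm_minus_commute)
      qed
    qed
    then have "uniform_limit (cball z d) (\<lambda>n. zeta_approx (real (Suc n))) (\<lambda>s. lim (\<lambda>n. zeta_approx (real (Suc n)) s)) sequentially"
      using Cauchy_uniformly_convergent uniformly_convergent_uniform_limit_iff by blast
    moreover have "cball z d \<subseteq> {s. Re s > \<eta>}" using Re d by force
    ultimately show "\<exists>d>0. cball z d \<subseteq> {s. Re s > \<eta>} \<and>
        uniform_limit (cball z d) (\<lambda>n. zeta_approx (real (Suc n))) (\<lambda>s. lim (\<lambda>n. zeta_approx (real (Suc n)) s)) sequentially"
      using d by blast
  qed
  then have "(\<lambda>s. of_real c + lim (\<lambda>n. zeta_approx (real (Suc n)) s)) holomorphic_on {s. Re s > \<eta>}"
    by (intro holomorphic_intros)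
  then show ?thesis by (simp add: reg_zeta_def[abs_def])
qed

lemma reg_zeta_1: "reg_zeta 1 = of_real c"
  by (simp add: reg_zeta_def zeta_approx_def)

lemma reg_zeta_eq:
  assumes "Re s > 1" shows "reg_zeta s = (s - 1) * Zeta P s"
proof -
  have "((\<lambda>X. npow X (s - 1)) \<longlongrightarrow> 0) at_top"
  proof (rule tendsto_norm_zero_cancel, rule Lim_transform_eventually)
    show "((\<lambda>X. X powr (- Re (s - 1))) \<longlongrightarrow> 0) at_top"
      using assms by (intro tendsto_neg_powr filterlim_ident) auto
    show "\<forall>\<^sub>F X in at_top. X powr (- Re (s - 1)) = norm (npow X (s - 1))"
      using eventually_gt_at_top[of 0] by eventually_elim (simp add: norm_npow)
  qed
  then have "((\<lambda>X. zeta_approx X s) \<longlongrightarrow> (s - 1) * Zeta P s + of_real c * (0 - 1)) at_top"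
    unfolding zeta_approx_def using assms
    by (intro tendsto_intros sum_elems_tendsto Zeta_has_sum) auto
  moreover have "filterlim (\<lambda>n. real (Suc n)) at_top sequentially"
    by (rule filterlim_compose[OF filterlim_real_sequentially filterlim_Suc])
  ultimately have "(\<lambda>n. zeta_approx (real (Suc n)) s) \<longlonglongrightarrow> (s - 1) * Zeta P s + of_real c * (0 - 1)"
    by (rule filterlim_compose)
  then show ?thesis by (simp add: reg_zeta_def limI)
qed

section \<open>Non-vanishing of zeta on the line Re s = 1\<close>

text \<open>For finite A the local inequalities multiply up and are inverted by the finite Euler
  product; the limit over finite subsets then reaches P. No logarithm of the full zeta function is
  formed.\<close>

lemma Zeta_3_4_1:
  assumes "\<sigma> > 1"
  shows "norm (Zeta P (of_real \<sigma>)) ^ 3 * norm (Zeta P (Complex \<sigma> t)) ^ 4 * norm (Zeta P (Complex \<sigma> (2 * t))) \<ge> 1"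
proof (rule tendsto_lowerbound)
  show "((\<lambda>A. norm (Zeta A (of_real \<sigma>)) ^ 3 * norm (Zeta A (Complex \<sigma> t)) ^ 4 * norm (Zeta A (Complex \<sigma> (2 * t)))) \<longlongrightarrow>
     norm (Zeta P (of_real \<sigma>)) ^ 3 * norm (Zeta P (Complex \<sigma> t)) ^ 4 * norm (Zeta P (Complex \<sigma> (2 * t)))) (finite_subsets_at_top P)"
    using assms by (intro tendsto_intros Zeta_finite_tendsto) auto
  have "norm (Zeta A (of_real \<sigma>)) ^ 3 * norm (Zeta A (Complex \<sigma> t)) ^ 4 * norm (Zeta A (Complex \<sigma> (2 * t))) \<ge> 1"
    if A: "finite A" "A \<subseteq> P" for A
  proof -
    let ?f = "\<lambda>s p. norm (1 - npow (Np p) s)"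
    let ?\<Pi> = "\<lambda>s. \<Prod>p\<in>A. ?f s p"
    have Z: "norm (Zeta A s) * ?\<Pi> s = 1" if "Re s > 1" for s
      using Zeta_finite[OF that A] by (metis norm_mult norm_one prod_norm)
    have le: "?f (of_real \<sigma>) p ^ 3 * ?f (Complex \<sigma> t) p ^ 4 * ?f (Complex \<sigma> (2 * t)) p \<le> 1" if "p \<in> A" for p
    proof -
      have p: "Np p > 1" using that A prime_norm_gt_1 by auto
      define w where "w = npow (Np p) (\<i> * t)"
      have w: "norm w = 1" using p by (simp add: w_def norm_npow)
      have e1: "npow (Np p) (Complex \<sigma> t) = of_real (Np p powr (- \<sigma>)) * w"
        using p by (simp add: Complex_eq w_def npow_add npow_of_real)
      have e2: "npow (Np p) (Complex \<sigma> (2 * t)) = of_real (Np p powr (- \<sigma>)) * w\<^sup>2"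
      proof -
        have "\<i> * of_real (2 * t) = \<i> * of_real t + \<i> * of_real t" by (simp add: algebra_simps)
        then show ?thesis using p by (simp only: Complex_eq w_def npow_add) (simp add: npow_of_real power2_eq_square)
      qed
      have "Np p powr (- \<sigma>) < 1" using p assms powr_less_mono[of "- \<sigma>" 0 "Np p"] by simp
      then show ?thesis
        using mertens_3_4_1[of "Np p powr (- \<sigma>)" w] w p unfolding e1 e2 by (simp add: npow_of_real)
    qed
    have "?\<Pi> (of_real \<sigma>) ^ 3 * ?\<Pi> (Complex \<sigma> t) ^ 4 * ?\<Pi> (Complex \<sigma> (2 * t))
        = (\<Prod>p\<in>A. ?f (of_real \<sigma>) p ^ 3 * ?f (Complex \<sigma> t) p ^ 4 * ?f (Complex \<sigma> (2 * t)) p)"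
      by (simp add: prod.distrib prod_power_distrib)
    also have "\<dots> \<le> 1" by (intro prod_le_1) (auto intro: le)
    finally have *: "?\<Pi> (of_real \<sigma>) ^ 3 * ?\<Pi> (Complex \<sigma> t) ^ 4 * ?\<Pi> (Complex \<sigma> (2 * t)) \<le> 1" .
    let ?z = "norm (Zeta A (of_real \<sigma>)) ^ 3 * norm (Zeta A (Complex \<sigma> t)) ^ 4 * norm (Zeta A (Complex \<sigma> (2 * t)))"
    have "1 = ?z * (?\<Pi> (of_real \<sigma>) ^ 3 * ?\<Pi> (Complex \<sigma> t) ^ 4 * ?\<Pi> (Complex \<sigma> (2 * t)))"
    proof -
      have "1 = (norm (Zeta A (of_real \<sigma>)) * ?\<Pi> (of_real \<sigma>)) ^ 3 * (norm (Zeta A (Complex \<sigma> t)) * ?\<Pi> (Complex \<sigma> t)) ^ 4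
          * (norm (Zeta A (Complex \<sigma> (2 * t))) * ?\<Pi> (Complex \<sigma> (2 * t)))"
        using Z[of "of_real \<sigma>"] Z[of "Complex \<sigma> t"] Z[of "Complex \<sigma> (2 * t)"] assms by simp
      then show ?thesis by (simp add: power_mult_distrib mult_ac)
    qed
    also have "\<dots> \<le> ?z * 1" using * by (intro mult_left_mono) auto
    finally show ?thesis by simp
  qed
  then show "\<forall>\<^sub>F A in finite_subsets_at_top P. 1 \<le> norm (Zeta A (of_real \<sigma>)) ^ 3 * norm (Zeta A (Complex \<sigma> t)) ^ 4 * norm (Zeta A (Complex \<sigma> (2 * t)))"
    unfolding eventually_finite_subsets_at_top by (intro exI[of _ "{}"]) auto
qed simp

lemma reg_zeta_continuous: "Re s > \<eta> \<Longrightarrow> isCont reg_zeta s"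
  using holomorphic_on_imp_continuous_on[OF reg_zeta_holomorphic]
  by (simp add: continuous_on_eq_continuous_at open_halfspace_Re_gt)

text \<open>A zero at 1 + it, taken to the fourth power, would outweigh the simple pole at 1, taken
  to the third, and push the 3-4-1 product below 1. At t = 0 the value is c.\<close>

lemma reg_zeta_nonzero:
  assumes "Re s \<ge> 1" shows "reg_zeta s \<noteq> 0"
proof (cases "Re s > 1")
  case True
  then show ?thesis using reg_zeta_eq[OF True] moebius_has_sum_inverse_Zeta(2)[OF True, of P] by auto
next
  case False
  define t where "t = Im s"
  have s: "s = Complex 1 t" using assms False by (simp add: complex_eq_iff t_def)
  show ?thesis
  proof (cases "t = 0")
    case True
    then show ?thesis using s c_pos by (simp add: reg_zeta_1 flip: one_complex.code)
  next
    case t: False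
    show ?thesis
    proof
      assume zero: "reg_zeta s = 0"
      have sh: "filterlim (\<lambda>x. z + complex_of_real x) (nhds z) (at_right 0)" for z
        by (auto intro!: tendsto_eq_intros filterlim_ident)
      have cont: "((\<lambda>x. reg_zeta (z + of_real x)) \<longlongrightarrow> reg_zeta z) (at_right 0)" if "Re z = 1" for z
        using reg_zeta_continuous[of z] that eta_less_1
        by (intro isCont_tendsto_compose[OF _ sh]) auto
      obtain D where D: "(reg_zeta has_field_derivative D) (at s)"
        using holomorphic_on_imp_differentiable_at[OF reg_zeta_holomorphic open_halfspace_Re_gt, of s] eta_less_1 s
        by (auto simp: field_differentiable_def)
      have "((\<lambda>h. (reg_zeta (s + h) - reg_zeta s) / h) \<longlongrightarrow> D) (at 0)"
        using D by (simp add: DERIV_def)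
      moreover have "filterlim complex_of_real (at 0) (at_right 0)"
        by (auto simp: filterlim_at eventually_at_filter intro!: tendsto_eq_intros filterlim_ident)
      ultimately have der: "((\<lambda>x. reg_zeta (s + of_real x) / of_real x) \<longlongrightarrow> D) (at_right 0)"
        unfolding zero by (drule_tac filterlim_compose) auto
      have algebraic_identity: "x * (\<bar>x\<bar> * y) ^ 3 * (a * z / \<bar>x\<bar> / a) ^ 4 * (b * v / b) = y ^ 3 * z ^ 4 * v"
        if "x > 0" "a \<noteq> 0" "b \<noteq> 0" for x y z v a b :: real
      proof -
        have "a * z / \<bar>x\<bar> / a = z / x" "b * v / b = v" using that by simp_all
        moreover have "x * x ^ 3 = x ^ 4" by (simp add: eval_nat_numeral)
        ultimately show ?thesis using that by (simp add: power_divide power_mult_distrib mult.assoc[symmetric])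
      qed
      \<comment> \<open>The 3-4-1 product at distance x to the right of the line, expressed through
        \<open>reg_zeta\<close>: x^(-3) from the pole against x^4 from the assumed zero leaves the
        single leading factor x.\<close>
      let ?u = "\<lambda>x :: real. x * norm (reg_zeta (1 + of_real x)) ^ 3 *
        (norm (reg_zeta (s + of_real x) / of_real x) / norm (\<i> * t + of_real x)) ^ 4 *
        (norm (reg_zeta (Complex 1 (2 * t) + of_real x)) / norm (\<i> * (2 * t) + of_real x))"
      have "(?u \<longlongrightarrow> 0 * norm (reg_zeta 1) ^ 3 * (norm D / norm (\<i> * t)) ^ 4 *
        (norm (reg_zeta (Complex 1 (2 * t))) / norm (\<i> * (2 * t)))) (at_right 0)"
        using t by (intro tendsto_intros cont der sh) auto
      then have "(?u \<longlongrightarrow> 0) (at_right 0)" by simp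
      then have "\<forall>\<^sub>F x in at_right 0. ?u x < 1" by (intro order_tendstoD(2)) auto
      moreover have "\<forall>\<^sub>F x in at_right 0. x > (0 :: real)" by (simp add: eventually_at_right_less)
      ultimately have "\<forall>\<^sub>F x in at_right 0. x > 0 \<and> ?u x < 1" by eventually_elim auto
      then obtain x where x: "x > 0" "?u x < 1"
        using eventually_happens'[of "at_right (0::real)"] by auto
      have e1: "reg_zeta (1 + of_real x) = of_real x * Zeta P (of_real (1 + x))"
        using x reg_zeta_eq[of "1 + of_real x"] by simp
      have e2: "reg_zeta (s + of_real x) = (\<i> * t + of_real x) * Zeta P (Complex (1 + x) t)"
      proof -
        have "s + of_real x = Complex (1 + x) t" "Complex (1 + x) t - 1 = \<i> * t + of_real x"
          by (auto simp: s complex_eq_iff)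
        then show ?thesis using x reg_zeta_eq[of "Complex (1 + x) t"] by simp
      qed
      have e3: "reg_zeta (Complex 1 (2 * t) + of_real x) = (\<i> * (2 * t) + of_real x) * Zeta P (Complex (1 + x) (2 * t))"
      proof -
        have "Complex 1 (2 * t) + of_real x = Complex (1 + x) (2 * t)" "Complex (1 + x) (2 * t) - 1 = \<i> * (2 * t) + of_real x"
          by (auto simp: complex_eq_iff)
        then show ?thesis using x reg_zeta_eq[of "Complex (1 + x) (2 * t)"] by simp
      qed
      have nz: "\<i> * t + of_real x \<noteq> 0" "\<i> * (2 * t) + of_real x \<noteq> 0"
        using t by (auto simp: complex_eq_iff)
      have "?u x = norm (Zeta P (of_real (1 + x))) ^ 3 * norm (Zeta P (Complex (1 + x) t)) ^ 4 * norm (Zeta P (Complex (1 + x) (2 * t)))"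
        unfolding e1 e2 e3 norm_mult norm_divide norm_of_real using x nz
        by (subst algebraic_identity) (auto simp del: zero_less_norm_iff)
      then show False using x Zeta_3_4_1[of "1 + x" t] by simp
    qed
  qed
qed

end

section \<open>Newman's Tauberian theorem\<close>

lemma Ln_imaginary_axis_diff:
  assumes "R > 0" shows "Ln (\<i> * of_real R) - Ln (- (\<i> * of_real R)) = \<i> * of_real pi"
proof -
  have "Ln (of_real R * z) = of_real (ln R) + Ln z" if "z \<noteq> 0" for z
    using assms that by (simp add: Ln_times_of_real Ln_of_real)
  from this[of \<i>] this[of "- \<i>"] show ?thesis by (simp add: mult.commute)
qed

text \<open>Cauchy's formula for a contour cut at \<open>\<plusminus>\<i>R\<close>, each half of which avoids a half line, so that
  no winding number has to be computed.\<close>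

lemma Cauchy_formula_two_arcs:
  fixes \<Phi> :: "complex \<Rightarrow> complex" and R :: real
  assumes S: "convex S" "open S" "0 \<in> S" and \<Phi>: "\<Phi> holomorphic_on S" and R: "R > 0"
    and g1: "valid_path g1" "pathstart g1 = - (\<i> * of_real R)" "pathfinish g1 = \<i> * of_real R"
      "path_image g1 \<subseteq> S - \<real>\<^sub>\<le>\<^sub>0"
    and g2: "valid_path g2" "pathstart g2 = \<i> * of_real R" "pathfinish g2 = - (\<i> * of_real R)"
      "path_image g2 \<subseteq> S - \<real>\<^sub>\<ge>\<^sub>0"
  shows "(\<lambda>z. \<Phi> z / z) contour_integrable_on g1" "(\<lambda>z. \<Phi> z / z) contour_integrable_on g2"
    and "contour_integral g1 (\<lambda>z. \<Phi> z / z) + contour_integral g2 (\<lambda>z. \<Phi> z / z) = 2 * of_real pi * \<i> * \<Phi> 0"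
proof -
  \<comment> \<open>The singularity of this quotient at 0 is removable, so it has a primitive on the
    convex set S and its integrals over the two arcs cancel. Only \<open>\<Phi> 0 / z\<close>
    remains.\<close>
  define F where "F z = (if z = 0 then deriv \<Phi> 0 else (\<Phi> z - \<Phi> 0) / (z - 0))" for z
  have "F holomorphic_on S"
    unfolding F_def[abs_def] using \<Phi> S(2) by (rule pole_lemma_open)
  then obtain p where p: "\<And>z. z \<in> S \<Longrightarrow> (p has_field_derivative F z) (at z within S)"
    using holomorphic_convex_primitive'[OF S(1,2)] by blast
  have i1: "(F has_contour_integral p (\<i> * of_real R) - p (- (\<i> * of_real R))) g1"
    using contour_integral_primitive[OF p g1(1)] g1 by auto
  have i2: "(F has_contour_integral p (- (\<i> * of_real R)) - p (\<i> * of_real R)) g2"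
    using contour_integral_primitive[OF p g2(1)] g2 by auto
  \<comment> \<open>Each arc gets the branch of the logarithm whose cut it avoids:
    \<open>Ln z\<close> on g1 and \<open>Ln (- z)\<close> on g2. Both increments are \<i>
    pi.\<close>
  have "((\<lambda>z. \<Phi> 0 / z) has_contour_integral \<Phi> 0 * Ln (pathfinish g1) - \<Phi> 0 * Ln (pathstart g1)) g1"
  proof (rule contour_integral_primitive[where S = "- \<real>\<^sub>\<le>\<^sub>0"])
    fix z :: complex assume "z \<in> - \<real>\<^sub>\<le>\<^sub>0"
    then show "((\<lambda>z. \<Phi> 0 * Ln z) has_field_derivative \<Phi> 0 / z) (at z within - \<real>\<^sub>\<le>\<^sub>0)"
      by (auto intro!: derivative_eq_intros simp: divide_inverse)
  qed (use g1 in auto)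
  then have l1: "((\<lambda>z. \<Phi> 0 / z) has_contour_integral \<Phi> 0 * (\<i> * of_real pi)) g1"
    using Ln_imaginary_axis_diff[OF R] g1 by (simp flip: right_diff_distrib)
  have "((\<lambda>z. \<Phi> 0 / z) has_contour_integral \<Phi> 0 * Ln (- pathfinish g2) - \<Phi> 0 * Ln (- pathstart g2)) g2"
  proof (rule contour_integral_primitive[where S = "- \<real>\<^sub>\<ge>\<^sub>0"])
    fix z :: complex assume z: "z \<in> - \<real>\<^sub>\<ge>\<^sub>0"
    then have "- z \<notin> \<real>\<^sub>\<le>\<^sub>0" "z \<noteq> 0" by auto
    then show "((\<lambda>z. \<Phi> 0 * Ln (- z)) has_field_derivative \<Phi> 0 / z) (at z within - \<real>\<^sub>\<ge>\<^sub>0)"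
      by (auto intro!: derivative_eq_intros simp: field_simps)
  qed (use g2 in auto)
  then have l2: "((\<lambda>z. \<Phi> 0 / z) has_contour_integral \<Phi> 0 * (\<i> * of_real pi)) g2"
    using Ln_imaginary_axis_diff[OF R] g2 by (simp flip: right_diff_distrib)
  have eq: "F z + \<Phi> 0 / z = \<Phi> z / z" if "z \<noteq> 0" for z
    using that by (simp add: F_def field_simps)
  have j1: "((\<lambda>z. \<Phi> z / z) has_contour_integral p (\<i> * of_real R) - p (- (\<i> * of_real R)) + \<Phi> 0 * (\<i> * of_real pi)) g1"
    by (rule has_contour_integral_eq[OF has_contour_integral_add[OF i1 l1]]) (use g1 in \<open>auto intro!: eq\<close>)
  have j2: "((\<lambda>z. \<Phi> z / z) has_contour_integral p (- (\<i> * of_real R)) - p (\<i> * of_real R) + \<Phi> 0 * (\<i> * of_real pi)) g2"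
    by (rule has_contour_integral_eq[OF has_contour_integral_add[OF i2 l2]]) (use g2 in \<open>auto intro!: eq\<close>)
  show "(\<lambda>z. \<Phi> z / z) contour_integrable_on g1" "(\<lambda>z. \<Phi> z / z) contour_integrable_on g2"
    using j1 j2 by (auto simp: contour_integrable_on_def)
  show "contour_integral g1 (\<lambda>z. \<Phi> z / z) + contour_integral g2 (\<lambda>z. \<Phi> z / z) = 2 * of_real pi * \<i> * \<Phi> 0"
    using contour_integral_unique[OF j1] contour_integral_unique[OF j2] by simp
qed

text \<open>On the circle R^2 = z times its conjugate, so 1 / z + z / R^2 collapses to 2 Re z / R^2.
  This zero on the imaginary axis cancels the 1 / Re z in Newman's hypotheses, and X^z cancels their
  power of X.\<close>

lemma norm_newman_kernel:
  assumes "norm z = R" "R > 0" "X > 0"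
  shows "norm (npow X (- z) * (1 + z\<^sup>2 / of_real (R\<^sup>2)) / z) = X powr Re z * (2 * \<bar>Re z\<bar> / R\<^sup>2)"
proof -
  have z0: "z \<noteq> 0" using assms by auto
  have "(1 + z\<^sup>2 / of_real (R\<^sup>2)) / z = (cnj z + z) / of_real (R\<^sup>2)"
  proof -
    have "of_real (R\<^sup>2) = z * cnj z" using assms complex_norm_square[of z] by simp
    moreover have "(1 + z\<^sup>2 / (z * cnj z)) / z = (cnj z + z) / (z * cnj z)"
      using z0 by (simp add: field_simps power2_eq_square)
    ultimately show ?thesis by simp
  qed
  also have "cnj z + z = of_real (2 * Re z)" by (simp add: complex_eq_iff)
  finally have "norm ((1 + z\<^sup>2 / of_real (R\<^sup>2)) / z) = 2 * \<bar>Re z\<bar> / R\<^sup>2"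
    by (simp only: norm_divide norm_of_real) (simp add: abs_mult)
  moreover have "norm (npow X (- z) * (1 + z\<^sup>2 / of_real (R\<^sup>2)) / z)
      = norm (npow X (- z)) * norm ((1 + z\<^sup>2 / of_real (R\<^sup>2)) / z)"
    by (simp add: norm_mult norm_divide)
  ultimately show ?thesis using assms by (simp add: norm_npow)
qed

lemma right_semicircle_image:
  assumes "z \<in> path_image (part_circlepath 0 R (- (pi / 2)) (pi / 2))" "R > 0"
  shows "norm z = R" "Re z \<ge> 0"
proof -
  obtain \<theta> where \<theta>: "- (pi / 2) \<le> \<theta>" "\<theta> \<le> pi / 2" "z = of_real R * cis \<theta>"
    using assms unfolding path_image_part_circlepath' by (auto simp: closed_segment_eq_real_ivl split: if_splits)
  then show "norm z = R" "Re z \<ge> 0" using assms cos_ge_zero[of \<theta>] by (auto simp: norm_mult)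
qed

lemma left_semicircle_image:
  assumes "z \<in> path_image (part_circlepath 0 R (pi / 2) (3 * pi / 2))" "R > 0"
  shows "norm z = R" "Re z \<le> 0"
proof -
  obtain \<theta> where \<theta>: "pi / 2 \<le> \<theta>" "\<theta> \<le> 3 * pi / 2" "z = of_real R * cis \<theta>"
    using assms unfolding path_image_part_circlepath' by (auto simp: closed_segment_eq_real_ivl split: if_splits)
  have "cos (\<theta> - pi) \<ge> 0" using \<theta> by (intro cos_ge_zero) (auto simp: field_simps)
  then have "cos \<theta> \<le> 0" by simp
  then show "norm z = R" "Re z \<le> 0" using assms \<theta> by (auto simp: norm_mult mult_nonneg_nonpos)
qed

lemma norm_eq_Re_zero:
  assumes "norm z = R" "Re z = 0" shows "z \<in> {\<i> * of_real R, - (\<i> * of_real R)}"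
proof -
  have "\<bar>Im z\<bar> = R" using assms by (simp add: cmod_def)
  then show ?thesis using assms by (auto simp: complex_eq_iff abs_if split: if_splits)
qed

text \<open>In the application \<open>H X\<close> is a transform truncated at X and G continues its
  limit across the imaginary axis. The proof sees only the two bounds, which are exactly what makes
  the integrals over both half circles O(1 / R) uniformly in X; the rest of the contour lies where
  X^z decays.\<close>

theorem newman_tauberian:
  fixes G :: "complex \<Rightarrow> complex" and H :: "real \<Rightarrow> complex \<Rightarrow> complex" and C :: real
  assumes \<Omega>: "open \<Omega>" "{z. Re z \<ge> 0} \<subseteq> \<Omega>" and G: "G holomorphic_on \<Omega>"
    and H: "\<And>X. X \<ge> 1 \<Longrightarrow> H X holomorphic_on UNIV" and C: "C \<ge> 0"
    and right: "\<And>X z. X \<ge> 1 \<Longrightarrow> Re z > 0 \<Longrightarrow> norm (G z - H X z) \<le> C * X powr (- Re z) / Re z"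
    and left: "\<And>X z. X \<ge> 1 \<Longrightarrow> Re z < 0 \<Longrightarrow> norm (H X z) \<le> C * X powr (- Re z) / (- Re z)"
  shows "((\<lambda>X. H X 0) \<longlongrightarrow> G 0) at_top"
proof (rule tendstoI)
  fix e :: real assume e: "e > 0"
  \<comment> \<open>Each half circle contributes at most 2 pi C / R; this radius makes 2 C / R < e /
    2.\<close>
  define R where "R = 4 * C / e + 1"
  have R: "R > 0" using C e by (simp add: R_def add_nonneg_pos)
  have RC: "2 * C / R < e / 2" using R e C by (simp add: R_def field_simps)
  define I where "I = \<i> * complex_of_real R"
  have I: "Re I = 0" "Im I = R" by (simp_all add: I_def)
  \<comment> \<open>Only openness of \<Omega> is known, so compactness of a segment of the imaginary
    axis supplies the width of a strip inside \<Omega>. Height R + 1 rather than R leaves room for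
    the open set S to contain the points of height R on the contour.\<close>
  let ?S0 = "{z. Re z \<ge> 0} \<inter> {z. Re z \<le> 0} \<inter> cball 0 (R + 1)"
  have "compact ?S0"
    by (intro closed_Int_compact closed_Int closed_halfspace_Re_ge closed_halfspace_Re_le compact_cball)
  then obtain \<epsilon> where \<epsilon>: "\<epsilon> > 0" "(\<Union>x\<in>?S0. cball x \<epsilon>) \<subseteq> \<Omega>"
    using compact_subset_open_imp_cball_epsilon_subset[of ?S0 \<Omega>] \<Omega> by blast
  define S where "S = {z. Re z > - \<epsilon>} \<inter> {z. Im z > - (R + 1)} \<inter> {z. Im z < R + 1}"
  have S: "convex S" "open S" "0 \<in> S"
    unfolding S_def using \<epsilon> R
    by (auto intro!: convex_Int open_Int convex_halfspace_Re_gt convex_halfspace_Im_gt convex_halfspace_Im_lt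
        open_halfspace_Re_gt open_halfspace_Im_gt open_halfspace_Im_lt)
  have S\<Omega>: "S \<subseteq> \<Omega>"
  proof
    fix z assume z: "z \<in> S"
    show "z \<in> \<Omega>"
    proof (cases "Re z \<ge> 0")
      case False
      have "Complex 0 (Im z) \<in> ?S0" using z by (auto simp: S_def dist_norm cmod_def)
      moreover have "z \<in> cball (Complex 0 (Im z)) \<epsilon>"
        using z False by (auto simp: S_def dist_norm cmod_def)
      ultimately show ?thesis using \<epsilon> by blast
    qed (use \<Omega> in auto)
  qed
  have GS: "G holomorphic_on S" using G S\<Omega> by (rule holomorphic_on_subset)
  let ?K = "{z. Re z \<ge> - (\<epsilon> / 2)} \<inter> {z. Im z \<ge> - R} \<inter> {z. Im z \<le> R} \<inter> {z. Re z \<le> 0}"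
  have "?K \<subseteq> S" using \<epsilon> by (auto simp: S_def)
  moreover have "compact ?K"
  proof -
    have "?K = cbox (Complex (- (\<epsilon> / 2)) (- R)) (Complex 0 R)" by (auto simp: in_cbox_complex_iff)
    then show ?thesis by simp
  qed
  ultimately have "bounded (G ` ?K)"
    using GS by (intro compact_imp_bounded compact_continuous_image holomorphic_on_imp_continuous_on)
      (auto intro: holomorphic_on_subset)
  then obtain D where D: "D > 0" "\<And>z. z \<in> ?K \<Longrightarrow> norm (G z) \<le> D"
    by (auto simp: bounded_pos)
  \<comment> \<open>The bound D holds on a rectangle fixed beforehand, so \<delta> may depend on it.
    The two horizontal sides have length \<delta> and integrand at most 3 D / R, which explains the
    12: together they cost at most e / 2.\<close>
  define \<delta> where "\<delta> = min (\<epsilon> / 2) (min R (e * R / (12 * D)))"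
  have \<delta>: "\<delta> > 0" "\<delta> \<le> \<epsilon> / 2" "\<delta> \<le> R" "\<delta> \<le> e * R / (12 * D)"
    using \<epsilon> R e D by (auto simp: \<delta>_def)
  have "((\<lambda>X. D * (1 / \<delta> + 2 / R) * (2 * R) * X powr (- \<delta>)) \<longlongrightarrow> D * (1 / \<delta> + 2 / R) * (2 * R) * 0) at_top"
    using \<delta> by (intro tendsto_intros tendsto_neg_powr filterlim_ident) auto
  then have "\<forall>\<^sub>F X in at_top. D * (1 / \<delta> + 2 / R) * (2 * R) * X powr (- \<delta>) < e / 2"
    using e by (intro order_tendstoD(2)) auto
  moreover have "\<forall>\<^sub>F X in at_top. X \<ge> (1 :: real)" by (rule eventually_ge_at_top)
  ultimately show "\<forall>\<^sub>F X in at_top. dist (H X 0) (G 0) < e"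
  proof eventually_elim
    case (elim X)
    define k where "k z = npow X (- z) * (1 + z\<^sup>2 / of_real (R\<^sup>2))" for z
    have k_hol: "k holomorphic_on T" for T
      unfolding k_def using R by (intro holomorphic_intros) auto
    have k0: "k 0 = 1" by (simp add: k_def)
    define gR where "gR = part_circlepath 0 R (- (pi / 2)) (pi / 2)"
    define gL where "gL = part_circlepath 0 R (pi / 2) (3 * pi / 2)"
    define a where "a = I - of_real \<delta>"
    define b where "b = - I - of_real \<delta>"
    define J where "J = linepath I a +++ (linepath a b +++ linepath b (- I))"
    have ab: "Re a = - \<delta>" "Im a = R" "Re b = - \<delta>" "Im b = - R" by (simp_all add: a_def b_def I)
    have seg1: "closed_segment I a \<subseteq> {z. Re z \<ge> - \<delta>} \<inter> {z. Re z \<le> 0} \<inter> {z. Im z \<ge> R} \<inter> {z. Im z \<le> R}"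
      using \<delta> by (intro closed_segment_subset convex_Int convex_halfspace_Re_ge convex_halfspace_Re_le
          convex_halfspace_Im_ge convex_halfspace_Im_le) (auto simp: ab I)
    have seg2: "closed_segment a b \<subseteq> {z. Re z \<ge> - \<delta>} \<inter> {z. Re z \<le> - \<delta>} \<inter> {z. Im z \<ge> - R} \<inter> {z. Im z \<le> R}"
      using \<delta> R by (intro closed_segment_subset convex_Int convex_halfspace_Re_ge convex_halfspace_Re_le
          convex_halfspace_Im_ge convex_halfspace_Im_le) (auto simp: ab I)
    have seg3: "closed_segment b (- I) \<subseteq> {z. Re z \<ge> - \<delta>} \<inter> {z. Re z \<le> 0} \<inter> {z. Im z \<ge> - R} \<inter> {z. Im z \<le> - R}"
      using \<delta> by (intro closed_segment_subset convex_Int convex_halfspace_Re_ge convex_halfspace_Re_le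
          convex_halfspace_Im_ge convex_halfspace_Im_le) (auto simp: ab I)
    have J_image: "path_image J = closed_segment I a \<union> (closed_segment a b \<union> closed_segment b (- I))"
      unfolding J_def by (simp add: path_image_join)
    have gR: "valid_path gR" "pathstart gR = - (\<i> * of_real R)" "pathfinish gR = \<i> * of_real R"
    proof -
      have "cis (- (pi / 2)) = - \<i>" by (simp add: complex_eq_iff)
      then have "exp (\<i> * of_real (- (pi / 2))) = - \<i>" by (simp only: cis_conv_exp)
      then show "pathstart gR = - (\<i> * of_real R)" by (simp add: gR_def mult.commute)
    qed (simp_all add: gR_def valid_path_part_circlepath mult.commute exp_eq_polar)
    have gL: "valid_path gL" "pathstart gL = \<i> * of_real R" "pathfinish gL = - (\<i> * of_real R)"
    proof -
      have "3 * pi / 2 = pi + pi / 2" by simp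
      then have "cis (3 * pi / 2) = - \<i>"
        by (simp only: complex_eq_iff cis.simps cos_add sin_add) simp
      then show "pathfinish gL = - (\<i> * of_real R)" by (simp add: gL_def exp_eq_polar mult.commute)
    qed (simp_all add: gL_def valid_path_part_circlepath mult.commute exp_eq_polar)
    have J: "valid_path J" "pathstart J = \<i> * of_real R" "pathfinish J = - (\<i> * of_real R)"
      by (auto simp: J_def I_def intro!: valid_path_join)
    have gR_im: "path_image gR \<subseteq> S - \<real>\<^sub>\<le>\<^sub>0"
    proof
      fix z assume "z \<in> path_image gR"
      then have z: "norm z = R" "Re z \<ge> 0" using right_semicircle_image R unfolding gR_def by blast+
      then have "\<bar>Im z\<bar> < R + 1" using abs_Im_le_cmod[of z] by simp
      moreover have "z \<notin> \<real>\<^sub>\<le>\<^sub>0"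
      proof
        assume "z \<in> \<real>\<^sub>\<le>\<^sub>0"
        then have "z = 0" using z by (auto simp: complex_nonpos_Reals_iff complex_eq_iff)
        then show False using z R by simp
      qed
      ultimately show "z \<in> S - \<real>\<^sub>\<le>\<^sub>0" using z \<epsilon> by (auto simp: S_def)
    qed
    have gL_im: "path_image gL \<subseteq> UNIV - \<real>\<^sub>\<ge>\<^sub>0"
    proof
      fix z assume "z \<in> path_image gL"
      then have z: "norm z = R" "Re z \<le> 0" using left_semicircle_image R unfolding gL_def by blast+
      have "z \<notin> \<real>\<^sub>\<ge>\<^sub>0"
      proof
        assume "z \<in> \<real>\<^sub>\<ge>\<^sub>0"
        then have "z = 0" using z by (auto simp: complex_nonneg_Reals_iff complex_eq_iff)
        then show False using z R by simp
      qed
      then show "z \<in> UNIV - \<real>\<^sub>\<ge>\<^sub>0" by simp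
    qed
    have J_im: "path_image J \<subseteq> S - \<real>\<^sub>\<ge>\<^sub>0"
    proof
      fix z assume "z \<in> path_image J"
      then show "z \<in> S - \<real>\<^sub>\<ge>\<^sub>0"
        using subsetD[OF seg1, of z] subsetD[OF seg2, of z] subsetD[OF seg3, of z] R \<delta> \<epsilon> unfolding J_image
        by (auto simp: S_def complex_nonneg_Reals_iff)
    qed
    have HX: "H X holomorphic_on UNIV" using elim by (intro H) auto
    let ?g = "\<lambda>z. G z * k z / z" and ?h = "\<lambda>z. H X z * k z / z"
    note cG = Cauchy_formula_two_arcs[OF S holomorphic_on_mult[OF GS k_hol] R gR gR_im J J_im]
    \<comment> \<open>\<open>H X\<close> is entire, so its left arc can stay on the circle, where
      the bound \<open>left\<close> applies. G is available only on S, hence the flat path J for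
      it.\<close>
    note cH = Cauchy_formula_two_arcs[of UNIV, OF _ _ _ holomorphic_on_mult[OF HX k_hol] R gR _ gL gL_im]
    have gR_im': "path_image gR \<subseteq> UNIV - \<real>\<^sub>\<le>\<^sub>0" using gR_im by auto
    have 1: "2 * of_real pi * \<i> * (G 0 - H X 0)
        = contour_integral gR (\<lambda>z. ?g z - ?h z) + contour_integral J ?g - contour_integral gL ?h"
    proof -
      have "contour_integral gR (\<lambda>z. ?g z - ?h z) = contour_integral gR ?g - contour_integral gR ?h"
        using cG(1) cH(1) gR_im' by (intro contour_integral_diff) auto
      moreover have "contour_integral gR ?g + contour_integral J ?g = 2 * of_real pi * \<i> * G 0"
        using cG(3) k0 by simp
      moreover have "contour_integral gR ?h + contour_integral gL ?h = 2 * of_real pi * \<i> * H X 0"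
        using cH(3) gR_im' k0 by simp
      moreover have "x - y = u + j - l" if "u = v - w" "v + j = x" "w + l = y" for u v w x y j l :: complex
        using that by auto
      ultimately show ?thesis unfolding right_diff_distrib by blast
    qed
    have bR: "norm (contour_integral gR (\<lambda>z. ?g z - ?h z)) \<le> 2 * C / R\<^sup>2 * R * (pi / 2 - - (pi / 2))"
      unfolding gR_def
    \<comment> \<open>The end points have Re z = 0, where the hypothesis says nothing; a finite
      exceptional set may be left out of the estimate.\<close>
    proof (rule contour_integral_bound_part_circlepath_strong[where k = "{I, - I}"])
      show "(\<lambda>z. ?g z - ?h z) contour_integrable_on part_circlepath 0 R (- (pi / 2)) (pi / 2)"
        using cG(1) cH(1) gR_im' unfolding gR_def by (intro contour_integrable_diff) auto
      fix z assume "z \<in> path_image (part_circlepath 0 R (- (pi / 2)) (pi / 2)) - {I, - I}"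
      then have z: "norm z = R" "Re z \<ge> 0" "z \<notin> {I, - I}"
        using right_semicircle_image R by blast+
      then have "Re z \<noteq> 0" using norm_eq_Re_zero[of z R] unfolding I_def by blast
      then have Re: "Re z > 0" using z by simp
      have kz: "norm (k z / z) = X powr Re z * (2 * \<bar>Re z\<bar> / R\<^sup>2)"
        unfolding k_def by (rule norm_newman_kernel[OF z(1) R]) (use elim in simp)
      have "norm (?g z - ?h z) = norm (G z - H X z) * norm (k z / z)"
        by (simp add: norm_mult norm_divide diff_divide_distrib[symmetric] left_diff_distrib[symmetric])
      also have "\<dots> \<le> (C * X powr (- Re z) / Re z) * (X powr Re z * (2 * \<bar>Re z\<bar> / R\<^sup>2))"
        unfolding kz by (rule mult_right_mono[OF right]) (use elim Re in simp_all)
      also have "\<dots> = 2 * C / R\<^sup>2"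
        using Re elim by (simp add: powr_minus field_simps)
      finally show "norm (?g z - ?h z) \<le> 2 * C / R\<^sup>2" .
    qed (use R C in auto)
    have bL: "norm (contour_integral gL ?h) \<le> 2 * C / R\<^sup>2 * R * (3 * pi / 2 - pi / 2)"
      unfolding gL_def
    proof (rule contour_integral_bound_part_circlepath_strong[where k = "{I, - I}"])
      show "?h contour_integrable_on part_circlepath 0 R (pi / 2) (3 * pi / 2)"
        using cH(2) gR_im' unfolding gL_def by auto
      fix z assume "z \<in> path_image (part_circlepath 0 R (pi / 2) (3 * pi / 2)) - {I, - I}"
      then have z: "norm z = R" "Re z \<le> 0" "z \<notin> {I, - I}"
        using left_semicircle_image R by blast+
      then have "Re z \<noteq> 0" using norm_eq_Re_zero[of z R] unfolding I_def by blast
      then have Re: "Re z < 0" using z by simp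
      have kz: "norm (k z / z) = X powr Re z * (2 * \<bar>Re z\<bar> / R\<^sup>2)"
        unfolding k_def by (rule norm_newman_kernel[OF z(1) R]) (use elim in simp)
      have "norm (?h z) = norm (H X z) * norm (k z / z)"
        by (simp add: norm_mult norm_divide)
      also have "\<dots> \<le> (C * X powr (- Re z) / (- Re z)) * (X powr Re z * (2 * \<bar>Re z\<bar> / R\<^sup>2))"
        unfolding kz by (rule mult_right_mono[OF left[OF elim(2) Re]]) simp
      also have "\<dots> = 2 * C / R\<^sup>2"
        using Re elim by (simp add: powr_minus field_simps)
      finally show "norm (?h z) \<le> 2 * C / R\<^sup>2" .
    qed (use R C in auto)
    \<comment> \<open>The lower bound m for the modulus is R on the horizontal sides and \<delta> on
      the vertical one.\<close>
    have kbd: "norm (?g z) \<le> D * X powr Re z * (1 / m + 2 / R)"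
      if z: "z \<in> ?K" "Re z \<ge> - R" "m > 0" "norm z \<ge> m" for z m
    proof -
      have z0: "z \<noteq> 0" using z by auto
      have "norm z \<le> \<bar>Re z\<bar> + \<bar>Im z\<bar>" by (rule cmod_le)
      then have z2: "norm z \<le> 2 * R" using z by auto
      have "(1 + z\<^sup>2 / of_real (R\<^sup>2)) / z = 1 / z + z / of_real (R\<^sup>2)"
        using z0 by (simp add: field_simps power2_eq_square)
      then have "norm ((1 + z\<^sup>2 / of_real (R\<^sup>2)) / z) \<le> norm (1 / z) + norm (z / of_real (R\<^sup>2))"
        using norm_triangle_ineq by metis
      also have "norm (1 / z) \<le> 1 / m" using z by (simp add: norm_divide frac_le)
      also have "norm (z / of_real (R\<^sup>2)) \<le> 2 * R / R\<^sup>2"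
        using z2 R by (simp add: norm_divide norm_power divide_right_mono)
      also have "2 * R / R\<^sup>2 = 2 / R" by (simp add: power2_eq_square)
      finally have q: "norm ((1 + z\<^sup>2 / of_real (R\<^sup>2)) / z) \<le> 1 / m + 2 / R" by simp
      have "norm (?g z) = norm (G z) * norm (npow X (- z)) * norm ((1 + z\<^sup>2 / of_real (R\<^sup>2)) / z)"
        by (simp add: k_def norm_mult norm_divide)
      also have "\<dots> \<le> D * X powr Re z * (1 / m + 2 / R)"
        using elim z D by (intro mult_mono q) (auto simp: norm_npow)
      finally show ?thesis .
    qed
    have int_J: "?g contour_integrable_on J" by (rule cG(2))
    have int2: "?g contour_integrable_on (linepath a b +++ linepath b (- I))"
      using int_J unfolding J_def by (rule contour_integrable_joinD2) auto
    have i1: "?g contour_integrable_on linepath I a"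
      using int_J unfolding J_def by (rule contour_integrable_joinD1) auto
    have i2: "?g contour_integrable_on linepath a b"
      using int2 by (rule contour_integrable_joinD1) auto
    have i3: "?g contour_integrable_on linepath b (- I)"
      using int2 by (rule contour_integrable_joinD2) auto
    have Jsum: "contour_integral J ?g = contour_integral (linepath I a) ?g
        + (contour_integral (linepath a b) ?g + contour_integral (linepath b (- I)) ?g)"
      unfolding J_def using i1 i2 i3 int2 by (simp add: contour_integral_join)
    have hor: "norm (?g z) \<le> D * (3 / R)" if "z \<in> ?K" "\<bar>Im z\<bar> = R" "Re z \<ge> - R" for z
    proof -
      have "norm (?g z) \<le> D * X powr Re z * (1 / R + 2 / R)"
        using that R abs_Im_le_cmod[of z] by (intro kbd) auto
      also have "\<dots> \<le> D * 1 * (1 / R + 2 / R)"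
        using D R that elim powr_mono[of "Re z" 0 X] by (intro mult_right_mono mult_left_mono) auto
      finally show ?thesis by (simp add: add_divide_distrib[symmetric])
    qed
    have b1: "norm (contour_integral (linepath I a) ?g) \<le> D * (3 / R) * norm (a - I)"
    proof (rule contour_integral_bound_linepath[OF i1])
      fix z assume "z \<in> closed_segment I a"
      then show "norm (?g z) \<le> D * (3 / R)" using subsetD[OF seg1, of z] \<delta> R by (intro hor) auto
    qed (use D R in auto)
    have b3: "norm (contour_integral (linepath b (- I)) ?g) \<le> D * (3 / R) * norm (- I - b)"
    proof (rule contour_integral_bound_linepath[OF i3])
      fix z assume "z \<in> closed_segment b (- I)"
      then show "norm (?g z) \<le> D * (3 / R)" using subsetD[OF seg3, of z] \<delta> R by (intro hor) auto
    qed (use D R in auto)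
    have b2: "norm (contour_integral (linepath a b) ?g) \<le> D * X powr (- \<delta>) * (1 / \<delta> + 2 / R) * norm (b - a)"
    proof (rule contour_integral_bound_linepath[OF i2])
      fix z assume "z \<in> closed_segment a b"
      then have z: "Re z = - \<delta>" "Im z \<ge> - R" "Im z \<le> R" using subsetD[OF seg2, of z] by auto
      then have "norm (?g z) \<le> D * X powr Re z * (1 / \<delta> + 2 / R)"
        using \<delta> abs_Re_le_cmod[of z] by (intro kbd) auto
      then show "norm (?g z) \<le> D * X powr (- \<delta>) * (1 / \<delta> + 2 / R)" using z by simp
    qed (use D R \<delta> in auto)
    have lens: "norm (a - I) = \<delta>" "norm (- I - b) = \<delta>" "norm (b - a) = 2 * R"
    proof -
      have "b - a = - (2 * I)" by (simp add: a_def b_def)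
      then show "norm (b - a) = 2 * R" using R by (simp add: I_def norm_mult)
    qed (use \<delta> in \<open>simp_all add: a_def b_def\<close>)
    have "norm (contour_integral J ?g) \<le> D * (3 / R) * \<delta> + (D * X powr (- \<delta>) * (1 / \<delta> + 2 / R) * (2 * R) + D * (3 / R) * \<delta>)"
      unfolding Jsum using b1 b2 b3 unfolding lens
      by (intro order.trans[OF norm_triangle_ineq] add_mono) auto
    also have "\<dots> = 2 * (D * (3 / R) * \<delta>) + D * (1 / \<delta> + 2 / R) * (2 * R) * X powr (- \<delta>)" by (simp add: algebra_simps)
    also have "\<dots> \<le> e / 2 + e / 2"
    proof (rule add_mono)
      have "D * (3 / R) * \<delta> \<le> D * (3 / R) * (e * R / (12 * D))" using \<delta> D R by (intro mult_left_mono) auto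
      also have "\<dots> = e / 4" using D R by simp
      finally show "2 * (D * (3 / R) * \<delta>) \<le> e / 2" by simp
    qed (use elim in auto)
    finally have bJ: "norm (contour_integral J ?g) \<le> e" by simp
    have "2 * pi * norm (G 0 - H X 0) = norm (2 * of_real pi * \<i> * (G 0 - H X 0))"
      by (simp add: norm_mult)
    also have "\<dots> \<le> 2 * C / R\<^sup>2 * R * pi + e + 2 * C / R\<^sup>2 * R * pi"
      unfolding 1 using bR bJ bL
      by (intro order.trans[OF norm_triangle_ineq4] order.trans[OF norm_triangle_ineq] add_mono) (auto simp: field_simps)
    also have "\<dots> = 2 * pi * (2 * C / R) + e" using R by (simp add: power2_eq_square field_simps)
    also have "\<dots> < 2 * pi * (e / 2) + 2 * pi * (e / 2)"
    proof (rule add_less_le_mono)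
      show "2 * pi * (2 * C / R) < 2 * pi * (e / 2)" using RC by (intro mult_strict_left_mono) auto
      show "e \<le> 2 * pi * (e / 2)" using pi_gt3 e by simp
    qed
    also have "\<dots> = 2 * pi * e" by simp
    finally have "norm (G 0 - H X 0) < e" by simp
    then show ?case by (simp add: dist_norm norm_minus_commute)
  qed
qed

context arithmetical_semigroup
begin

section \<open>Sums of the Moebius function\<close>

text \<open>The Dirichlet coefficients of 1 / \<open>Zeta (P - A) s\<close>.\<close>

definition mu_off :: "'p set \<Rightarrow> 'p multiset \<Rightarrow> complex" where
  "mu_off A h = (if set_mset h \<inter> A = {} then gmoebius h else 0)"

abbreviation moebius_sum :: "'p set \<Rightarrow> real \<Rightarrow> complex" where
  "moebius_sum A y \<equiv> \<Sum>h\<in>elems y. mu_off A h / of_real (nm h)"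

lemma norm_mu_off_le: "norm (mu_off A h) \<le> 1"
  using norm_gmoebius_le[of h] by (simp add: mu_off_def)

definition mertens :: "'p set \<Rightarrow> real \<Rightarrow> complex" where
  "mertens A x = (\<Sum>g\<in>elems x. mu_off A g)"

lemma norm_mertens_le: "x \<ge> 1 \<Longrightarrow> norm (mertens A x) \<le> C * x"
  unfolding mertens_def using norm_sum_elems_le[of "mu_off A" 1 x] norm_mu_off_le by simp

text \<open>By partial summation this is 1 + z times the integral of M(u) u^(-z-2) over [1, X], with
  M = \<open>mertens A\<close>. The form without an integral is visibly entire in z.\<close>

definition mertens_transform :: "'p set \<Rightarrow> real \<Rightarrow> complex \<Rightarrow> complex" where
  "mertens_transform A X z = (\<Sum>g\<in>elems X. mu_off A g * npow (nm g) (1 + z)) - mertens A X * npow X (1 + z)"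

text \<open>Both bounds of Newman's theorem come from here: X = 1 gives the one for Re z < 0, and Y
  tending to infinity the one for Re z > 0.\<close>

lemma mertens_transform_diff:
  assumes "1 \<le> X" "X \<le> Y" "Re z \<noteq> 0"
  shows "norm (mertens_transform A Y z - mertens_transform A X z)
      \<le> norm (1 + z) * C * (X powr (- Re z) - Y powr (- Re z)) / Re z"
proof -
  let ?D = "norm (1 + z) * C"
  have bound: "norm ((\<Sum>g\<in>elems Y. mu_off A g) * npow Y (1 + z) - (\<Sum>g\<in>elems X. mu_off A g) * npow X (1 + z)
      - (\<Sum>g\<in>elems Y - elems X. mu_off A g * npow (nm g) (1 + z)))
    \<le> ?D * Y powr (- Re z) / (- Re z) - ?D * X powr (- Re z) / (- Re z)"
  proof (rule abel_summation_bound[OF assms(2)])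
    fix u assume u: "u \<in> {X..Y}"
    then have u1: "u \<ge> 1" using assms by auto
    show "((\<lambda>u. npow u (1 + z)) has_vector_derivative - (1 + z) * npow u (1 + z + 1)) (at u)"
      by (rule npow_has_vector_derivative) (use u1 in auto)
    show "((\<lambda>u. ?D * u powr (- Re z) / (- Re z)) has_real_derivative ?D * u powr (- Re z - 1)) (at u)"
      by (rule has_real_derivative_powr_div) (use u1 assms in auto)
    have "norm (\<Sum>g\<in>elems u. mu_off A g) * norm (- (1 + z) * npow u (1 + z + 1))
        \<le> (C * u) * (norm (1 + z) * u powr (- Re (1 + z + 1)))"
      using norm_mertens_le[OF u1, of A] u1 C_pos unfolding mertens_def
      by (intro mult_mono) (simp_all only: norm_mult norm_minus_cancel norm_npow, simp_all)
    also have "\<dots> = ?D * (u powr 1 * u powr (- Re (1 + z + 1)))" using u1 by simp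
    also have "u powr 1 * u powr (- Re (1 + z + 1)) = u powr (- Re z - 1)"
      unfolding powr_add[symmetric] by (rule arg_cong[of _ _ "(powr) u"]) simp
    finally show "norm (\<Sum>g\<in>elems u. mu_off A g) * norm (- (1 + z) * npow u (1 + z + 1)) \<le> ?D * u powr (- Re z - 1)" .
  qed
  have "(\<Sum>g\<in>elems Y. mu_off A g * npow (nm g) (1 + z)) = (\<Sum>g\<in>elems Y - elems X. mu_off A g * npow (nm g) (1 + z))
      + (\<Sum>g\<in>elems X. mu_off A g * npow (nm g) (1 + z))"
    by (rule sum.subset_diff) (use elems_mono[OF assms(2)] in auto)
  then have "mertens_transform A Y z - mertens_transform A X z = - ((\<Sum>g\<in>elems Y. mu_off A g) * npow Y (1 + z)
      - (\<Sum>g\<in>elems X. mu_off A g) * npow X (1 + z) - (\<Sum>g\<in>elems Y - elems X. mu_off A g * npow (nm g) (1 + z)))"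
    by (simp add: mertens_transform_def mertens_def)
  then have "norm (mertens_transform A Y z - mertens_transform A X z)
      \<le> ?D * Y powr (- Re z) / (- Re z) - ?D * X powr (- Re z) / (- Re z)"
    using bound by (simp only: norm_minus_cancel)
  also have "\<dots> = ?D * (X powr (- Re z) - Y powr (- Re z)) / Re z"
    by (simp add: field_simps diff_divide_distrib)
  finally show ?thesis .
qed

lemma mertens_transform_1: "mertens_transform A 1 z = 0"
  by (simp add: mertens_transform_def mertens_def elems_1)

lemma mertens_transform_left:
  assumes "1 \<le> X" "Re z < 0"
  shows "norm (mertens_transform A X z) \<le> norm (1 + z) * (C * X powr (- Re z) / (- Re z))"
proof -
  have "norm (mertens_transform A X z) \<le> norm (1 + z) * C * (1 - X powr (- Re z)) / Re z"
    using mertens_transform_diff[of 1 X z A] assms by (simp add: mertens_transform_1)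
  also have "\<dots> = norm (1 + z) * (C * (X powr (- Re z) - 1) / (- Re z))"
  proof -
    have "(1 - y) / r = (y - 1) / (- r)" for y r :: real by (metis minus_diff_eq minus_divide_divide)
    then show ?thesis by (simp only: times_divide_eq_right[symmetric] mult.assoc)
  qed
  also have "\<dots> \<le> norm (1 + z) * (C * X powr (- Re z) / (- Re z))"
    using assms C_pos by (intro mult_left_mono divide_right_mono) auto
  finally show ?thesis .
qed

text \<open>Continues the inverse of \<open>Zeta (P - A) s\<close> to the line Re s = 1 and beyond.
  The factor s - 1, inherited from the pole of zeta, makes it vanish at s = 1; this is where the
  limit 0 comes from.\<close>

definition moebius_series :: "'p set \<Rightarrow> complex \<Rightarrow> complex" where
  "moebius_series A s = (s - 1) / (reg_zeta s * (\<Prod>p\<in>A. 1 - npow (Np p) s))"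

lemma npow_prime_neq_1:
  assumes "p \<in> P" "Re s > 0" shows "npow (Np p) s \<noteq> 1"
proof
  assume *: "npow (Np p) s = 1"
  have "norm (npow (Np p) s) = Np p powr (- Re s)" using prime_norm_gt_1[OF assms(1)] by (simp add: norm_npow)
  moreover have "Np p powr (- Re s) < Np p powr 0"
    using prime_norm_gt_1[OF assms(1)] assms by (intro powr_less_mono) auto
  ultimately show False using * prime_norm_gt_1[OF assms(1)] by simp
qed

lemma moebius_series_has_sum:
  assumes s: "Re s > 1" and A: "finite A" "A \<subseteq> P"
  shows "((\<lambda>g. mu_off A g * npow (nm g) s) has_sum moebius_series A s) (gelems P)"
proof -
  have "((\<lambda>g. gmoebius g * npow (nm g) s) has_sum inverse (Zeta (P - A) s)) (gelems (P - A))"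
    by (rule moebius_has_sum_inverse_Zeta[OF s]) auto
  also have "?this \<longleftrightarrow> ((\<lambda>g. mu_off A g * npow (nm g) s) has_sum inverse (Zeta (P - A) s)) (gelems P)"
    by (intro has_sum_cong_neutral) (auto simp: mu_off_def gelems_def)
  also have "inverse (Zeta (P - A) s) = moebius_series A s"
  proof -
    have "Zeta (A \<union> (P - A)) s * (\<Prod>p\<in>A. 1 - npow (Np p) s) = Zeta (P - A) s"
      using A by (intro Zeta_Un_finite s) auto
    moreover have "A \<union> (P - A) = P" using A by auto
    moreover have "s \<noteq> 1" using s by auto
    ultimately show ?thesis
      unfolding moebius_series_def reg_zeta_eq[OF s] by (simp add: mult.assoc inverse_eq_divide)
  qed
  finally show ?thesis .
qed

lemma mertens_transform_right:
  assumes X: "1 \<le> X" and z: "Re z > 0" and A: "finite A" "A \<subseteq> P"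
  shows "norm (moebius_series A (1 + z) - mertens_transform A X z) \<le> norm (1 + z) * (C * X powr (- Re z) / Re z)"
proof -
  have "((\<lambda>Y. mertens A Y * npow Y (1 + z)) \<longlongrightarrow> 0) at_top"
  proof (rule Lim_null_comparison)
    show "\<forall>\<^sub>F Y in at_top. norm (mertens A Y * npow Y (1 + z)) \<le> C * Y powr (- Re z)"
      using eventually_ge_at_top[of 1]
    proof eventually_elim
      case (elim Y)
      have "norm (mertens A Y * npow Y (1 + z)) \<le> (C * Y) * Y powr (- Re (1 + z))"
        unfolding norm_mult using elim C_pos by (intro mult_mono norm_mertens_le) (auto simp: norm_npow)
      also have "\<dots> = C * (Y powr 1 * Y powr (- Re (1 + z)))" using elim by simp
      also have "Y powr 1 * Y powr (- Re (1 + z)) = Y powr (- Re z)" unfolding powr_add[symmetric] by simp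
      finally show ?case .
    qed
    have "((\<lambda>Y. C * Y powr (- Re z)) \<longlongrightarrow> C * 0) at_top"
      using z by (intro tendsto_intros tendsto_neg_powr filterlim_ident) auto
    then show "((\<lambda>Y. C * Y powr (- Re z)) \<longlongrightarrow> 0) at_top" by simp
  qed
  then have "((\<lambda>Y. mertens_transform A Y z) \<longlongrightarrow> moebius_series A (1 + z) - 0) at_top"
    unfolding mertens_transform_def
    using z A by (intro tendsto_diff sum_elems_tendsto moebius_series_has_sum) auto
  then have lim: "((\<lambda>Y. mertens_transform A Y z - mertens_transform A X z) \<longlongrightarrow>
      moebius_series A (1 + z) - mertens_transform A X z) at_top"
    by (intro tendsto_intros) simp
  show ?thesis
  proof (rule Lim_norm_ubound[OF _ lim])
    show "\<forall>\<^sub>F Y in at_top. norm (mertens_transform A Y z - mertens_transform A X z) \<le> norm (1 + z) * (C * X powr (- Re z) / Re z)"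
      using eventually_ge_at_top[of X]
    proof eventually_elim
      case (elim Y)
      have "norm (mertens_transform A Y z - mertens_transform A X z)
          \<le> norm (1 + z) * C * (X powr (- Re z) - Y powr (- Re z)) / Re z"
        using z by (intro mertens_transform_diff X elim) auto
      also have "\<dots> \<le> norm (1 + z) * C * X powr (- Re z) / Re z"
        using z C_pos by (intro divide_right_mono mult_left_mono) auto
      finally show ?case by (simp add: field_simps)
    qed
  qed simp
qed

text \<open>Newman's hypotheses demand one constant C, while the bounds for the transform grow with
  \<open>norm (1 + z)\<close>. Therefore H and G are the transform and its limit divided by 1 +
  z.\<close>

lemma mertens_transform_tendsto:
  assumes A: "finite A" "A \<subseteq> P"
  shows "((\<lambda>X. mertens_transform A X 0) \<longlongrightarrow> 0) at_top"
proof -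
  define d where "d z = reg_zeta (1 + z) * (\<Prod>p\<in>A. 1 - npow (Np p) (1 + z))" for z
  define \<Omega> where "\<Omega> = {z \<in> {z. Re z > \<eta> - 1}. d z \<in> - {0}}"
  define G where "G z = moebius_series A (1 + z) / (1 + z)" for z
  \<comment> \<open>The transform vanishes at -1, so the quotient is entire once its value there is
    set to the derivative.\<close>
  define H where "H X z = (if z = - 1 then deriv (mertens_transform A X) (- 1)
     else (mertens_transform A X z - mertens_transform A X (- 1)) / (z - (- 1)))" for X z
  have d_hol: "d holomorphic_on {z. Re z > \<eta> - 1}"
  proof -
    have "(reg_zeta \<circ> (\<lambda>z. 1 + z)) holomorphic_on {z. Re z > \<eta> - 1}"
      by (rule holomorphic_on_compose_gen[OF _ reg_zeta_holomorphic]) (auto intro!: holomorphic_intros)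
    then show ?thesis unfolding d_def o_def by (intro holomorphic_intros)
  qed
  have d_nz: "d z \<noteq> 0" if "Re z \<ge> 0" for z
  proof -
    have "npow (Np p) (1 + z) \<noteq> 1" if "p \<in> A" for p
      using that A \<open>Re z \<ge> 0\<close> by (intro npow_prime_neq_1) auto
    then show ?thesis using reg_zeta_nonzero[of "1 + z"] that A by (auto simp: d_def)
  qed
  have mt0: "mertens_transform A X (- 1) = 0" for X
    by (simp add: mertens_transform_def mertens_def)
  have H_eq: "H X z = mertens_transform A X z / (1 + z)" if "z \<noteq> - 1" for X z
    using that by (simp add: H_def mt0 add.commute)
  have H_hol: "H X holomorphic_on UNIV" for X
    unfolding H_def[abs_def] mertens_transform_def[abs_def]
    by (rule pole_lemma_open) (auto intro!: holomorphic_intros)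
  have "((\<lambda>X. H X 0) \<longlongrightarrow> G 0) at_top"
  proof (rule newman_tauberian[where C = C and \<Omega> = \<Omega>])
    show "open \<Omega>"
      unfolding \<Omega>_def using continuous_open_preimage[OF holomorphic_on_imp_continuous_on[OF d_hol] open_halfspace_Re_gt, of "- {0}"]
      by (simp add: vimage_def Int_def open_Compl)
    show "{z. Re z \<ge> 0} \<subseteq> \<Omega>" using d_nz eta_less_1 by (auto simp: \<Omega>_def)
    have nz: "1 + z \<noteq> 0" if "z \<in> \<Omega>" for z
    proof -
      have "Re (1 + z) > 0" using that eta_pos by (simp add: \<Omega>_def)
      then show ?thesis by (metis less_irrefl zero_complex.sel(1))
    qed
    have "(\<lambda>z. z / d z / (1 + z)) holomorphic_on \<Omega>"
      using nz d_hol by (intro holomorphic_intros holomorphic_on_subset[OF d_hol]) (auto simp: \<Omega>_def)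
    then show "G holomorphic_on \<Omega>" by (simp add: G_def[abs_def] moebius_series_def d_def)
    show "H X holomorphic_on UNIV" for X by (rule H_hol)
    show "norm (G z - H X z) \<le> C * X powr (- Re z) / Re z" if "X \<ge> 1" "Re z > 0" for X z
    proof -
      have z: "1 + z \<noteq> 0" "z \<noteq> - 1" using that by (auto simp: complex_eq_iff)
      have "norm (G z - H X z) = norm (moebius_series A (1 + z) - mertens_transform A X z) / norm (1 + z)"
        unfolding G_def H_eq[OF z(2)] by (simp add: norm_divide flip: diff_divide_distrib)
      also have "\<dots> \<le> norm (1 + z) * (C * X powr (- Re z) / Re z) / norm (1 + z)"
        using that by (intro divide_right_mono mertens_transform_right A) auto
      also have "\<dots> = C * X powr (- Re z) / Re z" using z by simp
      finally show ?thesis .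
    qed
    show "norm (H X z) \<le> C * X powr (- Re z) / (- Re z)" if "X \<ge> 1" "Re z < 0" for X z
    proof -
      have away: "norm (H X z) \<le> C * X powr (- Re z) / (- Re z)" if "Re z < 0" "z \<noteq> -1" for z
      proof -
        have "norm (H X z) = norm (mertens_transform A X z) / norm (1 + z)"
          unfolding H_eq[OF that(2)] by (simp add: norm_divide)
        also have "\<dots> \<le> norm (1 + z) * (C * X powr (- Re z) / (- Re z)) / norm (1 + z)"
          using that \<open>X \<ge> 1\<close> by (intro divide_right_mono mertens_transform_left) auto
        also have "\<dots> = C * X powr (- Re z) / (- Re z)" using that by (simp add: add_eq_0_iff)
        finally show ?thesis .
      qed
      show ?thesis
      proof (cases "z = - 1")
        case True
        \<comment> \<open>At -1 one cannot divide by 1 + z; the bound is passed to the limit from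
          nearby points.\<close>
        have "isCont (H X) (- 1)"
          using holomorphic_on_imp_continuous_on[OF H_hol] continuous_on_eq_continuous_at by blast
        then have lim: "((\<lambda>z. norm (H X z)) \<longlongrightarrow> norm (H X (- 1))) (at (- 1))"
          by (intro tendsto_norm) (simp add: isCont_def)
        have lim2: "((\<lambda>z. C * X powr (- Re z) / (- Re z)) \<longlongrightarrow> C * X powr (- Re (- 1)) / (- Re (- 1))) (at (- 1))"
          using \<open>X \<ge> 1\<close> by (intro tendsto_intros) auto
        have "\<forall>\<^sub>F z in at (- 1). Re z < (0 :: real)"
          by (rule order_tendstoD(2)[OF tendsto_Re[OF tendsto_ident_at]]) simp
        moreover have "\<forall>\<^sub>F z in at (- 1). z \<noteq> (- 1 :: complex)" by (rule eventually_neq_at_within)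
        ultimately have ev: "\<forall>\<^sub>F z in at (- 1). norm (H X z) \<le> C * X powr (- Re z) / (- Re z)"
          by eventually_elim (rule away)
        show ?thesis unfolding True by (rule tendsto_le[OF _ lim2 lim ev]) simp
      qed (use away that in auto)
    qed
  qed (use C_pos in auto)
  then show ?thesis by (simp add: H_eq G_def moebius_series_def)
qed

lemma mertens_transform_0:
  assumes "X > 0"
  shows "mertens_transform A X 0 = (moebius_sum A X) - mertens A X / of_real X"
proof -
  have "(\<Sum>g\<in>elems X. mu_off A g * npow (nm g) 1) = (moebius_sum A X)"
    by (intro sum.cong refl) (auto simp: elems_def npow_1_right nm_pos)
  then show ?thesis using assms by (simp add: mertens_transform_def npow_1_right)
qed

text \<open>Convergence of the transform at 0 controls only the Moebius sum minus M(X) / X. Passing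
  from X to (1 + \<delta>) X adds roughly c \<delta> X elements, so M hardly changes while 1 / X
  does: the increment of the transform is M(X) (1 / X - 1 / Y), with Y = (1 + \<delta>) X, up to the
  share of the new elements.\<close>

lemma mertens_le_oscillation:
  assumes X: "X \<ge> 1" and \<delta>: "\<delta> > 0"
  shows "norm (mertens A X) / X \<le> (1 + \<delta>) / \<delta> * norm (mertens_transform A ((1 + \<delta>) * X) 0 - mertens_transform A X 0)
      + (c * \<delta> + 2 * K * (1 + \<delta>) powr \<eta> * X powr (\<eta> - 1))"
proof -
  define Y where "Y = (1 + \<delta>) * X"
  have "\<delta> * X > 0" using X \<delta> by (intro mult_pos_pos) auto
  moreover have "Y = X + \<delta> * X" by (simp add: Y_def distrib_right)
  ultimately have Y: "Y \<ge> X" "Y \<ge> 1" "Y > 0" "X > 0" using X by auto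
  define D where "D = elems Y - elems X"
  have split: "(\<Sum>g\<in>elems Y. f g) = (\<Sum>g\<in>D. f g) + (\<Sum>g\<in>elems X. f g)" for f :: "_ \<Rightarrow> complex"
    unfolding D_def by (rule sum.subset_diff) (use elems_mono[OF Y(1)] in auto)
  have eq: "mertens_transform A Y 0 - mertens_transform A X 0
      = (\<Sum>g\<in>D. mu_off A g * of_real (1 / nm g - 1 / Y)) + mertens A X * of_real (1 / X - 1 / Y)"
    unfolding mertens_transform_0[OF Y(3)] mertens_transform_0[OF Y(4)] mertens_def split[of "mu_off A"]
      split[of "\<lambda>g. mu_off A g / of_real (nm g)"]
    by (simp add: right_diff_distrib sum_subtractf sum_divide_distrib algebra_simps add_divide_distrib)
  have "norm (\<Sum>g\<in>D. mu_off A g * of_real (1 / nm g - 1 / Y)) \<le> (\<Sum>g\<in>D. 1 / X - 1 / Y)"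
  proof (rule sum_norm_le)
    fix g assume g: "g \<in> D"
    then have nm: "X < nm g" "nm g \<le> Y" by (auto simp: D_def elems_def)
    then have *: "0 \<le> 1 / nm g - 1 / Y" "1 / nm g - 1 / Y \<le> 1 / X - 1 / Y"
      using Y by (auto simp: frac_le)
    have "norm (mu_off A g * of_real (1 / nm g - 1 / Y)) = norm (mu_off A g) * (1 / nm g - 1 / Y)"
      using * by (simp only: norm_mult norm_of_real abs_of_nonneg)
    also have "\<dots> \<le> 1 * (1 / X - 1 / Y)" using * norm_mu_off_le by (intro mult_mono) auto
    finally show "norm (mu_off A g * of_real (1 / nm g - 1 / Y)) \<le> 1 / X - 1 / Y" by simp
  qed
  then have sumD: "norm (\<Sum>g\<in>D. mu_off A g * of_real (1 / nm g - 1 / Y)) \<le> card D * (1 / X - 1 / Y)" by simp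
  have pos: "1 / X - 1 / Y = \<delta> / ((1 + \<delta>) * X)"
  proof -
    have "1 + \<delta> \<noteq> 0" using \<delta> by simp
    then have "1 / X = (1 + \<delta>) / Y" by (simp add: Y_def)
    then have "1 / X - 1 / Y = \<delta> / Y" by (simp only: diff_divide_distrib[symmetric]) simp
    then show ?thesis by (simp only: Y_def)
  qed
  have pos': "\<delta> / ((1 + \<delta>) * X) > 0" using X \<delta> by simp
  have "norm (mertens A X) * (1 / X - 1 / Y) = norm (mertens A X * of_real (1 / X - 1 / Y))"
    using pos pos' by (simp only: norm_mult norm_of_real abs_of_pos)
  also have "\<dots> = norm ((mertens_transform A Y 0 - mertens_transform A X 0) - (\<Sum>g\<in>D. mu_off A g * of_real (1 / nm g - 1 / Y)))"
    unfolding eq by simp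
  also have "\<dots> \<le> norm (mertens_transform A Y 0 - mertens_transform A X 0) + card D * (1 / X - 1 / Y)"
    using sumD by (intro order.trans[OF norm_triangle_ineq4]) auto
  finally have "norm (mertens A X) * (\<delta> / ((1 + \<delta>) * X))
      \<le> norm (mertens_transform A Y 0 - mertens_transform A X 0) + card D * (\<delta> / ((1 + \<delta>) * X))"
    unfolding pos .
  then have "norm (mertens A X) * (\<delta> / ((1 + \<delta>) * X)) * ((1 + \<delta>) / \<delta>)
      \<le> (norm (mertens_transform A Y 0 - mertens_transform A X 0) + card D * (\<delta> / ((1 + \<delta>) * X))) * ((1 + \<delta>) / \<delta>)"
    using \<delta> by (intro mult_right_mono) auto
  moreover have "t * (\<delta> / ((1 + \<delta>) * X)) * ((1 + \<delta>) / \<delta>) = t / X" for t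
  proof -
    have "1 + \<delta> \<noteq> 0" "\<delta> \<noteq> 0" using \<delta> by auto
    then show ?thesis by simp
  qed
  ultimately have 1: "norm (mertens A X) / X
      \<le> (1 + \<delta>) / \<delta> * norm (mertens_transform A Y 0 - mertens_transform A X 0) + card D / X"
    by (simp only: distrib_right mult.commute[of "(1 + \<delta>) / \<delta>"])
  have "real (card D) = real (card (elems Y)) - real (card (elems X))"
    unfolding D_def using elems_mono[OF Y(1)] by (simp add: card_Diff_subset card_mono of_nat_diff)
  also have "\<dots> \<le> (c * Y + K * Y powr \<eta>) - (c * X - K * X powr \<eta>)"
    using card_elems_approx[OF Y(2)] card_elems_approx[OF X] by linarith
  also have "\<dots> \<le> (c * Y + K * Y powr \<eta>) - (c * X - K * Y powr \<eta>)"
    using K_nonneg X Y eta_pos by (intro diff_left_mono diff_left_mono mult_left_mono powr_mono2) auto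
  also have "\<dots> = X * (c * \<delta>) + 2 * K * Y powr \<eta>" by (simp add: Y_def algebra_simps)
  finally have "card D / X \<le> (X * (c * \<delta>) + 2 * K * Y powr \<eta>) / X"
    using X by (intro divide_right_mono) auto
  also have "\<dots> = c * \<delta> + 2 * K * (Y powr \<eta> / X)" using X by (simp add: field_simps)
  also have "Y powr \<eta> / X = (1 + \<delta>) powr \<eta> * X powr (\<eta> - 1)"
    using X \<delta> by (simp add: Y_def powr_mult powr_diff)
  finally show ?thesis using 1 by (simp add: Y_def mult.assoc)
qed

lemma mertens_little_o:
  assumes A: "finite A" "A \<subseteq> P"
  shows "((\<lambda>X. mertens A X / of_real X) \<longlongrightarrow> 0) at_top"
proof (rule tendstoI)
  fix e :: real assume e: "e > 0"
  \<comment> \<open>The one term that does not tend to 0 is c \<delta>, here e / 2.\<close>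
  define \<delta> where "\<delta> = e / (2 * c)"
  have \<delta>: "\<delta> > 0" using e c_pos by (simp add: \<delta>_def)
  let ?T = "\<lambda>X. mertens_transform A X 0"
  have T: "(?T \<longlongrightarrow> 0) at_top" by (rule mertens_transform_tendsto[OF A])
  have "filterlim (\<lambda>X. (1 + \<delta>) * X) at_top at_top"
    using \<delta> by (intro filterlim_tendsto_pos_mult_at_top[OF tendsto_const] filterlim_ident) auto
  then have T': "((\<lambda>X. ?T ((1 + \<delta>) * X)) \<longlongrightarrow> 0) at_top" by (rule filterlim_compose[OF T])
  have "((\<lambda>X. (1 + \<delta>) / \<delta> * norm (?T ((1 + \<delta>) * X) - ?T X) + (c * \<delta> + 2 * K * (1 + \<delta>) powr \<eta> * X powr (\<eta> - 1)))
      \<longlongrightarrow> (1 + \<delta>) / \<delta> * norm (0 - 0 :: complex) + (c * \<delta> + 2 * K * (1 + \<delta>) powr \<eta> * 0)) at_top"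
    by (intro tendsto_intros T T' powr_eta_tendsto_0)
  moreover have "(1 + \<delta>) / \<delta> * norm (0 - 0 :: complex) + (c * \<delta> + 2 * K * (1 + \<delta>) powr \<eta> * 0) < e"
    using e c_pos by (simp add: \<delta>_def)
  ultimately have "\<forall>\<^sub>F X in at_top. (1 + \<delta>) / \<delta> * norm (?T ((1 + \<delta>) * X) - ?T X)
      + (c * \<delta> + 2 * K * (1 + \<delta>) powr \<eta> * X powr (\<eta> - 1)) < e"
    by (rule order_tendstoD(2))
  then show "\<forall>\<^sub>F X in at_top. dist (mertens A X / of_real X) 0 < e"
    using eventually_ge_at_top[of 1]
  proof eventually_elim
    case (elim X)
    then show ?case using mertens_le_oscillation[OF elim(2) \<delta>, of A] by (simp add: norm_divide)
  qed
qed

lemma moebius_sum_tendsto_0: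
  assumes A: "finite A" "A \<subseteq> P"
  shows "((\<lambda>X. moebius_sum A X) \<longlongrightarrow> 0) at_top"
proof (rule Lim_transform_eventually)
  show "((\<lambda>X. mertens_transform A X 0 + mertens A X / of_real X) \<longlongrightarrow> 0) at_top"
    using tendsto_add[OF mertens_transform_tendsto[OF A] mertens_little_o[OF A]] by simp
  show "\<forall>\<^sub>F X in at_top. mertens_transform A X 0 + mertens A X / of_real X = (moebius_sum A X)"
    using eventually_gt_at_top[of 0] by eventually_elim (simp add: mertens_transform_0)
qed


section \<open>Sparse sets and sums over primes\<close>

definition count_avoiding :: "'p set \<Rightarrow> real \<Rightarrow> real" where
  "count_avoiding A x = real (card {g \<in> elems x. set_mset g \<inter> A = {}})"

lemma count_avoiding_insert:
  assumes "p \<in> P" "p \<notin> A"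
  shows "count_avoiding (insert p A) x = count_avoiding A x - count_avoiding A (x / Np p)"
proof -
  let ?S = "\<lambda>A x. {g \<in> elems x. set_mset g \<inter> A = {}}"
  have p: "Np p > 0" using prime_norm_gt_1[OF assms(1)] by simp
  have img: "?S A x = ?S (insert p A) x \<union> add_mset p ` ?S A (x / Np p)"
  proof (intro equalityI subsetI)
    fix g assume g: "g \<in> ?S A x"
    show "g \<in> ?S (insert p A) x \<union> add_mset p ` ?S A (x / Np p)"
    proof (cases "p \<in># g")
      case True
      then obtain h where h: "g = add_mset p h" by (meson mset_add)
      then have "h \<in> ?S A (x / Np p)"
        using g p by (auto simp: elems_def gelems_def gnorm_add_mset field_simps)
      then show ?thesis using h by blast
    qed (use g in auto)
  next
    fix g assume "g \<in> ?S (insert p A) x \<union> add_mset p ` ?S A (x / Np p)"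
    then show "g \<in> ?S A x"
      using p assms by (auto simp: elems_def gelems_def gnorm_add_mset field_simps)
  qed
  have "card (?S A x) = card (?S (insert p A) x) + card (add_mset p ` ?S A (x / Np p))"
    unfolding img by (rule card_Un_disjoint) auto
  also have "card (add_mset p ` ?S A (x / Np p)) = card (?S A (x / Np p))"
    by (rule card_image) (simp add: inj_on_def)
  finally show ?thesis by (simp add: count_avoiding_def)
qed

text \<open>Excluding one more prime p removes p times the elements of norm at most x / ||p|| that
  avoid A, so the density picks up the factor 1 - 1 / ||p||.\<close>

lemma count_avoiding_density:
  assumes "finite A" "A \<subseteq> P"
  shows "((\<lambda>x. count_avoiding A x / x) \<longlongrightarrow> c * (\<Prod>p\<in>A. 1 - 1 / Np p)) at_top"
  using assms
proof (induction A)
  case empty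
  have "((\<lambda>x. card (elems x) / x - c) \<longlongrightarrow> 0) at_top"
  proof (rule Lim_null_comparison)
    show "\<forall>\<^sub>F x in at_top. norm (card (elems x) / x - c) \<le> K * x powr (\<eta> - 1)"
      using eventually_ge_at_top[of 1]
    proof eventually_elim
      case (elim x)
      have "norm (card (elems x) / x - c) = \<bar>card (elems x) - c * x\<bar> / x"
        using elim by (simp add: field_simps abs_divide)
      also have "\<dots> \<le> K * x powr \<eta> / x" using elim card_elems_approx[OF elim] by (intro divide_right_mono) auto
      also have "\<dots> = K * x powr (\<eta> - 1)" using elim by (simp add: powr_diff)
      finally show ?case .
    qed
    show "((\<lambda>x. K * x powr (\<eta> - 1)) \<longlongrightarrow> 0) at_top"
      by (rule tendsto_mult_right_zero[OF powr_eta_tendsto_0])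
  qed
  then have "((\<lambda>x. card (elems x) / x) \<longlongrightarrow> c) at_top" by (simp add: LIM_zero_iff)
  then show ?case by (simp add: count_avoiding_def)
next
  case (insert p A)
  then have p: "p \<in> P" "Np p > 1" using prime_norm_gt_1 by auto
  let ?L = "c * (\<Prod>p\<in>A. 1 - 1 / Np p)"
  have IH: "((\<lambda>x. count_avoiding A x / x) \<longlongrightarrow> ?L) at_top" using insert by auto
  have "filterlim (\<lambda>x. (1 / Np p) * x) at_top at_top"
    using p by (intro filterlim_tendsto_pos_mult_at_top[OF tendsto_const] filterlim_ident) auto
  then have "filterlim (\<lambda>x. x / Np p) at_top at_top" by simp
  from filterlim_compose[OF IH this]
  have "((\<lambda>x. count_avoiding A x / x - count_avoiding A (x / Np p) / (x / Np p) * (1 / Np p)) \<longlongrightarrow> ?L - ?L * (1 / Np p)) at_top"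
    by (intro tendsto_diff IH tendsto_mult tendsto_const)
  moreover have "count_avoiding A x / x - count_avoiding A (x / Np p) / (x / Np p) * (1 / Np p)
      = count_avoiding (insert p A) x / x" for x
    using p insert.hyps count_avoiding_insert[of p A x] by (simp add: diff_divide_distrib)
  ultimately show ?case using insert.hyps by (simp add: algebra_simps)
qed

lemma prime_factor_bounds:
  assumes "p \<in> P" shows "0 < 1 - 1 / Np p" "1 - 1 / Np p \<le> 1"
  using prime_norm_gt_1[OF assms] by (auto simp: field_simps)

text \<open>The pole at 1 makes \<open>Zeta P s\<close> arbitrarily large for s slightly above 1,
  and finite Euler products follow it. Since ||p||^(-s) \<le> 1 / ||p||, the product at 1 is at most
  1 / \<open>norm (Zeta A s)\<close>.\<close>

lemma euler_product_small:
  assumes "e > 0"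
  shows "\<exists>A. finite A \<and> A \<subseteq> P \<and> (\<Prod>p\<in>A. 1 - 1 / Np p) < e"
proof -
  have "((\<lambda>x. reg_zeta (1 + of_real x)) \<longlongrightarrow> reg_zeta 1) (at_right 0)"
    using reg_zeta_continuous[of 1] eta_less_1
    by (intro isCont_tendsto_compose[where g = reg_zeta]) (auto intro!: tendsto_eq_intros)
  then have lim: "((\<lambda>x. norm (reg_zeta (1 + of_real x))) \<longlongrightarrow> c) (at_right 0)"
    using c_pos tendsto_norm by (fastforce simp: reg_zeta_1)
  have "\<forall>\<^sub>F x in at_right 0. norm (reg_zeta (1 + of_real x)) > c / 2"
    using c_pos by (intro order_tendstoD(1)[OF lim]) auto
  \<comment> \<open>For such x the lower bound (c / 2) / x for zeta exceeds 1 / e.\<close>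
  moreover have "\<forall>\<^sub>F x in at_right 0. x < c * e / 2"
    using c_pos assms by (intro order_tendstoD(2)[OF tendsto_ident_at]) auto
  moreover have "\<forall>\<^sub>F x in at_right 0. (0 :: real) < x" by (simp add: eventually_at_right_less)
  ultimately have "\<forall>\<^sub>F x in at_right 0. norm (reg_zeta (1 + of_real x)) > c / 2 \<and> x < c * e / 2 \<and> 0 < x"
    by eventually_elim auto
  then obtain x where x: "norm (reg_zeta (1 + of_real x)) > c / 2" "x < c * e / 2" "0 < x"
    using eventually_happens'[of "at_right (0 :: real)"] by auto
  define s where "s = 1 + complex_of_real x"
  have s: "Re s > 1" using x by (simp add: s_def)
  have "1 / e < (c / 2) / x" using x assms c_pos by (simp add: field_simps)
  also have "\<dots> < norm (reg_zeta s) / x" using x by (intro divide_strict_right_mono) (auto simp: s_def)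
  also have "\<dots> = norm (Zeta P s)" using reg_zeta_eq[OF s] x by (simp add: s_def norm_mult)
  finally have "1 / e < norm (Zeta P s)" .
  then have "\<forall>\<^sub>F A in finite_subsets_at_top P. norm (Zeta A s) > 1 / e"
    using tendsto_norm[OF Zeta_finite_tendsto[OF s]] by (rule order_tendstoD(1)[rotated])
  then obtain A where A: "finite A" "A \<subseteq> P" "norm (Zeta A s) > 1 / e"
    unfolding eventually_finite_subsets_at_top by blast
  have le: "(\<Prod>p\<in>A. 1 - 1 / Np p) \<le> (\<Prod>p\<in>A. norm (1 - npow (Np p) s))"
  proof (rule prod_mono)
    fix p assume "p \<in> A"
    then have p: "p \<in> P" "Np p > 1" using A prime_norm_gt_1 by auto
    have "norm (npow (Np p) s) = Np p powr (- Re s)" using p by (simp add: norm_npow)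
    also have "\<dots> \<le> Np p powr (- 1)" using p s by (intro powr_mono) auto
    also have "\<dots> = 1 / Np p" using p by (simp add: powr_minus field_simps)
    finally show "0 \<le> 1 - 1 / Np p \<and> 1 - 1 / Np p \<le> norm (1 - npow (Np p) s)"
      using prime_factor_bounds[OF p(1)] norm_triangle_ineq2[of 1 "npow (Np p) s"] by auto
  qed
  have "norm (Zeta A s) * (\<Prod>p\<in>A. norm (1 - npow (Np p) s)) = 1"
    using Zeta_finite[OF s A(1,2)] by (metis norm_mult norm_one prod_norm)
  then have "(\<Prod>p\<in>A. norm (1 - npow (Np p) s)) = 1 / norm (Zeta A s)"
    by (metis mult.commute nonzero_eq_divide_eq mult_zero_left zero_neq_one)
  also have "\<dots> < e"
    using A(3) assms by (metis divide_less_eq divide_pos_pos dual_order.strict_trans mult.commute zero_less_one)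
  finally show ?thesis using le A by force
qed

text \<open>Deleting the finitely many primes of B changes the Euler product only by a fixed factor,
  so it can still be made small. Keeping A disjoint from B serves
  \<open>sparse_finitely_generated\<close>.\<close>

lemma sparse_avoiding:
  assumes "finite B" "B \<subseteq> P" "e > 0"
  shows "\<exists>A. finite A \<and> A \<subseteq> P - B \<and> (\<forall>\<^sub>F x in at_top. count_avoiding A x \<le> e * x)"
proof -
  let ?\<Pi> = "\<lambda>A. \<Prod>p\<in>A. 1 - 1 / Np p"
  have pos: "?\<Pi> A > 0" if "A \<subseteq> P" for A using that prime_factor_bounds by (intro prod_pos) auto
  \<comment> \<open>The factor belonging to B compensates for the later passage from A to A - B;
    dividing by c turns the product into a density.\<close>
  obtain A where A: "finite A" "A \<subseteq> P" "?\<Pi> A < e / c * ?\<Pi> B"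
    using euler_product_small[of "e / c * ?\<Pi> B"] assms c_pos pos[of B] by auto
  have "?\<Pi> B * ?\<Pi> (A - B) \<le> ?\<Pi> (A \<inter> B) * ?\<Pi> (A - B)"
  proof (rule mult_right_mono)
    show "?\<Pi> B \<le> ?\<Pi> (A \<inter> B)"
    proof -
      have "?\<Pi> B = ?\<Pi> (B - A \<inter> B) * ?\<Pi> (A \<inter> B)"
        using assms by (intro prod.subset_diff) auto
      also have "\<dots> \<le> 1 * ?\<Pi> (A \<inter> B)"
      proof (rule mult_right_mono)
        show "?\<Pi> (B - A \<inter> B) \<le> 1"
          by (intro prod_le_1) (use assms prime_factor_bounds in \<open>fastforce\<close>)
      qed (rule less_imp_le, rule pos, use A in auto)
      finally show ?thesis by simp
    qed
  qed (rule less_imp_le, rule pos, use A in auto)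
  also have "\<dots> = ?\<Pi> A" using A(1) by (rule prod.Int_Diff[symmetric])
  finally have "?\<Pi> B * ?\<Pi> (A - B) < ?\<Pi> B * (e / c)" using A by (simp add: mult.commute)
  then have "?\<Pi> (A - B) < e / c" using pos[of B] assms by (simp only: mult_less_cancel_left_pos)
  then have "c * ?\<Pi> (A - B) < e" using c_pos by (simp add: field_simps)
  moreover have "((\<lambda>x. count_avoiding (A - B) x / x) \<longlongrightarrow> c * ?\<Pi> (A - B)) at_top"
    using A by (intro count_avoiding_density) auto
  ultimately have "\<forall>\<^sub>F x in at_top. count_avoiding (A - B) x / x < e" by (intro order_tendstoD(2))
  then have "\<forall>\<^sub>F x in at_top. count_avoiding (A - B) x \<le> e * x"
    using eventually_gt_at_top[of 0] by eventually_elim (simp add: field_simps)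
  then show ?thesis using A by (intro exI[of _ "A - B"]) auto
qed

lemma sparse_large_primes:
  assumes "e > 0"
  shows "\<exists>Y. \<forall>\<^sub>F x in at_top. real (card {g \<in> elems x. \<forall>p\<in>#g. Np p > Y}) \<le> e * x"
proof -
  obtain A where A: "finite A" "A \<subseteq> P" "\<forall>\<^sub>F x in at_top. count_avoiding A x \<le> e * x"
    using sparse_avoiding[of "{}" e] assms by auto
  define Y where "Y = Max (insert 0 (Np ` A))"
  have Y: "Np p \<le> Y" if "p \<in> A" for p using A that by (simp add: Y_def)
  have "real (card {g \<in> elems x. \<forall>p\<in>#g. Np p > Y}) \<le> count_avoiding A x" for x
    unfolding count_avoiding_def using Y by (intro of_nat_mono card_mono) (auto simp: not_less[symmetric])
  then show ?thesis using A(3) by (intro exI[of _ Y]) (auto elim!: eventually_mono intro: order.trans)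
qed

text \<open>Elements supported on B avoid every A disjoint from B, and such A can be chosen with
  arbitrarily small density of avoiding elements.\<close>

lemma sparse_finitely_generated:
  assumes "finite B" "B \<subseteq> P"
  shows "((\<lambda>x. real (card {g \<in> elems x. set_mset g \<subseteq> B}) / x) \<longlongrightarrow> 0) at_top"
proof (rule tendstoI)
  fix e :: real assume e: "e > 0"
  obtain A where A: "finite A" "A \<subseteq> P - B" "\<forall>\<^sub>F x in at_top. count_avoiding A x \<le> e / 2 * x"
    using sparse_avoiding[OF assms, of "e / 2"] e by auto
  have le: "real (card {g \<in> elems x. set_mset g \<subseteq> B}) \<le> count_avoiding A x" for x
    unfolding count_avoiding_def using A(2) by (intro of_nat_mono card_mono) auto
  show "\<forall>\<^sub>F x in at_top. dist (real (card {g \<in> elems x. set_mset g \<subseteq> B}) / x) 0 < e"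
    using A(3) eventually_gt_at_top[of 0]
  proof eventually_elim
    case (elim x)
    then have "real (card {g \<in> elems x. set_mset g \<subseteq> B}) \<le> e / 2 * x" using le[of x] by linarith
    also have "\<dots> < e * x" using elim e by simp
    finally show ?case using elim by (simp add: field_simps)
  qed
qed

lemma norm_Zeta_le:
  assumes "Re s > 1" "B \<subseteq> P"
  shows "norm (Zeta B s) \<le> C + C * Re s / (Re s - 1)"
proof (rule Lim_norm_ubound)
  show "(sum (\<lambda>g. npow (nm g) s) \<longlongrightarrow> Zeta B s) (finite_subsets_at_top (gelems B))"
    using Zeta_has_sum[OF assms] by (simp add: has_sum_def)
  have "norm (\<Sum>g\<in>F. npow (nm g) s) \<le> C + C * Re s / (Re s - 1)" if F: "finite F" "F \<subseteq> gelems B" for F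
  proof -
    have FP: "F \<subseteq> gelems P" using F gelems_mono[OF assms(2)] by auto
    then have "norm (\<Sum>g\<in>F. npow (nm g) s) \<le> (\<Sum>g\<in>F. nm g powr (- Re s))"
      using nm_pos by (intro sum_norm_le) (auto simp: norm_npow)
    also have "\<dots> \<le> C + C * Re s / (Re s - 1)" by (rule finite_sum_nm_powr_le[OF assms(1) F(1) FP])
    finally show ?thesis .
  qed
  then show "\<forall>\<^sub>F F in finite_subsets_at_top (gelems B). norm (\<Sum>g\<in>F. npow (nm g) s) \<le> C + C * Re s / (Re s - 1)"
    unfolding eventually_finite_subsets_at_top by (intro exI[of _ "{}"]) auto
qed simp

text \<open>With \<open>s = 1 + 1 / ln z\<close> each term \<open>1 / \<parallel>p\<parallel>\<close> with \<open>\<parallel>p\<parallel> \<le> z\<close> is at most \<open>e \<parallel>p\<parallel>\<^sup>-\<^sup>s\<close>,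
  and \<open>\<Sum> \<parallel>p\<parallel>\<^sup>-\<^sup>s \<le> ln \<zeta>(s)\<close> by the Euler product.\<close>

lemma sum_inverse_primes_le:
  assumes "z \<ge> exp 1"
  shows "(\<Sum>p | p \<in> P \<and> Np p \<le> z. 1 / Np p) \<le> exp 1 * (ln (3 * C) + ln (ln z))"
proof -
  define A where "A = {p \<in> P. Np p \<le> z}"
  define L where "L = ln z"
  define \<sigma> where "\<sigma> = 1 + 1 / L"
  have z: "z > 0" using assms by (rule less_le_trans[rotated]) simp
  have L: "L \<ge> 1" using assms z by (simp add: L_def ln_ge_iff)
  have \<sigma>: "\<sigma> > 1" using L by (simp add: \<sigma>_def)
  have A: "finite A" "A \<subseteq> P" using finite_primes_le by (auto simp: A_def)
  have prime_term: "1 / Np p \<le> exp 1 * Np p powr (- \<sigma>)" if "p \<in> A" for p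
  proof -
    have p: "Np p > 1" "Np p \<le> z" using that prime_norm_gt_1 by (auto simp: A_def)
    have "ln (Np p) / L \<le> 1" using p L z by (simp add: L_def)
    then have "Np p powr (1 / L) \<le> exp 1" using p by (simp add: powr_def)
    moreover have "1 / Np p = Np p powr (1 / L) * Np p powr (- \<sigma>)"
      using p unfolding powr_add[symmetric] by (simp add: \<sigma>_def powr_minus field_simps)
    ultimately show ?thesis using mult_right_mono[of "Np p powr (1 / L)" "exp 1" "Np p powr (- \<sigma>)"] by simp
  qed
  have lt1: "Np p powr (- \<sigma>) < 1" if "p \<in> A" for p
    using that A prime_norm_gt_1[of p] \<sigma> powr_less_mono[of "- \<sigma>" 0 "Np p"] by auto
  have "(\<Prod>p\<in>A. 1 - Np p powr (- \<sigma>)) \<le> (\<Prod>p\<in>A. exp (- (Np p powr (- \<sigma>))))"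
  proof (rule prod_mono)
    fix p assume "p \<in> A"
    then show "0 \<le> 1 - Np p powr (- \<sigma>) \<and> 1 - Np p powr (- \<sigma>) \<le> exp (- (Np p powr (- \<sigma>)))"
      using lt1[of p] exp_ge_add_one_self[of "- (Np p powr (- \<sigma>))"] by simp
  qed
  also have "\<dots> = exp (- (\<Sum>p\<in>A. Np p powr (- \<sigma>)))"
    using A by (simp add: exp_sum sum_negf[symmetric])
  finally have 1: "(\<Prod>p\<in>A. 1 - Np p powr (- \<sigma>)) \<le> exp (- (\<Sum>p\<in>A. Np p powr (- \<sigma>)))" .
  have "(\<Prod>p\<in>A. 1 - npow (Np p) (of_real \<sigma>)) = of_real (\<Prod>p\<in>A. 1 - Np p powr (- \<sigma>))"
    using A prime_norm_gt_1 by (simp add: npow_of_real subset_iff less_trans[OF zero_less_one] cong: prod.cong)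
  then have "Zeta A (of_real \<sigma>) * of_real (\<Prod>p\<in>A. 1 - Np p powr (- \<sigma>)) = 1"
    using Zeta_finite[of "of_real \<sigma>" A] \<sigma> A by simp
  then have "norm (Zeta A (of_real \<sigma>)) * \<bar>\<Prod>p\<in>A. 1 - Np p powr (- \<sigma>)\<bar> = 1"
    by (metis norm_mult norm_of_real norm_one)
  moreover have "(\<Prod>p\<in>A. 1 - Np p powr (- \<sigma>)) > 0" using lt1 by (intro prod_pos) auto
  ultimately have 2: "norm (Zeta A (of_real \<sigma>)) * (\<Prod>p\<in>A. 1 - Np p powr (- \<sigma>)) = 1" by simp
  have "norm (Zeta A (of_real \<sigma>)) \<le> C + C * \<sigma> / (\<sigma> - 1)"
    using norm_Zeta_le[of "of_real \<sigma>" A] \<sigma> A by simp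
  also have "\<dots> = C + C * (L + 1)" using L by (simp add: \<sigma>_def field_simps)
  \<comment> \<open>Origin of the 3: since L \<ge> 1, the constant 2 C is absorbed into 2 C
    L.\<close>
  also have "\<dots> \<le> 3 * C * L" using L C_pos mult_left_mono[of 1 L C] by (simp add: algebra_simps)
  finally have Z: "norm (Zeta A (of_real \<sigma>)) \<le> 3 * C * L" .
  have "norm (Zeta A (of_real \<sigma>)) * (\<Prod>p\<in>A. 1 - Np p powr (- \<sigma>)) \<le> 3 * C * L * exp (- (\<Sum>p\<in>A. Np p powr (- \<sigma>)))"
    by (rule mult_mono[OF Z 1]) (use C_pos L lt1 in \<open>auto intro!: prod_nonneg simp: less_imp_le\<close>)
  then have "1 \<le> 3 * C * L * exp (- (\<Sum>p\<in>A. Np p powr (- \<sigma>)))"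
    using 2 by simp
  then have "exp (\<Sum>p\<in>A. Np p powr (- \<sigma>)) \<le> 3 * C * L"
    by (simp add: exp_minus field_simps)
  then have "(\<Sum>p\<in>A. Np p powr (- \<sigma>)) \<le> ln (3 * C * L)"
    using C_pos L by (simp add: ln_ge_iff)
  also have "\<dots> = ln (3 * C) + ln L" using C_pos L by (simp add: ln_mult)
  finally have "exp 1 * (\<Sum>p\<in>A. Np p powr (- \<sigma>)) \<le> exp 1 * (ln (3 * C) + ln L)" by simp
  moreover have "(\<Sum>p\<in>A. 1 / Np p) \<le> exp 1 * (\<Sum>p\<in>A. Np p powr (- \<sigma>))"
    unfolding sum_distrib_left by (intro sum_mono prime_term)
  ultimately show ?thesis unfolding A_def L_def by linarith
qed

section \<open>Moebius sums against the counting error\<close>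

definition count_error :: "real \<Rightarrow> complex" where
  "count_error x = of_real (real (card (elems x)) - c * x)"

lemma norm_count_error_le: "x \<ge> 1 \<Longrightarrow> norm (count_error x) \<le> K * x powr \<eta>"
  using card_elems_approx[of x] by (simp only: count_error_def norm_of_real)

lemma sum_mu_off_divisors:
  "(\<Sum>h | h \<subseteq># g. mu_off A h) = (if set_mset g \<subseteq> A then 1 else 0)"
proof -
  have "(\<Sum>h | h \<subseteq># g. mu_off A h) = (\<Sum>h | h \<subseteq># g \<and> set_mset h \<subseteq> - A. gmoebius h)"
    using finite_submultisets[of g]
    by (intro sum.mono_neutral_cong_right) (auto simp: mu_off_def)
  also have "\<dots> = (if set_mset g \<inter> - A = {} then 1 else 0)" by (rule sum_gmoebius_divisors)
  also have "set_mset g \<inter> - A = {} \<longleftrightarrow> set_mset g \<subseteq> A" by auto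
  finally show ?thesis .
qed

text \<open>The elements supported on A are counted through the divisor sum of
  \<open>mu_off A\<close>; after the exchange each count of elements up to y / ||h|| splits into its
  main term and its error. The identity is used in both directions: to bound the Moebius sum, and to
  show that the left side is o(y).\<close>

lemma sum_mu_off_error:
  "(\<Sum>h\<in>elems y. mu_off A h * count_error (y / nm h))
    = of_nat (card {g \<in> elems y. set_mset g \<subseteq> A}) - of_real (c * y) * (moebius_sum A y)"
proof -
  have "of_nat (card {g \<in> elems y. set_mset g \<subseteq> A}) = (\<Sum>g\<in>elems y. if set_mset g \<subseteq> A then 1 else (0 :: complex))"
    by (simp add: sum.If_cases Int_def)
  also have "\<dots> = (\<Sum>g\<in>elems y. \<Sum>h | h \<subseteq># g. mu_off A h)" by (simp only: sum_mu_off_divisors)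
  also have "\<dots> = (\<Sum>h\<in>elems y. \<Sum>k\<in>elems (y / nm h). mu_off A h)" by (rule sum_divisors_swap)
  also have "\<dots> = (\<Sum>h\<in>elems y. mu_off A h * of_nat (card (elems (y / nm h))))" by (simp add: mult.commute)
  finally show ?thesis
    by (simp add: count_error_def right_diff_distrib sum_subtractf sum_distrib_left mult_ac)
qed

lemma sum_eta_le:
  assumes "y \<ge> 1"
  shows "(\<Sum>h\<in>elems y. (y / nm h) powr \<eta>) \<le> C / (1 - \<eta>) * y"
proof -
  have "(\<Sum>h\<in>elems y. (y / nm h) powr \<eta>) = y powr \<eta> * (\<Sum>h\<in>elems y. nm h powr (- \<eta>))"
    unfolding sum_distrib_left using assms
    by (intro sum.cong refl) (auto simp: elems_def powr_divide powr_minus_divide nm_pos less_imp_le)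
  also have "\<dots> \<le> y powr \<eta> * (C * y powr (1 - \<eta>) + C * \<eta> * (y powr (1 - \<eta>) - 1) / (1 - \<eta>))"
    using assms eta_pos eta_less_1 by (intro mult_left_mono sum_nm_powr_le) auto
  also have "\<dots> \<le> y powr \<eta> * (C * y powr (1 - \<eta>) + C * \<eta> * y powr (1 - \<eta>) / (1 - \<eta>))"
    using assms eta_pos eta_less_1 C_pos by (intro mult_left_mono add_left_mono divide_right_mono) auto
  also have "\<dots> = (y powr \<eta> * y powr (1 - \<eta>)) * (C / (1 - \<eta>))"
    using eta_less_1 by (simp add: field_simps)
  also have "y powr \<eta> * y powr (1 - \<eta>) = y" using assms by (simp flip: powr_add)
  finally show ?thesis by (simp add: mult.commute)
qed

definition mu_bound :: real where
  "mu_bound = (C + K * (C / (1 - \<eta>))) / c"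

lemma mu_bound_nonneg: "mu_bound \<ge> 0"
  using C_pos K_nonneg eta_less_1 c_pos by (simp add: mu_bound_def)

text \<open>In \<open>sum_mu_off_error\<close> the count is at most C y and the error sum at most K
  C y / (1 - \<eta>); dividing by c y gives a constant free of A and y. Being free of A, it can be
  applied with a different excluded set for each prime and then summed.\<close>

lemma norm_moebius_sum_le: "norm (moebius_sum A y) \<le> mu_bound"
proof (cases "y \<ge> 1")
  case False
  then show ?thesis using mu_bound_nonneg by (simp add: elems_empty)
next
  case True
  let ?s = "moebius_sum A y"
  have "of_real (c * y) * ?s = of_nat (card {g \<in> elems y. set_mset g \<subseteq> A}) - (\<Sum>h\<in>elems y. mu_off A h * count_error (y / nm h))"
    unfolding sum_mu_off_error by simp
  then have "norm (of_real (c * y) * ?s) \<le> norm (of_nat (card {g \<in> elems y. set_mset g \<subseteq> A}) :: complex)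
      + norm (\<Sum>h\<in>elems y. mu_off A h * count_error (y / nm h))"
    by (simp only: norm_triangle_ineq4)
  also have "norm (of_nat (card {g \<in> elems y. set_mset g \<subseteq> A}) :: complex) \<le> C * y"
  proof -
    have "card {g \<in> elems y. set_mset g \<subseteq> A} \<le> card (elems y)" by (intro card_mono) auto
    then show ?thesis using card_elems_le[OF True] by simp
  qed
  also have "norm (\<Sum>h\<in>elems y. mu_off A h * count_error (y / nm h)) \<le> (\<Sum>h\<in>elems y. K * (y / nm h) powr \<eta>)"
  proof (rule sum_norm_le)
    fix h assume "h \<in> elems y"
    then have h: "y / nm h \<ge> 1" using nm_pos by (auto simp: elems_def)
    have "norm (mu_off A h * count_error (y / nm h)) \<le> 1 * (K * (y / nm h) powr \<eta>)"
      unfolding norm_mult using norm_mu_off_le norm_count_error_le[OF h] by (intro mult_mono) auto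
    then show "norm (mu_off A h * count_error (y / nm h)) \<le> K * (y / nm h) powr \<eta>" by simp
  qed
  also have "\<dots> \<le> K * (C / (1 - \<eta>) * y)"
    unfolding sum_distrib_left[symmetric] by (intro mult_left_mono sum_eta_le True K_nonneg)
  finally have "(c * y) * norm ?s \<le> (C + K * (C / (1 - \<eta>))) * y"
    using c_pos True by (simp add: norm_mult algebra_simps)
  then have "(c * norm ?s) * y \<le> (C + K * (C / (1 - \<eta>))) * y" by (simp only: mult_ac)
  then have "c * norm ?s \<le> C + K * (C / (1 - \<eta>))" using True by (subst (asm) mult_le_cancel_right_pos) auto
  then show ?thesis using c_pos by (simp add: mu_bound_def pos_le_divide_eq mult.commute)
qed

end

section \<open>Duality between smallest and largest prime factors\<close>

text \<open>Distinguishability with \<open>Pmin Np h = p\<close> in one quantifier. The multiplicity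
  of p is left free.\<close>

definition strict_min :: "('p \<Rightarrow> real) \<Rightarrow> 'p \<Rightarrow> 'p multiset \<Rightarrow> bool" where
  "strict_min Np p h \<longleftrightarrow> p \<in># h \<and> (\<forall>q\<in>#h. q \<noteq> p \<longrightarrow> Np p < Np q)"

lemma strict_min_Nminus:
  assumes "strict_min Np p h" shows "Nminus Np h = Np p"
  unfolding Nminus_def using assms by (intro Min_eqI) (auto simp: strict_min_def less_imp_le)

lemma strict_min_unique: "strict_min Np p h \<Longrightarrow> strict_min Np q h \<Longrightarrow> p = q"
  by (metis strict_min_def less_asym)

lemma strict_min_minimal_primes:
  "strict_min Np p h \<Longrightarrow> {q \<in> set_mset h. Np q = Nminus Np h} = {p}"
  by (auto simp: strict_min_Nminus) (auto simp: strict_min_def)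

lemma strict_min_Pmin: "strict_min Np p h \<Longrightarrow> Pmin Np h = p"
  unfolding Pmin_def using strict_min_minimal_primes[of Np p h] by (intro the_equality) auto

lemma distinguishable_iff: "distinguishable Np h \<longleftrightarrow> (\<exists>p. strict_min Np p h)"
proof
  assume d: "distinguishable Np h"
  then obtain p where p: "{q \<in> set_mset h. Np q = Nminus Np h} = {p}"
    by (auto simp: distinguishable_def card_1_singleton_iff)
  have "Np p < Np q" if "q \<in># h" "q \<noteq> p" for q
  proof -
    have "Np p = Nminus Np h" "Np q \<noteq> Nminus Np h" using p that by auto
    moreover have "Nminus Np h \<le> Np q" unfolding Nminus_def using that by (intro Min_le) auto
    ultimately show ?thesis by simp
  qed
  then show "\<exists>p. strict_min Np p h" using p by (auto simp: strict_min_def)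
next
  assume "\<exists>p. strict_min Np p h"
  then show "distinguishable Np h"
    using strict_min_minimal_primes[of Np _ h] by (elim exE) (simp add: distinguishable_def, auto simp: strict_min_def)
qed

lemma Dset_iff:
  assumes "h \<noteq> {#}"
  shows "h \<in> Dset P Np S \<longleftrightarrow> h \<in> gelems P \<and> (\<exists>p\<in>S. strict_min Np p h)"
proof -
  have "(\<exists>p. strict_min Np p h) \<and> Pmin Np h \<in> S \<longleftrightarrow> (\<exists>p\<in>S. strict_min Np p h)"
    using strict_min_Pmin[of Np _ h] by blast
  then show ?thesis using assms by (simp add: Dset_def distinguishable_iff)
qed

lemma gmoebius_add_mset:
  "gmoebius (add_mset p h) = (if p \<in># h then 0 else - gmoebius h)"
proof (cases "p \<in># h")
  case True
  then have "count (add_mset p h) p > 1" by simp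
  then have "\<not> (\<forall>q. count (add_mset p h) q \<le> 1)" using not_le by blast
  then show ?thesis using True by (simp add: gmoebius_def)
next
  case False
  then have "(\<forall>q. count (add_mset p h) q \<le> 1) \<longleftrightarrow> (\<forall>q. count h q \<le> 1)"
    by (metis count_add_mset le_refl One_nat_def not_in_iff zero_le)
  then show ?thesis using False by (simp add: gmoebius_def)
qed

context arithmetical_semigroup
begin

text \<open>Includes p and all other primes of the same norm: avoiding the others makes p strictly
  smallest in p k, and avoiding p itself matches the vanishing of the Moebius function when p
  divides k.\<close>

definition primes_le :: "'p \<Rightarrow> 'p set" where
  "primes_le p = {q \<in> P. Np q \<le> Np p}"

lemma primes_le_finite [simp]: "finite (primes_le p)" "primes_le p \<subseteq> P"
  using finite_primes_le by (auto simp: primes_le_def)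

definition dual_weight :: "(real \<Rightarrow> complex) \<Rightarrow> 'p set \<Rightarrow> 'p multiset \<Rightarrow> complex" where
  "dual_weight f S h = (if h \<in> Dset P Np S \<and> h \<noteq> {#} then gmoebius h * f (Nminus Np h) else 0)"

abbreviation dual_sum :: "(real \<Rightarrow> complex) \<Rightarrow> 'p set \<Rightarrow> real \<Rightarrow> complex" where
  "dual_sum f S x \<equiv> \<Sum>h\<in>elems x. dual_weight f S h / of_real (nm h)"

abbreviation error_sum :: "(real \<Rightarrow> complex) \<Rightarrow> 'p set \<Rightarrow> real \<Rightarrow> complex" where
  "error_sum f S x \<equiv> \<Sum>h\<in>elems x. dual_weight f S h * count_error (x / nm h)"

text \<open>At most one p can be strictly smallest in h, and only its term survives, with \<mu>(p k)
  = - \<mu>(k). As a sum over p the weight is additive in S and can be sorted by the smallest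
  prime.\<close>

lemma dual_weight_eq:
  assumes "h \<in> gelems P" "S \<subseteq> P"
  shows "dual_weight f S h = - (\<Sum>p\<in>S \<inter> set_mset h. f (Np p) * mu_off (primes_le p) (h - {#p#}))"
proof -
  have off: "mu_off (primes_le p) (h - {#p#}) = (if strict_min Np p h then - gmoebius h else 0)"
    if p: "p \<in># h" for p
  proof -
    obtain k where k: "h = add_mset p k" using p by (meson mset_add)
    have pP: "p \<in> P" "set_mset k \<subseteq> P" using assms(1) k by (auto simp: gelems_def)
    show ?thesis
    proof (cases "p \<in># k")
      case True
      then show ?thesis using pP by (auto simp: k mu_off_def primes_le_def gmoebius_add_mset)
    next
      case False
      then have "set_mset k \<inter> primes_le p = {} \<longleftrightarrow> strict_min Np p h"
        using pP by (auto simp: k strict_min_def primes_le_def not_le[symmetric])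
      then show ?thesis using False by (simp add: k mu_off_def gmoebius_add_mset)
    qed
  qed
  show ?thesis
  proof (cases "\<exists>p\<in>S. strict_min Np p h")
    case True
    then obtain p where p: "p \<in> S" "strict_min Np p h" by blast
    then have ph: "p \<in># h" by (simp add: strict_min_def)
    then have h: "h \<noteq> {#}" by auto
    have "(\<Sum>q\<in>S \<inter> set_mset h. f (Np q) * mu_off (primes_le q) (h - {#q#}))
        = (\<Sum>q\<in>{p}. f (Np q) * mu_off (primes_le q) (h - {#q#}))"
    proof (rule sum.mono_neutral_right)
      show "\<forall>q\<in>S \<inter> set_mset h - {p}. f (Np q) * mu_off (primes_le q) (h - {#q#}) = 0"
      proof
        fix q assume q: "q \<in> S \<inter> set_mset h - {p}"
        then have "\<not> strict_min Np q h" using strict_min_unique[OF p(2), of q] by blast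
        then show "f (Np q) * mu_off (primes_le q) (h - {#q#}) = 0" using off[of q] q by simp
      qed
    qed (use p ph in auto)
    also have "\<dots> = - (f (Np p) * gmoebius h)" using off[OF ph] p by simp
    finally show ?thesis
      using True h assms(1) strict_min_Nminus[OF p(2)] by (simp add: dual_weight_def Dset_iff mult.commute)
  next
    case False
    then have "(\<Sum>q\<in>S \<inter> set_mset h. f (Np q) * mu_off (primes_le q) (h - {#q#})) = 0"
      using off by (intro sum.neutral) auto
    moreover have "dual_weight f S h = 0" using False by (auto simp: dual_weight_def Dset_iff)
    ultimately show ?thesis by simp
  qed
qed

lemma dual_weight_Un:
  assumes "h \<in> gelems P" "S \<subseteq> P" "T \<subseteq> P" "S \<inter> T = {}"
  shows "dual_weight f (S \<union> T) h = dual_weight f S h + dual_weight f T h"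
proof -
  have "(S \<union> T) \<inter> set_mset h = (S \<inter> set_mset h) \<union> (T \<inter> set_mset h)" by auto
  then show ?thesis
    using assms by (simp add: dual_weight_eq sum.union_disjoint disjoint_iff)
qed

text \<open>Divisors are sorted as h = p k. For fixed p the sum over k detects whether all primes of
  g - p have norm at most that of p, that is, whether p attains \<open>Nplus Np g\<close>; the
  number of such p in S is \<open>QS Np S g\<close>.\<close>

lemma sum_dual_weight_divisors:
  assumes g: "g \<in> gelems P" and S: "S \<subseteq> P"
  shows "(\<Sum>h | h \<subseteq># g. dual_weight f S h) = - (of_nat (QS Np S g) * f (Nplus Np g))"
proof -
  let ?F = "\<lambda>p k. f (Np p) * mu_off (primes_le p) k"
  have "(\<Sum>h | h \<subseteq># g. dual_weight f S h) = (\<Sum>h | h \<subseteq># g. - (\<Sum>p\<in>S \<inter> set_mset h. ?F p (h - {#p#})))"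
    by (intro sum.cong refl dual_weight_eq S) (use g gelems_subset_mset in blast)
  also have "\<dots> = - (\<Sum>h | h \<subseteq># g. \<Sum>p\<in>S \<inter> set_mset h. ?F p (h - {#p#}))" by (simp add: sum_negf)
  also have "(\<Sum>h | h \<subseteq># g. \<Sum>p\<in>S \<inter> set_mset h. ?F p (h - {#p#}))
      = (\<Sum>(h, p)\<in>Sigma {h. h \<subseteq># g} (\<lambda>h. S \<inter> set_mset h). ?F p (h - {#p#}))"
    by (rule sum.Sigma) (auto simp: finite_submultisets)
  also have "\<dots> = (\<Sum>(p, k)\<in>Sigma (S \<inter> set_mset g) (\<lambda>p. {k. k \<subseteq># g - {#p#}}). ?F p k)"
  proof (rule sum.reindex_bij_witness[of _ "\<lambda>(p, k). (add_mset p k, p)" "\<lambda>(h, p). (p, h - {#p#})"], goal_cases)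
    case (2 a)
    then obtain h p where a: "a = (h, p)" "h \<subseteq># g" "p \<in> S" "p \<in># h" by auto
    have "h - {#p#} \<subseteq># g - {#p#}" using a(2) by (simp add: subseteq_mset_def diff_le_mono)
    then show ?case using a mset_subset_eqD[OF a(2,4)] by simp
  next
    case (4 b)
    then show ?case
      by (auto simp: insert_subset_eq_iff)
  qed auto
  also have "\<dots> = (\<Sum>p\<in>S \<inter> set_mset g. \<Sum>k | k \<subseteq># g - {#p#}. ?F p k)"
    by (rule sum.Sigma[symmetric]) (auto simp: finite_submultisets)
  also have "\<dots> = (\<Sum>p\<in>S \<inter> set_mset g. if Np p = Nplus Np g then f (Nplus Np g) else 0)"
  proof (rule sum.cong)
    fix p assume p: "p \<in> S \<inter> set_mset g"
    then have gne: "g \<noteq> {#}" and pg: "p \<in># g" by auto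
    have "set_mset (g - {#p#}) \<subseteq> primes_le p \<longleftrightarrow> (\<forall>q\<in>#g. Np q \<le> Np p)"
    proof -
      obtain k where "g = add_mset p k" using pg by (meson mset_add)
      then show ?thesis using g by (auto simp: primes_le_def gelems_def)
    qed
    also have "\<dots> \<longleftrightarrow> Np p = Nplus Np g"
    proof
      assume "\<forall>q\<in>#g. Np q \<le> Np p"
      then have "Max (Np ` set_mset g) = Np p" using pg by (intro Max_eqI) auto
      then show "Np p = Nplus Np g" using gne by (simp add: Nplus_def)
    qed (use gne in \<open>simp add: Nplus_def\<close>)
    finally show "(\<Sum>k | k \<subseteq># g - {#p#}. ?F p k) = (if Np p = Nplus Np g then f (Nplus Np g) else 0)"
      by (simp add: sum_mu_off_divisors flip: sum_distrib_left)
  qed simp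
  also have "\<dots> = (\<Sum>p\<in>{p \<in> S. p \<in># g \<and> Np p = Nplus Np g}. f (Nplus Np g))"
    by (intro sum.mono_neutral_cong_right) auto
  also have "\<dots> = of_nat (QS Np S g) * f (Nplus Np g)" by (simp add: QS_def)
  finally show ?thesis .
qed

text \<open>The factor \<open>\<phi>\<close> stays free because the same rearrangement is needed for
  the counting error and for the reciprocal of the norm.\<close>

lemma sum_dual_weight_elems:
  assumes S: "S \<subseteq> P"
  shows "(\<Sum>h\<in>elems x. dual_weight f S h * \<phi> h)
    = - (\<Sum>p\<in>{p \<in> S. Np p \<le> x}. f (Np p) * (\<Sum>k\<in>elems (x / Np p). mu_off (primes_le p) k * \<phi> (add_mset p k)))"
proof -
  let ?F = "\<lambda>p k. f (Np p) * (mu_off (primes_le p) k * \<phi> (add_mset p k))"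
  have fin: "finite {p \<in> S. Np p \<le> x}" using finite_primes_le by (rule rev_finite_subset) (use S in auto)
  have "(\<Sum>h\<in>elems x. dual_weight f S h * \<phi> h) = (\<Sum>h\<in>elems x. - (\<Sum>p\<in>S \<inter> set_mset h. ?F p (h - {#p#})))"
  proof (rule sum.cong)
    fix h assume "h \<in> elems x"
    then have h: "h \<in> gelems P" by (simp add: elems_def)
    show "dual_weight f S h * \<phi> h = - (\<Sum>p\<in>S \<inter> set_mset h. ?F p (h - {#p#}))"
      unfolding dual_weight_eq[OF h S] by (simp add: sum_distrib_right mult.assoc)
  qed simp
  also have "\<dots> = - (\<Sum>h\<in>elems x. \<Sum>p\<in>S \<inter> set_mset h. ?F p (h - {#p#}))" by (simp add: sum_negf)
  also have "(\<Sum>h\<in>elems x. \<Sum>p\<in>S \<inter> set_mset h. ?F p (h - {#p#}))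
      = (\<Sum>(h, p)\<in>Sigma (elems x) (\<lambda>h. S \<inter> set_mset h). ?F p (h - {#p#}))"
    by (rule sum.Sigma) auto
  also have "\<dots> = (\<Sum>(p, k)\<in>Sigma {p \<in> S. Np p \<le> x} (\<lambda>p. elems (x / Np p)). ?F p k)"
  proof (rule sum.reindex_bij_witness[of _ "\<lambda>(p, k). (add_mset p k, p)" "\<lambda>(h, p). (p, h - {#p#})"], goal_cases)
    case (2 a)
    then obtain h p where a: "a = (h, p)" "h \<in> elems x" "p \<in> S" "p \<in># h" by auto
    obtain k where k: "h = add_mset p k" using a(4) by (meson mset_add)
    have p: "Np p > 1" using a S prime_norm_gt_1 by auto
    have "Np p \<le> x" using prime_le_nm[of h p] a by (auto simp: elems_def)
    then show ?case using a k p by (auto simp: elems_def gelems_def gnorm_add_mset field_simps)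
  next
    case (4 b)
    then obtain p k where b: "b = (p, k)" "p \<in> S" "k \<in> elems (x / Np p)" by auto
    have p: "Np p > 1" "p \<in> P" using b S prime_norm_gt_1 by auto
    then show ?case using b by (auto simp: elems_def gelems_def gnorm_add_mset field_simps)
  qed auto
  also have "\<dots> = (\<Sum>p\<in>{p \<in> S. Np p \<le> x}. \<Sum>k\<in>elems (x / Np p). ?F p k)"
    by (rule sum.Sigma[symmetric]) (use fin in auto)
  finally show ?thesis by (simp add: sum_distrib_left)
qed

lemma sum_dual_weight_elems_finite:
  assumes S: "S \<subseteq> P" "finite S"
  shows "(\<Sum>h\<in>elems x. dual_weight f S h * \<phi> h)
    = - (\<Sum>p\<in>S. f (Np p) * (\<Sum>k\<in>elems (x / Np p). mu_off (primes_le p) k * \<phi> (add_mset p k)))"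
proof -
  \<comment> \<open>Primes of norm above x have an empty inner sum, so the range of p need not
    depend on x and limits can be taken term by term.\<close>
  have "elems (x / Np p) = {}" if "p \<in> S" "\<not> Np p \<le> x" for p
    using that S prime_norm_gt_1[of p] by (intro elems_empty) (auto simp: field_simps)
  then have "(\<Sum>p\<in>{p \<in> S. Np p \<le> x}. f (Np p) * (\<Sum>k\<in>elems (x / Np p). mu_off (primes_le p) k * \<phi> (add_mset p k)))
    = (\<Sum>p\<in>S. f (Np p) * (\<Sum>k\<in>elems (x / Np p). mu_off (primes_le p) k * \<phi> (add_mset p k)))"
    using S by (intro sum.mono_neutral_left) auto
  then show ?thesis using sum_dual_weight_elems[OF S(1)] by simp
qed

lemma norm_dual_weight_le:
  assumes f: "\<And>x. x \<ge> 1 \<Longrightarrow> norm (f x) \<le> B" and h: "h \<in> gelems P" and S: "S \<subseteq> P"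
  shows "norm (dual_weight f S h) \<le> B"
proof -
  have B: "B \<ge> 0" using order.trans[OF norm_ge_zero f[of 1]] by simp
  show ?thesis
  proof (cases "h \<in> Dset P Np S \<and> h \<noteq> {#}")
    case True
    then obtain p where p: "p \<in> S" "strict_min Np p h" by (auto simp: Dset_iff)
    then have "Np p \<ge> 1" using S prime_norm_gt_1[of p] by auto
    then have "norm (gmoebius h) * norm (f (Np p)) \<le> 1 * B"
      using B by (intro mult_mono norm_gmoebius_le f) auto
    then show ?thesis using True strict_min_Nminus[OF p(2)] by (simp add: dual_weight_def norm_mult)
  qed (use B in \<open>auto simp: dual_weight_def\<close>)
qed

section \<open>Smallness of the error sum\<close>

lemma filterlim_divide_prime:
  assumes "p \<in> P" shows "filterlim (\<lambda>x. x / Np p) at_top at_top"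
proof -
  have "filterlim (\<lambda>x. (1 / Np p) * x) at_top at_top"
    using prime_norm_gt_1[OF assms] by (intro filterlim_tendsto_pos_mult_at_top[OF tendsto_const] filterlim_ident) auto
  then show ?thesis by simp
qed

text \<open>Here cancellation beats the trivial O(y): by \<open>sum_mu_off_error\<close> the sum is
  a count of elements supported on finitely many primes, which is o(y), minus c y times a Moebius
  sum tending to 0.\<close>

lemma sum_mu_off_error_little_o:
  assumes A: "finite A" "A \<subseteq> P"
  shows "((\<lambda>y. (\<Sum>h\<in>elems y. mu_off A h * count_error (y / nm h)) / of_real y) \<longlongrightarrow> 0) at_top"
proof (rule Lim_transform_eventually)
  have "((\<lambda>y. of_real (card {g \<in> elems y. set_mset g \<subseteq> A} / y) - of_real c * (moebius_sum A y))
      \<longlongrightarrow> of_real 0 - of_real c * 0) at_top"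
    by (intro tendsto_intros sparse_finitely_generated moebius_sum_tendsto_0 A)
  then show "((\<lambda>y. of_real (card {g \<in> elems y. set_mset g \<subseteq> A} / y) - of_real c * (moebius_sum A y))
      \<longlongrightarrow> 0) at_top" by simp
  show "\<forall>\<^sub>F y in at_top. of_real (card {g \<in> elems y. set_mset g \<subseteq> A} / y) - of_real c * (moebius_sum A y)
      = (\<Sum>h\<in>elems y. mu_off A h * count_error (y / nm h)) / of_real y"
    using eventually_gt_at_top[of 0]
    by eventually_elim (simp add: sum_mu_off_error diff_divide_distrib)
qed

lemma sum_dual_weight_error_finite:
  assumes S: "S \<subseteq> P" "finite S"
  shows "((\<lambda>x. (error_sum f S x) / of_real x) \<longlongrightarrow> 0) at_top"
proof -
  let ?g = "\<lambda>p y. \<Sum>k\<in>elems y. mu_off (primes_le p) k * count_error (y / nm k)"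
  have "((\<lambda>x. - (\<Sum>p\<in>S. f (Np p) / of_real (Np p) * (?g p (x / Np p) / of_real (x / Np p)))) \<longlongrightarrow>
      - (\<Sum>p\<in>S. f (Np p) / of_real (Np p) * 0)) at_top"
  proof (intro tendsto_intros)
    fix p assume "p \<in> S"
    then have "p \<in> P" using S by auto
    then show "((\<lambda>x. ?g p (x / Np p) / of_real (x / Np p)) \<longlongrightarrow> 0) at_top"
      by (intro filterlim_compose[OF sum_mu_off_error_little_o filterlim_divide_prime]) auto
  qed
  moreover have "- (\<Sum>p\<in>S. f (Np p) / of_real (Np p) * (?g p (x / Np p) / of_real (x / Np p)))
      = (error_sum f S x) / of_real x" for x
  proof -
    have eq: "f (Np p) / of_real (Np p) * (?g p (x / Np p) / of_real (x / Np p))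
        = f (Np p) * (\<Sum>k\<in>elems (x / Np p). mu_off (primes_le p) k * count_error (x / nm (add_mset p k))) / of_real x" if "p \<in> S" for p
      using that S prime_norm_gt_1[of p] by (auto simp: gnorm_add_mset)
    have "(\<Sum>p\<in>S. f (Np p) / of_real (Np p) * (?g p (x / Np p) / of_real (x / Np p)))
        = (\<Sum>p\<in>S. f (Np p) * (\<Sum>k\<in>elems (x / Np p). mu_off (primes_le p) k * count_error (x / nm (add_mset p k)))) / of_real x"
      by (subst sum_divide_distrib) (intro sum.cong refl eq)
    then show ?thesis
      unfolding sum_dual_weight_elems_finite[OF S, of f "\<lambda>h. count_error (x / nm h)" x]
      by (simp only: minus_divide_left)
  qed
  ultimately show ?thesis by simp
qed

text \<open>A set of elements of upper density at most \<open>e\<close> contributes at most \<open>2 e x / (1 - \<eta>)\<close> to the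
  sum of \<open>(x / \<parallel>h\<parallel>)\<^sup>\<eta>\<close>: the finitely many \<open>h\<close> at which the density bound fails contribute \<open>O(x\<^sup>\<eta>)\<close>.\<close>

lemma sum_eta_sparse:
  assumes e: "e > 0" and sparse: "\<forall>\<^sub>F x in at_top. real (card {h \<in> elems x. Q h}) \<le> e * x"
  shows "\<forall>\<^sub>F x in at_top. (\<Sum>h\<in>{h \<in> elems x. Q h}. (x / nm h) powr \<eta>) \<le> 2 * e / (1 - \<eta>) * x"
proof -
  obtain u0 where u0: "\<And>u. u \<ge> u0 \<Longrightarrow> real (card {h \<in> elems u. Q h}) \<le> e * u"
    using sparse by (auto simp: eventually_at_top_linorder)
  \<comment> \<open>Discarding norms up to \<open>u0\<close> makes the density bound hold for every
    u from 1 on, as partial summation requires, and not only for large u.\<close>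
  define w where "w h = (if Q h \<and> nm h > u0 then 1 else 0 :: complex)" for h
  have W: "norm (\<Sum>h\<in>elems u. w h) \<le> e * u" if "u \<in> {1..X}" for u X
  proof (cases "u \<ge> u0")
    case True
    have "norm (\<Sum>h\<in>elems u. w h) \<le> (\<Sum>h\<in>elems u. if Q h then 1 else 0)"
      by (rule sum_norm_le) (simp add: w_def)
    also have "\<dots> = real (card {h \<in> elems u. Q h})" by (simp add: sum.If_cases Int_def)
    also have "\<dots> \<le> e * u" by (rule u0[OF True])
    finally show ?thesis .
  next
    case False
    then have "(\<Sum>h\<in>elems u. w h) = 0" by (intro sum.neutral) (auto simp: w_def elems_def)
    then show ?thesis using e that by simp
  qed
  have "((\<lambda>x. card (elems u0) * x powr (\<eta> - 1)) \<longlongrightarrow> 0) at_top"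
    by (rule tendsto_mult_right_zero[OF powr_eta_tendsto_0])
  then have "\<forall>\<^sub>F x in at_top. card (elems u0) * x powr (\<eta> - 1) < e / (1 - \<eta>)"
    using e eta_less_1 by (intro order_tendstoD(2)) auto
  then show ?thesis using eventually_ge_at_top[of 1]
  proof eventually_elim
    case (elim x)
    have split: "(x / nm h) powr \<eta> = x powr \<eta> * nm h powr (- \<eta>)" if "h \<in> elems x" for h
      using that elim by (auto simp: elems_def powr_divide powr_minus_divide nm_pos less_imp_le)
    let ?A = "{h \<in> elems x. Q h \<and> nm h > u0}" and ?B = "{h \<in> elems x. Q h \<and> nm h \<le> u0}"
    have "(\<Sum>h\<in>{h \<in> elems x. Q h}. (x / nm h) powr \<eta>) = (\<Sum>h\<in>?A. (x / nm h) powr \<eta>) + (\<Sum>h\<in>?B. (x / nm h) powr \<eta>)"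
    proof -
      have "{h \<in> elems x. Q h} = ?A \<union> ?B" by auto
      then show ?thesis by (simp only:) (rule sum.union_disjoint, auto)
    qed
    also have "(\<Sum>h\<in>?B. (x / nm h) powr \<eta>) \<le> (\<Sum>h\<in>?B. x powr \<eta>)"
    proof (rule sum_mono)
      fix h assume "h \<in> ?B"
      then have "h \<in> elems x" "nm h \<ge> 1" using nm_ge_1 by (auto simp: elems_def)
      then show "(x / nm h) powr \<eta> \<le> x powr \<eta>"
        using elim eta_pos by (intro powr_mono2) (auto simp: field_simps)
    qed
    also have "\<dots> = card ?B * x powr \<eta>" by simp
    also have "\<dots> \<le> card (elems u0) * x powr \<eta>"
      by (intro mult_right_mono of_nat_mono card_mono) (auto simp: elems_def finite_elems[unfolded elems_def])
    also have "\<dots> = card (elems u0) * x powr (\<eta> - 1) * x" using elim by (simp add: powr_diff)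
    also have "\<dots> \<le> e / (1 - \<eta>) * x" using elim by (intro mult_right_mono) auto
    also have "(\<Sum>h\<in>?A. (x / nm h) powr \<eta>) \<le> e / (1 - \<eta>) * x"
    proof -
      have factor: "(\<Sum>h\<in>?A. (x / nm h) powr \<eta>) = x powr \<eta> * (\<Sum>h\<in>?A. nm h powr (- \<eta>))"
        unfolding sum_distrib_left by (intro sum.cong refl split) auto
      have "(\<Sum>h\<in>?A. nm h powr (- \<eta>)) = norm (\<Sum>h\<in>elems x. w h * of_real (nm h powr (- \<eta>)))"
      proof -
        have "(\<Sum>h\<in>elems x. w h * of_real (nm h powr (- \<eta>))) = (\<Sum>h\<in>?A. of_real (nm h powr (- \<eta>)))"
          by (intro sum.mono_neutral_cong_right) (auto simp: w_def)
        also have "\<dots> = of_real (\<Sum>h\<in>?A. nm h powr (- \<eta>))" by simp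
        finally show ?thesis by (simp only: norm_of_real abs_of_nonneg sum_nonneg powr_ge_zero)
      qed
      also have "\<dots> \<le> e * x powr (1 - \<eta>) + e * \<eta> * (x powr (1 - \<eta>) - 1) / (1 - \<eta>)"
        using elim eta_less_1 eta_pos W by (intro sum_powr_le) auto
      also have "\<dots> \<le> e * x powr (1 - \<eta>) + e * \<eta> * x powr (1 - \<eta>) / (1 - \<eta>)"
        using e eta_pos eta_less_1 by (intro add_left_mono divide_right_mono mult_left_mono) auto
      also have "\<dots> = e / (1 - \<eta>) * x powr (1 - \<eta>)" using eta_less_1 by (simp add: field_simps)
      finally have "(\<Sum>h\<in>?A. (x / nm h) powr \<eta>) \<le> x powr \<eta> * (e / (1 - \<eta>) * x powr (1 - \<eta>))"
        unfolding factor by (rule mult_left_mono) simp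
      also have "\<dots> = e / (1 - \<eta>) * (x powr \<eta> * x powr (1 - \<eta>))" by simp
      also have "x powr \<eta> * x powr (1 - \<eta>) = x" using elim by (simp flip: powr_add)
      finally show ?thesis .
    qed
    finally show ?case by (simp add: algebra_simps)
  qed
qed

text \<open>The threshold Y depends only on the accuracy r. Hence the primes of S up to Y form a
  finite set fixed before x grows, and no uniformity in p of the o(x) terms is required.\<close>

lemma sum_dual_weight_error:
  assumes f: "\<And>x. x \<ge> 1 \<Longrightarrow> norm (f x) \<le> B" and S: "S \<subseteq> P"
  shows "((\<lambda>x. (error_sum f S x) / of_real x) \<longlongrightarrow> 0) at_top"
proof (rule tendstoI)
  fix r :: real assume r: "r > 0"
  have B: "B \<ge> 0" using order.trans[OF norm_ge_zero f[of 1]] by simp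
  \<comment> \<open>Chosen so that (B K + 1) 2 e / (1 - \<eta>) = r / 2; the added 1 keeps the
    denominator positive when B K = 0.\<close>
  define e where "e = r * (1 - \<eta>) / (4 * (B * K + 1))"
  have BK: "B * K + 1 > 0" using B K_nonneg by (simp add: add_nonneg_pos)
  have e: "e > 0" using r eta_less_1 BK by (simp add: e_def)
  obtain Y where Y: "\<forall>\<^sub>F x in at_top. real (card {g \<in> elems x. \<forall>p\<in>#g. Np p > Y}) \<le> e * x"
    using sparse_large_primes[OF e] by blast
  define S1 where "S1 = {p \<in> S. Np p \<le> Y}"
  define S2 where "S2 = {p \<in> S. Np p > Y}"
  have S1: "S1 \<subseteq> P" "finite S1" and S2: "S2 \<subseteq> P"
    using S finite_primes_le[of Y] by (auto simp: S1_def S2_def elim: rev_finite_subset)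
  have split: "dual_weight f S h = dual_weight f S1 h + dual_weight f S2 h" if "h \<in> gelems P" for h
  proof -
    have "S = S1 \<union> S2" by (auto simp: S1_def S2_def)
    moreover have "S1 \<inter> S2 = {}" by (auto simp: S1_def S2_def)
    ultimately show ?thesis using dual_weight_Un[OF that S1(1) S2] by simp
  qed
  let ?R = "\<lambda>S x. error_sum f S x"
  have "\<forall>\<^sub>F x in at_top. dist (?R S1 x / of_real x) 0 < r / 2"
    using tendstoD[OF sum_dual_weight_error_finite[OF S1], of "r / 2"] r by auto
  moreover have "\<forall>\<^sub>F x in at_top. (\<Sum>h\<in>{h \<in> elems x. \<forall>p\<in>#h. Np p > Y}. (x / nm h) powr \<eta>) \<le> 2 * e / (1 - \<eta>) * x"
    by (rule sum_eta_sparse[OF e Y])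
  ultimately show "\<forall>\<^sub>F x in at_top. dist (?R S x / of_real x) 0 < r"
    using eventually_ge_at_top[of 1]
  proof eventually_elim
    case (elim x)
    have zero: "dual_weight f S2 h = 0" if "\<not> (\<forall>p\<in>#h. Np p > Y)" for h
    proof -
      have "\<not> (\<exists>p\<in>S2. strict_min Np p h)"
        using that by (force simp: strict_min_def S2_def)
      then show ?thesis by (auto simp: dual_weight_def Dset_iff)
    qed
    have "norm (?R S2 x) \<le> (\<Sum>h\<in>elems x. if \<forall>p\<in>#h. Np p > Y then B * K * (x / nm h) powr \<eta> else 0)"
    proof (rule sum_norm_le)
      fix h assume h: "h \<in> elems x"
      then have hP: "h \<in> gelems P" and xh: "x / nm h \<ge> 1" using nm_pos by (auto simp: elems_def)
      have "norm (dual_weight f S2 h * count_error (x / nm h)) \<le> B * (K * (x / nm h) powr \<eta>)"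
        unfolding norm_mult using norm_dual_weight_le[OF f hP S2] norm_count_error_le[OF xh] B
        by (intro mult_mono) auto
      then show "norm (dual_weight f S2 h * count_error (x / nm h))
          \<le> (if \<forall>p\<in>#h. Np p > Y then B * K * (x / nm h) powr \<eta> else 0)"
        using zero[of h] by auto
    qed
    also have "\<dots> = B * K * (\<Sum>h\<in>{h \<in> elems x. \<forall>p\<in>#h. Np p > Y}. (x / nm h) powr \<eta>)"
      by (simp add: sum.If_cases Int_def sum_distrib_left)
    also have "\<dots> \<le> B * K * (2 * e / (1 - \<eta>) * x)"
      using elim B K_nonneg by (intro mult_left_mono) auto
    also have "\<dots> \<le> (B * K + 1) * (2 * e / (1 - \<eta>) * x)"
      using elim e eta_less_1 by (intro mult_right_mono) auto
    also have "\<dots> = r / 2 * x"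
    proof -
      have cancel: "D * (2 * (r * t / (4 * D)) / t * x) = r / 2 * x" if "D \<noteq> 0" "t \<noteq> 0" for D t
        using that by simp
      show ?thesis unfolding e_def by (rule cancel) (use BK eta_less_1 in auto)
    qed
    finally have "norm (?R S2 x / of_real x) \<le> r / 2" using elim by (simp add: norm_divide field_simps)
    moreover have "?R S x = ?R S1 x + ?R S2 x"
      by (simp add: split elems_def distrib_right sum.distrib)
    then have "norm (?R S x / of_real x) \<le> norm (?R S1 x / of_real x) + norm (?R S2 x / of_real x)"
      using norm_triangle_ineq[of "?R S1 x / of_real x" "?R S2 x / of_real x"] by (simp add: add_divide_distrib)
    ultimately show ?case using elim by simp
  qed
qed

lemma sum_QS_eq:
  assumes "S \<subseteq> P"
  shows "(\<Sum>g\<in>elems x. of_nat (QS Np S g) * f (Nplus Np g))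
    = - of_real (c * x) * (dual_sum f S x)
      - (error_sum f S x)"
proof -
  have "(\<Sum>g\<in>elems x. of_nat (QS Np S g) * f (Nplus Np g)) = - (\<Sum>g\<in>elems x. \<Sum>h | h \<subseteq># g. dual_weight f S h)"
    using assms by (simp add: sum_dual_weight_divisors elems_def sum_negf)
  also have "(\<Sum>g\<in>elems x. \<Sum>h | h \<subseteq># g. dual_weight f S h) = (\<Sum>h\<in>elems x. \<Sum>k\<in>elems (x / nm h). dual_weight f S h)"
    by (rule sum_divisors_swap)
  also have "\<dots> = (\<Sum>h\<in>elems x. of_real (c * x) * (dual_weight f S h / of_real (nm h)) + dual_weight f S h * count_error (x / nm h))"
    by (intro sum.cong refl) (simp add: count_error_def algebra_simps)
  finally show ?thesis by (simp only: sum.distrib sum_distrib_left[symmetric]) simp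
qed

lemma largest_prime_iff_smallest_prime:
  assumes f: "\<And>x. x \<ge> 1 \<Longrightarrow> norm (f x) \<le> B" and S: "S \<subseteq> P"
  shows "(\<lambda>x. (\<Sum>g\<in>elems x. of_nat (QS Np S g) * f (Nplus Np g)) - complex_of_real (c * d * x)) \<in> o[at_top](\<lambda>x. complex_of_real x)
    \<longleftrightarrow> ((\<lambda>x. dual_sum f S x) \<longlongrightarrow> - complex_of_real d) at_top"
proof -
  let ?L = "\<lambda>x. \<Sum>g\<in>elems x. of_nat (QS Np S g) * f (Nplus Np g)"
  let ?T = "\<lambda>x. dual_sum f S x"
  let ?R = "\<lambda>x. (error_sum f S x) / of_real x"
  have R: "(?R \<longlongrightarrow> 0) at_top" by (rule sum_dual_weight_error[OF f S])
  have ev: "\<forall>\<^sub>F x in at_top. (?L x - of_real (c * d * x)) / of_real x = - of_real c * (?T x + of_real d) - ?R x"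
    using eventually_gt_at_top[of 0]
  proof eventually_elim
    case (elim x)
    then show ?case unfolding sum_QS_eq[OF S] by (simp add: field_simps)
  qed
  have "(\<lambda>x. ?L x - of_real (c * d * x)) \<in> o[at_top](\<lambda>x. complex_of_real x)
      \<longleftrightarrow> ((\<lambda>x. (?L x - of_real (c * d * x)) / of_real x) \<longlongrightarrow> 0) at_top"
  proof
    assume "(\<lambda>x. ?L x - of_real (c * d * x)) \<in> o[at_top](\<lambda>x. complex_of_real x)"
    then show "((\<lambda>x. (?L x - of_real (c * d * x)) / of_real x) \<longlongrightarrow> 0) at_top"
      by (rule smalloD_tendsto)
  next
    assume "((\<lambda>x. (?L x - of_real (c * d * x)) / of_real x) \<longlongrightarrow> 0) at_top"
    then show "(\<lambda>x. ?L x - of_real (c * d * x)) \<in> o[at_top](\<lambda>x. complex_of_real x)"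
      by (rule smalloI_tendsto) (use eventually_gt_at_top[of 0] in \<open>auto elim!: eventually_mono\<close>)
  qed
  also have "\<dots> \<longleftrightarrow> ((\<lambda>x. - of_real c * (?T x + of_real d) - ?R x) \<longlongrightarrow> 0) at_top"
    using ev by (rule tendsto_cong)
  also have "\<dots> \<longleftrightarrow> (?T \<longlongrightarrow> - of_real d) at_top"
  proof
    assume "((\<lambda>x. - of_real c * (?T x + of_real d) - ?R x) \<longlongrightarrow> 0) at_top"
    then have "((\<lambda>x. ((- of_real c * (?T x + of_real d) - ?R x) + ?R x) / (- of_real c) - of_real d)
        \<longlongrightarrow> (0 + 0) / (- of_real c) - of_real d) at_top"
      using c_pos by (intro tendsto_intros R) auto
    then show "(?T \<longlongrightarrow> - of_real d) at_top" using c_pos by simp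
  next
    assume "(?T \<longlongrightarrow> - of_real d) at_top"
    then have "((\<lambda>x. - of_real c * (?T x + of_real d) - ?R x) \<longlongrightarrow> - of_real c * (- of_real d + of_real d) - 0) at_top"
      by (intro tendsto_intros R)
    then show "((\<lambda>x. - of_real c * (?T x + of_real d) - ?R x) \<longlongrightarrow> 0) at_top" by simp
  qed
  finally show ?thesis .
qed

end

section \<open>Convolutions\<close>

lemma gconv_commute: "gconv u v g = (\<Sum>k | k \<subseteq># g. v k * u (g - k))"
proof -
  have dd: "g - (g - h) = h" if "h \<subseteq># g" for h
    using that by (simp add: multiset_eq_iff subseteq_mset_def)
  show ?thesis unfolding gconv_def
    by (rule sum.reindex_bij_witness[of _ "\<lambda>k. g - k" "\<lambda>h. g - h"]) (auto simp: dd mult.commute)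
qed

context arithmetical_semigroup
begin

text \<open>Kept apart from the Moebius factor, since (iii) multiplies it by the convolution
  instead.\<close>

definition dset_weight :: "(real \<Rightarrow> complex) \<Rightarrow> 'p set \<Rightarrow> 'p multiset \<Rightarrow> complex" where
  "dset_weight f S g = (if g \<in> Dset P Np S \<and> g \<noteq> {#} then f (Nminus Np g) else 0)"

lemma dual_weight_dset_weight: "dual_weight f S h = gmoebius h * dset_weight f S h"
  by (simp add: dual_weight_def dset_weight_def)

lemma Dset_subset_gelems: "Dset P Np S \<subseteq> gelems P"
  by (auto simp: Dset_def)

lemma sum_Dset_eq:
  "(\<Sum>g\<in>{g \<in> Dset P Np S. g \<noteq> {#} \<and> nm g \<le> x}. u g * f (Nminus Np g) / of_real (nm g))
    = (\<Sum>g\<in>elems x. u g * dset_weight f S g / of_real (nm g))"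
  using Dset_subset_gelems by (intro sum.mono_neutral_cong_left) (auto simp: elems_def dset_weight_def finite_elems[unfolded elems_def])

text \<open>If h has a prime of norm below that of q, the smallest prime of h + k is decided by h
  alone. Otherwise only q can be strictly smallest; this forbids other primes of norm at most
  \<open>Np q\<close> in h but permits q itself, hence the excluded set
  \<open>primes_le q - {q}\<close>. In each case the other term vanishes.\<close>

lemma dset_weight_shift:
  assumes q: "q \<in> S" "strict_min Np q k" and k: "k \<in> gelems P" and h: "h \<in> gelems P"
  shows "gmoebius h * dset_weight f S (h + k)
    = dual_weight f {p \<in> S. Np p < Np q} h + f (Np q) * mu_off (primes_le q - {q}) h"
proof -
  have qk: "q \<in># k" "\<And>r. r \<in># k \<Longrightarrow> r \<noteq> q \<Longrightarrow> Np q < Np r" using q by (auto simp: strict_min_def)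
  have ne: "h + k \<noteq> {#}" using qk by auto
  have hkP: "h + k \<in> gelems P" using h k by simp
  have qP: "q \<in> P" using qk(1) k by (auto simp: gelems_def)
  show ?thesis
  proof (cases "\<exists>p\<in>#h. Np p < Np q")
    case True
    then obtain p0 where p0: "p0 \<in># h" "Np p0 < Np q" by blast
    then have hne: "h \<noteq> {#}" by auto
    have iff: "strict_min Np p (h + k) \<longleftrightarrow> strict_min Np p h" for p
    proof
      assume sm: "strict_min Np p (h + k)"
      have "p \<in># h"
      proof (rule ccontr)
        assume "p \<notin># h"
        then have "p \<in># k" "p \<noteq> p0" using sm p0 by (auto simp: strict_min_def)
        moreover have "Np p < Np p0" using sm p0 \<open>p \<noteq> p0\<close> by (auto simp: strict_min_def)
        ultimately show False using qk(2)[of p] p0 by fastforce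
      qed
      then show "strict_min Np p h" using sm by (auto simp: strict_min_def)
    next
      assume sm: "strict_min Np p h"
      have "Np p \<le> Np p0" using sm p0 by (cases "p0 = p") (auto simp: strict_min_def)
      then have "Np p < Np r" if "r \<in># k" for r using p0 qk(2)[OF that] by (cases "r = q") auto
      then show "strict_min Np p (h + k)" using sm by (auto simp: strict_min_def)
    qed
    have small: "Np p < Np q" if "strict_min Np p h" for p
      using that p0 by (cases "p0 = p") (auto simp: strict_min_def)
    have "mu_off (primes_le q - {q}) h = 0"
      using p0 h by (auto simp: mu_off_def primes_le_def gelems_def)
    moreover have "gmoebius h * dset_weight f S (h + k) = dual_weight f {p \<in> S. Np p < Np q} h"
    proof (cases "\<exists>p\<in>S. strict_min Np p h")
      case True
      then obtain p where p: "p \<in> S" "strict_min Np p h" by blast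
      then have "h + k \<in> Dset P Np S" "h \<in> Dset P Np {p \<in> S. Np p < Np q}"
        using ne hne hkP h iff small by (auto simp: Dset_iff)
      moreover have "Nminus Np (h + k) = Nminus Np h" using p iff[of p] by (simp add: strict_min_Nminus)
      ultimately show ?thesis using ne hne by (simp add: dset_weight_def dual_weight_def)
    next
      case False
      then show ?thesis using ne hne iff by (auto simp: dset_weight_def dual_weight_def Dset_iff)
    qed
    ultimately show ?thesis by simp
  next
    case False
    then have ge: "Np q \<le> Np p" if "p \<in># h" for p using that not_le by blast
    have dw: "dual_weight f {p \<in> S. Np p < Np q} h = 0"
      using False by (auto simp: dual_weight_def Dset_iff strict_min_def)
    have only: "r = q" if "strict_min Np r (h + k)" for r
    proof (rule ccontr)
      assume "r \<noteq> q"
      then have "Np r < Np q" using that qk(1) by (auto simp: strict_min_def)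
      moreover have "r \<in># h \<or> r \<in># k" using that by (auto simp: strict_min_def)
      ultimately show False using ge[of r] qk(2)[of r] \<open>r \<noteq> q\<close> by force
    qed
    have iff: "strict_min Np q (h + k) \<longleftrightarrow> set_mset h \<inter> (primes_le q - {q}) = {}"
    proof
      assume sm: "strict_min Np q (h + k)"
      have "Np q < Np r" if "r \<in># h" "r \<noteq> q" for r using sm that by (simp add: strict_min_def)
      then show "set_mset h \<inter> (primes_le q - {q}) = {}" by (force simp: primes_le_def)
    next
      assume *: "set_mset h \<inter> (primes_le q - {q}) = {}"
      have "Np q < Np r" if "r \<in># h" "r \<noteq> q" for r
      proof -
        have "r \<notin> primes_le q" using * that by auto
        moreover have "r \<in> P" using h that by (auto simp: gelems_def)
        ultimately show ?thesis by (simp add: primes_le_def)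
      qed
      then show "strict_min Np q (h + k)" using qk by (auto simp: strict_min_def)
    qed
    have "gmoebius h * dset_weight f S (h + k) = f (Np q) * mu_off (primes_le q - {q}) h"
    proof (cases "strict_min Np q (h + k)")
      case True
      then have "h + k \<in> Dset P Np S" using q ne hkP by (auto simp: Dset_iff)
      then show ?thesis using ne True iff by (simp add: dset_weight_def mu_off_def strict_min_Nminus)
    next
      case False
      then have "\<not> (\<exists>p\<in>S. strict_min Np p (h + k))" using only by blast
      then have "h + k \<notin> Dset P Np S" using ne by (simp add: Dset_iff)
      moreover have "mu_off (primes_le q - {q}) h = 0" using False iff by (simp add: mu_off_def)
      ultimately show ?thesis by (simp add: dset_weight_def)
    qed
    then show ?thesis using dw by simp
  qed
qed

lemma sum_dual_weight_finite:
  assumes S: "S \<subseteq> P" "finite S"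
  shows "(dual_sum f S y)
    = - (\<Sum>p\<in>S. f (Np p) / of_real (Np p) * (moebius_sum (primes_le p) (y / Np p)))"
proof -
  have "(dual_sum f S y) = (\<Sum>h\<in>elems y. dual_weight f S h * (1 / of_real (nm h)))"
    by simp
  also have "\<dots> = - (\<Sum>p\<in>S. f (Np p) * (\<Sum>k\<in>elems (y / Np p). mu_off (primes_le p) k * (1 / of_real (nm (add_mset p k)))))"
    by (rule sum_dual_weight_elems_finite[OF S])
  also have "\<dots> = - (\<Sum>p\<in>S. f (Np p) / of_real (Np p) * (moebius_sum (primes_le p) (y / Np p)))"
    by (intro arg_cong[of _ _ uminus] sum.cong refl) (simp add: gnorm_add_mset sum_distrib_left)
  finally show ?thesis .
qed

text \<open>The inner sum that is left for fixed k once g = h + k is substituted in (iii); k = e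
  gives the sum in (ii).\<close>

definition shifted_sum :: "(real \<Rightarrow> complex) \<Rightarrow> 'p set \<Rightarrow> 'p multiset \<Rightarrow> real \<Rightarrow> complex" where
  "shifted_sum f S k y = (\<Sum>h\<in>elems y. gmoebius h * dset_weight f S (h + k) / of_real (nm h))"

lemma shifted_sum_eq:
  assumes q: "q \<in> S" "strict_min Np q k" and k: "k \<in> gelems P" and S: "S \<subseteq> P"
  shows "shifted_sum f S k y
    = - (\<Sum>p\<in>{p \<in> S. Np p < Np q}. f (Np p) / of_real (Np p) * (moebius_sum (primes_le p) (y / Np p)))
      + f (Np q) * (moebius_sum (primes_le q - {q}) y)"
proof -
  let ?S = "{p \<in> S. Np p < Np q}"
  have S': "?S \<subseteq> P" "finite ?S"
    using S finite_primes_le[of "Np q"] by (auto elim!: rev_finite_subset)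
  have "shifted_sum f S k y = (\<Sum>h\<in>elems y. dual_weight f ?S h / of_real (nm h) + f (Np q) * (mu_off (primes_le q - {q}) h / of_real (nm h)))"
    unfolding shifted_sum_def
    by (intro sum.cong refl) (auto simp: dset_weight_shift[OF q k] elems_def add_divide_distrib)
  also have "\<dots> = (dual_sum f ?S y) + f (Np q) * (moebius_sum (primes_le q - {q}) y)"
    by (simp only: sum.distrib sum_distrib_left)
  finally show ?thesis unfolding sum_dual_weight_finite[OF S'] .
qed

lemma shifted_sum_tendsto_0:
  assumes q: "q \<in> S" "strict_min Np q k" and k: "k \<in> gelems P" and S: "S \<subseteq> P"
  shows "(shifted_sum f S k \<longlongrightarrow> 0) at_top"
proof -
  let ?s = "\<lambda>A y. moebius_sum A y"
  have fin: "finite (primes_le q - {q})" "primes_le q - {q} \<subseteq> P"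
    by (auto simp: primes_le_def finite_primes_le)
  have "((\<lambda>y. - (\<Sum>p\<in>{p \<in> S. Np p < Np q}. f (Np p) / of_real (Np p) * ?s (primes_le p) (y / Np p))
      + f (Np q) * ?s (primes_le q - {q}) y) \<longlongrightarrow>
      - (\<Sum>p\<in>{p \<in> S. Np p < Np q}. f (Np p) / of_real (Np p) * 0) + f (Np q) * 0) at_top"
  proof (intro tendsto_add tendsto_minus tendsto_sum tendsto_mult tendsto_const)
    show "(?s (primes_le q - {q}) \<longlongrightarrow> 0) at_top" by (rule moebius_sum_tendsto_0[OF fin])
    fix p assume "p \<in> {p \<in> S. Np p < Np q}"
    then have "p \<in> P" using S by auto
    then show "((\<lambda>y. ?s (primes_le p) (y / Np p)) \<longlongrightarrow> 0) at_top"
      by (intro filterlim_compose[OF moebius_sum_tendsto_0 filterlim_divide_prime]) auto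
  qed
  then show ?thesis unfolding shifted_sum_eq[OF assms] by simp
qed

text \<open>Every prime p below q costs the uniform \<open>mu_bound\<close> times B / ||p||, and q
  itself one more term. As q divides k, enlarging the range to ||p|| \<le> ||k|| expresses the bound
  through the norm of k.\<close>

lemma norm_shifted_sum_le:
  assumes q: "q \<in> S" "strict_min Np q k" and k: "k \<in> gelems P" and S: "S \<subseteq> P"
    and f: "\<And>x. x \<ge> 1 \<Longrightarrow> norm (f x) \<le> B"
  shows "norm (shifted_sum f S k y) \<le> B * mu_bound * ((\<Sum>p | p \<in> P \<and> Np p \<le> nm k. 1 / Np p) + 1)"
proof -
  let ?s = "\<lambda>A y. moebius_sum A y"
  let ?S = "{p \<in> S. Np p < Np q}"
  have B: "B \<ge> 0" using order.trans[OF norm_ge_zero f[of 1]] by simp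
  have qk: "q \<in># k" using q by (simp add: strict_min_def)
  have "norm (\<Sum>p\<in>?S. f (Np p) / of_real (Np p) * ?s (primes_le p) (y / Np p)) \<le> (\<Sum>p\<in>?S. B * mu_bound * (1 / Np p))"
  proof (rule sum_norm_le)
    fix p assume "p \<in> ?S"
    then have p: "Np p > 1" using S prime_norm_gt_1 by auto
    have "norm (f (Np p)) / Np p * norm (?s (primes_le p) (y / Np p)) \<le> B / Np p * mu_bound"
      using p B by (intro mult_mono divide_right_mono f norm_moebius_sum_le) auto
    then show "norm (f (Np p) / of_real (Np p) * ?s (primes_le p) (y / Np p)) \<le> B * mu_bound * (1 / Np p)"
      using p by (simp add: norm_mult norm_divide)
  qed
  also have "\<dots> = B * mu_bound * (\<Sum>p\<in>?S. 1 / Np p)" by (simp add: sum_distrib_left)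
  also have "(\<Sum>p\<in>?S. 1 / Np p) \<le> (\<Sum>p | p \<in> P \<and> Np p \<le> nm k. 1 / Np p)"
  proof (rule sum_mono2)
    show "?S \<subseteq> {p \<in> P. Np p \<le> nm k}" using S prime_le_nm[OF k qk] by auto
    show "1 / Np p \<ge> 0" if "p \<in> {p \<in> P. Np p \<le> nm k} - ?S" for p
      using that prime_norm_gt_1[of p] by auto
  qed (rule finite_primes_le)
  finally have 1: "norm (\<Sum>p\<in>?S. f (Np p) / of_real (Np p) * ?s (primes_le p) (y / Np p))
      \<le> B * mu_bound * (\<Sum>p | p \<in> P \<and> Np p \<le> nm k. 1 / Np p)"
    using B mu_bound_nonneg by (simp add: mult_left_mono)
  have "q \<in> P" using q S by auto
  then have "norm (f (Np q) * ?s (primes_le q - {q}) y) \<le> B * mu_bound"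
    unfolding norm_mult using B prime_norm_gt_1[of q] by (intro mult_mono f norm_moebius_sum_le) auto
  then show ?thesis
    unfolding shifted_sum_eq[OF q k S] distrib_left mult_1_right using 1
    by (intro order.trans[OF norm_triangle_ineq] add_mono) (simp_all only: norm_minus_cancel)
qed

section \<open>Comparing the sums in (ii) and (iii)\<close>

lemma sum_convolution_eq:
  assumes a1: "a {#} = 1" and x: "x \<ge> 1"
  shows "(\<Sum>g\<in>elems x. gconv gmoebius a g * dset_weight f S g / of_real (nm g))
    = (\<Sum>g\<in>elems x. gmoebius g * dset_weight f S g / of_real (nm g))
      + (\<Sum>k\<in>elems x - {{#}}. a k / of_real (nm k) * shifted_sum f S k (x / nm k))"
proof -
  define u where "u k h = a k * gmoebius h * dset_weight f S (k + h) / of_real (nm (k + h))" for k h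
  have "gconv gmoebius a g * dset_weight f S g / of_real (nm g) = (\<Sum>k | k \<subseteq># g. u k (g - k))" for g
    unfolding gconv_commute sum_distrib_right sum_divide_distrib by (intro sum.cong refl) (simp add: u_def)
  then have "(\<Sum>g\<in>elems x. gconv gmoebius a g * dset_weight f S g / of_real (nm g))
      = (\<Sum>g\<in>elems x. \<Sum>k | k \<subseteq># g. u k (g - k))" by simp
  also have "\<dots> = (\<Sum>k\<in>elems x. \<Sum>h\<in>elems (x / nm k). u k h)" by (rule sum_divisors_swap)
  also have "\<dots> = (\<Sum>k\<in>elems x. a k / of_real (nm k) * shifted_sum f S k (x / nm k))"
    unfolding shifted_sum_def sum_distrib_left
    by (intro sum.cong refl) (simp add: u_def gnorm_add add.commute)
  also have "\<dots> = a {#} / of_real (nm {#}) * shifted_sum f S {#} (x / nm {#})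
      + (\<Sum>k\<in>elems x - {{#}}. a k / of_real (nm k) * shifted_sum f S k (x / nm k))"
    using x by (intro sum.remove) (auto simp: elems_def finite_elems[unfolded elems_def])
  finally show ?thesis using a1 by (simp add: shifted_sum_def)
qed

lemma convolution_remainder_tendsto_0:
  assumes f: "\<And>x. x \<ge> 1 \<Longrightarrow> norm (f x) \<le> B" and S: "S \<subseteq> P"
    and supp: "\<forall>g\<in>gelems P. g \<notin> Dset P Np S \<longrightarrow> a g = 0"
    and conv: "((\<lambda>x. \<Sum>g\<in>{g \<in> Dset P Np S. 2 \<le> nm g \<and> nm g \<le> x}. norm (a g) / nm g * ln (ln (nm g))) \<longlongrightarrow> L) at_top"
  shows "((\<lambda>x. \<Sum>k\<in>elems x - {{#}}. a k / of_real (nm k) * shifted_sum f S k (x / nm k)) \<longlongrightarrow> 0) at_top"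
proof (rule tendstoI)
  fix r :: real assume r: "r > 0"
  have B: "B \<ge> 0" using order.trans[OF norm_ge_zero f[of 1]] by simp
  \<comment> \<open>Absorbs all additive constants of \<open>sum_inverse_primes_le\<close> into a
    multiple of log log, which is possible once log log is at least 1.\<close>
  define D where "D = exp 1 * (\<bar>ln (3 * C)\<bar> + 1) + 1"
  have D: "D > 0" by (simp add: D_def add_nonneg_pos)
  define M where "M = B * mu_bound * D + 1"
  have M: "M > 0" using B mu_bound_nonneg D by (simp add: M_def add_nonneg_pos)
  have obt: "\<exists>q\<in>S. strict_min Np q k" if "k \<in> gelems P" "k \<noteq> {#}" "a k \<noteq> 0" for k
    using supp that by (auto simp: Dset_iff)
  let ?t = "\<lambda>k x. a k / of_real (nm k) * shifted_sum f S k (x / nm k)"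
  let ?v = "\<lambda>g. norm (a g) / nm g * ln (ln (nm g))"
  let ?V = "\<lambda>x. \<Sum>g\<in>{g \<in> Dset P Np S. 2 \<le> nm g \<and> nm g \<le> x}. ?v g"
  have "\<forall>\<^sub>F x in at_top. dist (?V x) L < r / (4 * M)"
    using tendstoD[OF conv, of "r / (4 * M)"] r M by simp
  then obtain X1 where X1: "\<And>x. x \<ge> X1 \<Longrightarrow> dist (?V x) L < r / (4 * M)"
    by (auto simp: eventually_at_top_linorder)
  \<comment> \<open>Beyond exp (exp 1) the weight log log is at least 1, whereas it is negative for
    norms below e. As \<open>X0 \<ge> 2\<close>, elements of norm below 2, which the hypothesis does
    not see, fall into the finite head.\<close>
  define X0 where "X0 = max X1 (exp (exp 1))"
  have X0: "X0 \<ge> X1" "X0 \<ge> exp (exp 1)" by (simp_all add: X0_def)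
  have "(2 :: real) \<le> exp 1" using exp_ge_add_one_self[of 1] by simp
  also have "\<dots> \<le> exp (exp 1)" by simp
  finally have X02: "X0 \<ge> 2" using X0 by simp
  have ll: "ln (ln z) \<ge> 1" if "z \<ge> X0" for z
  proof -
    have z: "z \<ge> exp (exp 1)" using that X0 by simp
    then have z0: "z > 0" by (rule less_le_trans[rotated]) simp
    have "ln z \<ge> exp 1" using z z0 by (simp add: ln_ge_iff)
    moreover from this have "ln z > 0" by (rule less_le_trans[rotated]) simp
    ultimately show ?thesis by (simp add: ln_ge_iff)
  qed
  have term_le: "norm (?t k x) \<le> M * ?v k" if k: "k \<in> gelems P" "nm k > X0" for k x
  proof (cases "a k = 0")
    case False
    have "k \<noteq> {#}" using k X02 by auto
    then obtain q where q: "q \<in> S" "strict_min Np q k" using obt[OF k(1)] False by blast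
    have z: "nm k \<ge> X0" using k by simp
    note l1 = ll[OF z]
    have "exp 1 \<le> exp (exp (1 :: real))" using exp_ge_add_one_self[of "1 :: real"] by simp
    then have "nm k \<ge> exp 1" using z X0 by linarith
    then have "(\<Sum>p | p \<in> P \<and> Np p \<le> nm k. 1 / Np p) + 1 \<le> exp 1 * (ln (3 * C) + ln (ln (nm k))) + 1"
      using sum_inverse_primes_le by simp
    also have "\<dots> \<le> exp 1 * (\<bar>ln (3 * C)\<bar> * ln (ln (nm k)) + ln (ln (nm k))) + ln (ln (nm k))"
      using l1 mult_left_mono[OF l1, of "\<bar>ln (3 * C)\<bar>"] by (intro add_mono mult_left_mono) auto
    also have "\<dots> = D * ln (ln (nm k))" by (simp add: D_def algebra_simps)
    finally have R: "(\<Sum>p | p \<in> P \<and> Np p \<le> nm k. 1 / Np p) + 1 \<le> D * ln (ln (nm k))" .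
    have "norm (shifted_sum f S k (x / nm k)) \<le> B * mu_bound * ((\<Sum>p | p \<in> P \<and> Np p \<le> nm k. 1 / Np p) + 1)"
      by (rule norm_shifted_sum_le[OF q k(1) S f])
    also have "\<dots> \<le> B * mu_bound * (D * ln (ln (nm k)))"
      using R B mu_bound_nonneg by (intro mult_left_mono) auto
    also have "\<dots> \<le> M * ln (ln (nm k))" using l1 by (simp add: M_def algebra_simps)
    finally have "norm (shifted_sum f S k (x / nm k)) \<le> M * ln (ln (nm k))" .
    then have "norm (a k) / nm k * norm (shifted_sum f S k (x / nm k)) \<le> norm (a k) / nm k * (M * ln (ln (nm k)))"
      using nm_pos[OF k(1)] by (intro mult_left_mono) auto
    then show ?thesis using nm_pos[OF k(1)] by (simp add: norm_mult norm_divide mult_ac)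
  qed simp
  \<comment> \<open>The convergent weighted sum enters as a Cauchy criterion: both
    \<open>?V x\<close> and \<open>?V X0\<close> are within r / (4 M) of L, and M times their
    difference dominates the tail for every x at once.\<close>
  have tail: "norm (\<Sum>k\<in>elems x - elems X0. ?t k x) < r / 2" if x: "x \<ge> X0" for x
  proof -
    have "norm (\<Sum>k\<in>elems x - elems X0. ?t k x) \<le> (\<Sum>k\<in>elems x - elems X0. M * ?v k)"
      by (intro sum_norm_le term_le) (auto simp: elems_def)
    also have "\<dots> = M * (\<Sum>k\<in>elems x - elems X0. ?v k)" by (simp add: sum_distrib_left)
    also have "(\<Sum>k\<in>elems x - elems X0. ?v k) = ?V x - ?V X0"
    proof -
      let ?G = "\<lambda>x. {g \<in> Dset P Np S. 2 \<le> nm g \<and> nm g \<le> x}"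
      have fin: "finite (?G x)" for x
        by (rule finite_subset[OF _ finite_elems[of x]]) (use Dset_subset_gelems in \<open>auto simp: elems_def\<close>)
      have "?V x = (\<Sum>g\<in>?G x - ?G X0. ?v g) + ?V X0"
        by (rule sum.subset_diff) (use x fin in auto)
      moreover have "(\<Sum>g\<in>?G x - ?G X0. ?v g) = (\<Sum>k\<in>elems x - elems X0. ?v k)"
      proof (rule sum.mono_neutral_left)
        show "?G x - ?G X0 \<subseteq> elems x - elems X0" using Dset_subset_gelems by (auto simp: elems_def)
        show "\<forall>k\<in>(elems x - elems X0) - (?G x - ?G X0). ?v k = 0"
        proof
          fix k assume "k \<in> (elems x - elems X0) - (?G x - ?G X0)"
          then have "k \<in> gelems P" "k \<notin> Dset P Np S" using X02 by (auto simp: elems_def)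
          then show "?v k = 0" using supp by simp
        qed
      qed simp
      ultimately show ?thesis by simp
    qed
    also have "M * (?V x - ?V X0) < M * (r / (2 * M))"
    proof (rule mult_strict_left_mono[OF _ M])
      have "dist (?V x) L < r / (4 * M)" "dist (?V X0) L < r / (4 * M)" using X1 x X0 by auto
      then have "?V x - ?V X0 < r / (4 * M) + r / (4 * M)" unfolding dist_real_def by linarith
      also have "\<dots> = r / (2 * M)" by simp
      finally show "?V x - ?V X0 < r / (2 * M)" .
    qed
    finally show ?thesis using M by simp
  qed
  have head: "((\<lambda>x. \<Sum>k\<in>elems X0 - {{#}}. ?t k x) \<longlongrightarrow> (\<Sum>k\<in>elems X0 - {{#}}. 0)) at_top"
  proof (rule tendsto_sum)
    fix k assume "k \<in> elems X0 - {{#}}"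
    then have k: "k \<in> gelems P" "k \<noteq> {#}" by (auto simp: elems_def)
    show "(?t k \<longlongrightarrow> 0) at_top"
    proof (cases "a k = 0")
      case False
      then obtain q where q: "q \<in> S" "strict_min Np q k" using obt[OF k] by blast
      have "filterlim (\<lambda>x. (1 / nm k) * x) at_top at_top"
        using nm_pos[OF k(1)] by (intro filterlim_tendsto_pos_mult_at_top[OF tendsto_const] filterlim_ident) auto
      then have "filterlim (\<lambda>x. x / nm k) at_top at_top" by simp
      from filterlim_compose[OF shifted_sum_tendsto_0[OF q k(1) S] this]
      show ?thesis by (rule tendsto_mult_right_zero)
    qed simp
  qed
  have "\<forall>\<^sub>F x in at_top. norm (\<Sum>k\<in>elems X0 - {{#}}. ?t k x) < r / 2"
    using tendstoD[OF head, of "r / 2"] r by simp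
  then show "\<forall>\<^sub>F x in at_top. dist (\<Sum>k\<in>elems x - {{#}}. ?t k x) 0 < r"
    using eventually_ge_at_top[of X0]
  proof eventually_elim
    case (elim x)
    have "{#} \<in> elems X0" using X02 by (simp add: elems_def)
    then have "elems x - {{#}} = (elems X0 - {{#}}) \<union> (elems x - elems X0)"
      using elems_mono[OF elim(2)] by auto
    then have "(\<Sum>k\<in>elems x - {{#}}. ?t k x) = (\<Sum>k\<in>elems X0 - {{#}}. ?t k x) + (\<Sum>k\<in>elems x - elems X0. ?t k x)"
      by (simp only:) (rule sum.union_disjoint, auto)
    then have "norm (\<Sum>k\<in>elems x - {{#}}. ?t k x) \<le> norm (\<Sum>k\<in>elems X0 - {{#}}. ?t k x) + norm (\<Sum>k\<in>elems x - elems X0. ?t k x)"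
      by (simp only: norm_triangle_ineq)
    then show ?case using elim(1) tail[OF elim(2)] by (simp add: dist_norm)
  qed
qed

lemma smallest_prime_iff_convolution:
  assumes f: "\<And>x. x \<ge> 1 \<Longrightarrow> norm (f x) \<le> B" and S: "S \<subseteq> P"
    and supp: "\<forall>g\<in>gelems P. g \<notin> Dset P Np S \<longrightarrow> a g = 0" and a1: "a {#} = 1"
    and conv: "((\<lambda>x. \<Sum>g\<in>{g \<in> Dset P Np S. 2 \<le> nm g \<and> nm g \<le> x}. norm (a g) / nm g * ln (ln (nm g))) \<longlongrightarrow> L) at_top"
  shows "((\<lambda>x. \<Sum>g\<in>elems x. gmoebius g * dset_weight f S g / of_real (nm g)) \<longlongrightarrow> l) at_top
    \<longleftrightarrow> ((\<lambda>x. \<Sum>g\<in>elems x. gconv gmoebius a g * dset_weight f S g / of_real (nm g)) \<longlongrightarrow> l) at_top"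
proof -
  let ?T = "\<lambda>x. \<Sum>g\<in>elems x. gmoebius g * dset_weight f S g / of_real (nm g)"
  let ?R = "\<lambda>x. \<Sum>k\<in>elems x - {{#}}. a k / of_real (nm k) * shifted_sum f S k (x / nm k)"
  have R: "(?R \<longlongrightarrow> 0) at_top" by (rule convolution_remainder_tendsto_0[OF f S supp conv])
  have "((\<lambda>x. \<Sum>g\<in>elems x. gconv gmoebius a g * dset_weight f S g / of_real (nm g)) \<longlongrightarrow> l) at_top
      \<longleftrightarrow> ((\<lambda>x. ?T x + ?R x) \<longlongrightarrow> l) at_top"
    by (intro tendsto_cong eventually_mono[OF eventually_ge_at_top[of 1]]) (rule sum_convolution_eq[of a, OF a1])
  also have "\<dots> \<longleftrightarrow> (?T \<longlongrightarrow> l) at_top"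
  proof
    assume "((\<lambda>x. ?T x + ?R x) \<longlongrightarrow> l) at_top"
    from tendsto_diff[OF this R] show "(?T \<longlongrightarrow> l) at_top" by simp
  next
    assume "(?T \<longlongrightarrow> l) at_top"
    from tendsto_add[OF this R] show "((\<lambda>x. ?T x + ?R x) \<longlongrightarrow> l) at_top" by simp
  qed
  finally show ?thesis by simp
qed

end

section \<open>From Axiom A to explicit constants, and conclusion\<close>

lemma axiomA_imp_arithmetical_semigroup:
  assumes sg: "arith_semigroup P Np" and A: "axiomA P Np c"
  shows "\<exists>\<eta> K. arithmetical_semigroup P Np c \<eta> K"
proof -
  obtain \<eta> where c: "c > 0" and \<eta>: "0 < \<eta>" "\<eta> < 1"
    and O: "(\<lambda>x. real (countN P Np x) - c * x) \<in> O[at_top](\<lambda>x. x powr \<eta>)"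
    using A by (auto simp: axiomA_def)
  obtain D where D: "D > 0" "\<forall>\<^sub>F x in at_top. norm (real (countN P Np x) - c * x) \<le> D * norm (x powr \<eta>)"
    using O by (rule landau_o.bigE)
  then obtain x0 where x0: "\<And>x. x \<ge> x0 \<Longrightarrow> \<bar>real (countN P Np x) - c * x\<bar> \<le> D * x powr \<eta>"
    by (auto simp: eventually_at_top_linorder)
  \<comment> \<open>Axiom A speaks only of large x. Between 1 and x0 the count is monotone, hence
    bounded, and x powr \<eta> \<ge> 1, so a larger constant covers this range as well.\<close>
  define K where "K = max D (real (countN P Np x0) + c * \<bar>x0\<bar>)"
  have "\<bar>real (countN P Np x) - c * x\<bar> \<le> K * x powr \<eta>" if x: "x \<ge> 1" for x
  proof (cases "x \<ge> x0")
    case True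
    then have "\<bar>real (countN P Np x) - c * x\<bar> \<le> D * x powr \<eta>" by (rule x0)
    also have "\<dots> \<le> K * x powr \<eta>" by (intro mult_right_mono) (auto simp: K_def)
    finally show ?thesis .
  next
    case False
    have "countN P Np x \<le> countN P Np x0"
      unfolding countN_def using False sg by (intro card_mono) (auto simp: arith_semigroup_def)
    moreover have "0 \<le> c * x" "c * x \<le> c * \<bar>x0\<bar>" using c x False by auto
    ultimately have "\<bar>real (countN P Np x) - c * x\<bar> \<le> real (countN P Np x0) + c * \<bar>x0\<bar>"
      by (simp add: abs_le_iff)
    also have "\<dots> \<le> K * 1" by (simp add: K_def)
    also have "\<dots> \<le> K * x powr \<eta>"
      using x \<eta> D(1) by (intro mult_left_mono ge_one_powr_ge_zero) (auto simp: K_def)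
    finally show ?thesis .
  qed
  then show ?thesis using sg c \<eta> by (auto simp: arithmetical_semigroup_def)
qed

theorem theorem3p7:
  fixes P S :: "'p set" and Np :: "'p \<Rightarrow> real" and c d :: real
    and f :: "real \<Rightarrow> complex" and a :: "'p multiset \<Rightarrow> complex"
  assumes "arith_semigroup P Np"
    and "axiomA P Np c"
    and "S \<subseteq> P"
    and "has_nat_density P Np S d"
    and "\<exists>B. \<forall>x\<ge>1. norm (f x) \<le> B"
    and "f 1 = 0"
    and "\<forall>g\<in>gelems P. g \<notin> Dset P Np S \<longrightarrow> a g = 0"
    and "a {#} = 1"
    and "\<exists>L. ((\<lambda>x. \<Sum>g\<in>{g \<in> Dset P Np S. 2 \<le> gnorm Np g \<and> gnorm Np g \<le> x}.
                  norm (a g) / gnorm Np g * ln (ln (gnorm Np g))) \<longlongrightarrow> L) at_top"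
  shows "(((\<lambda>x. (\<Sum>g\<in>{g \<in> gelems P. gnorm Np g \<le> x}. of_nat (QS Np S g) * f (Nplus Np g))
              - complex_of_real (c * d * x)) \<in> o[at_top](\<lambda>x. complex_of_real x))
       \<longleftrightarrow> ((\<lambda>x. \<Sum>g\<in>{g \<in> Dset P Np S. g \<noteq> {#} \<and> gnorm Np g \<le> x}.
                 gmoebius g * f (Nminus Np g) / complex_of_real (gnorm Np g))
             \<longlongrightarrow> - complex_of_real d) at_top)
    \<and> (((\<lambda>x. \<Sum>g\<in>{g \<in> Dset P Np S. g \<noteq> {#} \<and> gnorm Np g \<le> x}.
                 gmoebius g * f (Nminus Np g) / complex_of_real (gnorm Np g))
             \<longlongrightarrow> - complex_of_real d) at_top
       \<longleftrightarrow> ((\<lambda>x. \<Sum>g\<in>{g \<in> Dset P Np S. g \<noteq> {#} \<and> gnorm Np g \<le> x}.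
                 gconv gmoebius a g * f (Nminus Np g) / complex_of_real (gnorm Np g))
             \<longlongrightarrow> - complex_of_real d) at_top)"
proof -
  obtain \<eta> K where "arithmetical_semigroup P Np c \<eta> K"
    using axiomA_imp_arithmetical_semigroup assms(1,2) by blast
  then interpret arithmetical_semigroup P Np c \<eta> K .
  obtain B where B: "\<And>x. x \<ge> 1 \<Longrightarrow> norm (f x) \<le> B" using assms(5) by blast
  obtain L where L: "((\<lambda>x. \<Sum>g\<in>{g \<in> Dset P Np S. 2 \<le> nm g \<and> nm g \<le> x}. norm (a g) / nm g * ln (ln (nm g))) \<longlongrightarrow> L) at_top"
    using assms(9) by blast
  have elems: "{g \<in> gelems P. nm g \<le> x} = elems x" for x by (simp add: elems_def)
  \<comment> \<open>Extending the weights by 0 brings the sums over D(G, S) to the index set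
    \<open>elems x\<close> used for (i), and (ii) takes the same form in both equivalences.\<close>
  show ?thesis
    unfolding sum_Dset_eq elems
    using largest_prime_iff_smallest_prime[of f B S d, OF B assms(3)]
      smallest_prime_iff_convolution[of f B S a L "- complex_of_real d", OF B assms(3,7,8) L]
    unfolding dual_weight_dset_weight by blast
qed

end
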